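(* Let the smoothness parameters $\alpha>\frac12$ and $\beta\le0$ with $\alpha+\beta>\frac12$, and $2<q<\infty$. Let the dimension $d\in\mathbb{N}$, $d\ge2$, and the refinement $R\ge1$ be given. Assume that $\Lambda(\boldsymbol z,M)$ is a reconstructing rank-1 lattice for $H_R^{d,0}$ constructed by the CBC strategy. Then $$\big\|\mathrm{Id}-S_{H_R^{d,0}}^{\Lambda(\boldsymbol z,M)}\big|\mathcal{H}^{\alpha,\beta}(\mathbb{T}^d)\to L_q(\mathbb{T}^d)\big\|\lesssim 2^{-(\alpha+\beta-(\frac12-\frac1q))R}\begin{cases}R^{(d-1)/2}&:\ \beta=0,\\1&:\ \beta<0\end{cases}$$ $$\lesssim M^{-(\alpha+\beta-(\frac12-\frac1q))/2}(\log M)^{\frac{d-2}{2}(\alpha+\beta-(\frac12-\frac1q))}\begin{cases}(\log M)^{(d-1)/2}&:\ \beta=0,\\1&:\ \beta<0.\end{cases}$$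
   Context: $\mathbb{T}=[0,1)$ is the torus, $\hat f_{\boldsymbol k}=\int_{\mathbb{T}^d}f(\boldsymbol x)e^{-2\pi i\boldsymbol k\cdot\boldsymbol x}\,d\boldsymbol x$. For real $\alpha,\beta$, $\mathcal{H}^{\alpha,\beta}(\mathbb{T}^d)$ is the space of $f\in L_2(\mathbb{T}^d)$ with finite norm $$\|f|\mathcal{H}^{\alpha,\beta}(\mathbb{T}^d)\|^2=\sum_{\boldsymbol k\in\mathbb{Z}^d}|\hat f_{\boldsymbol k}|^2(1+\|\boldsymbol k\|_2^2)^{\beta}\prod_{s=1}^d(1+|k_s|^2)^{\alpha}.$$ Under the hypotheses elements of $\mathcal{H}^{\alpha,\beta}(\mathbb{T}^d)$ are continuous (after choosing the continuous representative). Hyperbolic cross: $Q_0=\{-1,0,1\}$, $Q_j=([-2^j,-2^{j-1}-1]\cup[2^{j-1}+1,2^j])\cap\mathbb{Z}$ for $j\ge1$, $Q_{\boldsymbol j}=Q_{j_1}\times\dots\times Q_{j_d}$, $J_R^{d,0}=\{\boldsymbol j\in\mathbb{N}_0^d:\|\boldsymbol j\|_1\le R+d-1\}$, $H_R^{d,0}=\bigcup_{\boldsymbol j\in J_R^{d,0}}Q_{\boldsymbol j}$. For $\boldsymbol z\in\mathbb{Z}^d$, $M\in\mathbb{N}$, the rank-1 lattice with generating vector $\boldsymbol z$ and size $M$ is $\Lambda(\boldsymbol z,M)=\{\frac jM\boldsymbol z\bmod\boldsymbol 1:j=0,\dots,M-1\}$. For finite $I\subset\mathbb{Z}^d$ the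 sampling operator is $$S_I^{\Lambda(\boldsymbol z,M)}f=\sum_{\boldsymbol k\in I}\hat f_{\boldsymbol k}^{\Lambda(\boldsymbol z,M)}e^{2\pi i\boldsymbol k\cdot\circ},\qquad \hat f_{\boldsymbol k}^{\Lambda(\boldsymbol z,M)}=\frac1M\sum_{j=0}^{M-1}f\big(\tfrac jM\boldsymbol z\big)e^{-2\pi i\frac jM\boldsymbol k\cdot\boldsymbol z}.$$ $\Lambda(\boldsymbol z,M)$ is a reconstructing rank-1 lattice for $I$ if $S_I^{\Lambda(\boldsymbol z,M)}p=p$ for all trigonometric polynomials $p$ with frequencies in $I$; equivalently $\boldsymbol k^1\cdot\boldsymbol z\not\equiv\boldsymbol k^2\cdot\boldsymbol z\pmod M$ for all distinct $\boldsymbol k^1,\boldsymbol k^2\in I$. The CBC (component-by-component) strategy is the search algorithm of Table 3.1 in L. Kämmerer's dissertation: it constructs the generating vector $\boldsymbol z$ of a reconstructing rank-1 lattice component by component, iteratively increasing the dimension of the index set for which the reconstruction property should hold. With it one can explicitly construct reconstructing rank-1 lattices for $H_R^{d,0}$ of size $2^{2R-2}\le M\lesssim 2^{2R}R^{d-2}$. $\|A|X\to Y\|$ is the operator norm; $a\lesssim b$ means $a\le c\,b$ with a constant $c>0$ independent of $R,\boldsymbol z,M$. *)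

theory Defs
  imports "HOL-Analysis.Analysis"
begin

text \<open>
  Vectors with \<open>d\<close> components are functions on \<open>{..<d}\<close>, extended by \<^const>\<open>undefined\<close>: the dimension
  is a number and not a type because the component-by-component strategy passes through the dimensions
  \<open>1, \<dots>, d\<close>. The topology of \<open>nat \<Rightarrow> real\<close> is the product topology, so on \<open>real_vecs d\<close> it induces
  the Euclidean topology.
\<close>

definition real_vecs :: "nat \<Rightarrow> (nat \<Rightarrow> real) set" where
  "real_vecs d = (\<Pi>\<^sub>E s\<in>{..<d}. UNIV)"

definition int_vecs :: "nat \<Rightarrow> (nat \<Rightarrow> int) set" where
  "int_vecs d = (\<Pi>\<^sub>E s\<in>{..<d}. UNIV)"

definition nat_vecs :: "nat \<Rightarrow> (nat \<Rightarrow> nat) set" where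
  "nat_vecs d = (\<Pi>\<^sub>E s\<in>{..<d}. UNIV)"

definition torus :: "nat \<Rightarrow> (nat \<Rightarrow> real) measure" where
  "torus d = (\<Pi>\<^sub>M s\<in>{..<d}. restrict_space lborel {0..<1})"

definition trig :: "nat \<Rightarrow> (nat \<Rightarrow> int) \<Rightarrow> (nat \<Rightarrow> real) \<Rightarrow> complex" where
  "trig d k x = cis (2 * pi * (\<Sum>s<d. real_of_int (k s) * x s))"

definition fourier_coeff :: "nat \<Rightarrow> ((nat \<Rightarrow> real) \<Rightarrow> complex) \<Rightarrow> (nat \<Rightarrow> int) \<Rightarrow> complex" where
  "fourier_coeff d f k =
     (\<integral>x. f x * cis (- 2 * pi * (\<Sum>s<d. real_of_int (k s) * x s)) \<partial>torus d)"


subsection \<open>Function spaces and norms\<close>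

text \<open>Functions rather than classes of functions are used; all norms below are invariant under
  modification on a null set.\<close>

definition L2_space :: "nat \<Rightarrow> ((nat \<Rightarrow> real) \<Rightarrow> complex) set" where
  "L2_space d = {f \<in> borel_measurable (torus d). integrable (torus d) (\<lambda>x. (norm (f x))\<^sup>2)}"

definition Lq_norm :: "nat \<Rightarrow> real \<Rightarrow> ((nat \<Rightarrow> real) \<Rightarrow> complex) \<Rightarrow> ennreal" where
  "Lq_norm d q f =
     (if f \<in> borel_measurable (torus d) \<and> integrable (torus d) (\<lambda>x. norm (f x) powr q)
      then ennreal ((\<integral>x. norm (f x) powr q \<partial>torus d) powr (1 / q)) else \<infinity>)"

definition hybrid_term ::
  "nat \<Rightarrow> real \<Rightarrow> real \<Rightarrow> ((nat \<Rightarrow> real) \<Rightarrow> complex) \<Rightarrow> (nat \<Rightarrow> int) \<Rightarrow> real" where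
  "hybrid_term d \<alpha> \<beta> f k =
     (norm (fourier_coeff d f k))\<^sup>2 * (1 + (\<Sum>s<d. (real_of_int (k s))\<^sup>2)) powr \<beta>
       * (\<Prod>s<d. (1 + (real_of_int (k s))\<^sup>2) powr \<alpha>)"

definition hybrid_space :: "nat \<Rightarrow> real \<Rightarrow> real \<Rightarrow> ((nat \<Rightarrow> real) \<Rightarrow> complex) set" where
  "hybrid_space d \<alpha> \<beta> = {f \<in> L2_space d. hybrid_term d \<alpha> \<beta> f summable_on int_vecs d}"

definition hybrid_norm :: "nat \<Rightarrow> real \<Rightarrow> real \<Rightarrow> ((nat \<Rightarrow> real) \<Rightarrow> complex) \<Rightarrow> real" where
  "hybrid_norm d \<alpha> \<beta> f = sqrt (\<Sum>\<^sub>\<infinity>k\<in>int_vecs d. hybrid_term d \<alpha> \<beta> f k)"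

text \<open>A continuous function on the torus is a continuous function on the whole space that has
  period 1 in every component.\<close>

definition torus_continuous :: "nat \<Rightarrow> ((nat \<Rightarrow> real) \<Rightarrow> complex) \<Rightarrow> bool" where
  "torus_continuous d g \<longleftrightarrow> continuous_on (real_vecs d) g \<and>
     (\<forall>x\<in>real_vecs d. \<forall>s<d. g (x(s := x s + 1)) = g x)"

text \<open>If a continuous representative exists, it is unique on \<open>real_vecs d\<close>.\<close>

definition continuous_rep ::
  "nat \<Rightarrow> ((nat \<Rightarrow> real) \<Rightarrow> complex) \<Rightarrow> (nat \<Rightarrow> real) \<Rightarrow> complex" where
  "continuous_rep d f = (SOME g. torus_continuous d g \<and> (AE x in torus d. g x = f x))"

text \<open>The values lie in \<^typ>\<open>ennreal\<close>, so that an unbounded operator has norm \<open>\<infinity>\<close>.\<close>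

definition op_norm :: "'a set \<Rightarrow> ('a \<Rightarrow> real) \<Rightarrow> ('b \<Rightarrow> ennreal) \<Rightarrow> ('a \<Rightarrow> 'b) \<Rightarrow> ennreal" where
  "op_norm X normX normY T = (SUP f\<in>{f \<in> X. normX f \<le> 1}. normY (T f))"


subsection \<open>Hyperbolic crosses\<close>

definition Q :: "nat \<Rightarrow> int set" where
  "Q j = (if j = 0 then {-1, 0, 1}
          else {- (2 ^ j) .. - (2 ^ (j - 1)) - 1} \<union> {2 ^ (j - 1) + 1 .. 2 ^ j})"

definition J :: "nat \<Rightarrow> real \<Rightarrow> (nat \<Rightarrow> nat) set" where
  "J d R = {j \<in> nat_vecs d. real (\<Sum>s<d. j s) \<le> R + real d - 1}"

definition hyp_cross :: "nat \<Rightarrow> real \<Rightarrow> (nat \<Rightarrow> int) set" where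
  "hyp_cross d R = (\<Union>j\<in>J d R. \<Pi>\<^sub>E s\<in>{..<d}. Q (j s))"


subsection \<open>Sampling along rank-1 lattices\<close>

text \<open>The nodes are not reduced modulo 1, since only periodic functions are sampled.\<close>

definition lattice_node :: "nat \<Rightarrow> (nat \<Rightarrow> int) \<Rightarrow> nat \<Rightarrow> nat \<Rightarrow> nat \<Rightarrow> real" where
  "lattice_node d z M j = (\<lambda>s\<in>{..<d}. real j / real M * real_of_int (z s))"

definition lattice_coeff ::
  "nat \<Rightarrow> (nat \<Rightarrow> int) \<Rightarrow> nat \<Rightarrow> ((nat \<Rightarrow> real) \<Rightarrow> complex) \<Rightarrow> (nat \<Rightarrow> int) \<Rightarrow> complex" where
  "lattice_coeff d z M f k =
     1 / of_nat M * (\<Sum>j<M. f (lattice_node d z M j)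
        * cis (- 2 * pi * (real j / real M) * (\<Sum>s<d. real_of_int (k s) * real_of_int (z s))))"

definition sampling_op ::
  "nat \<Rightarrow> (nat \<Rightarrow> int) set \<Rightarrow> (nat \<Rightarrow> int) \<Rightarrow> nat \<Rightarrow> ((nat \<Rightarrow> real) \<Rightarrow> complex)
    \<Rightarrow> (nat \<Rightarrow> real) \<Rightarrow> complex" where
  "sampling_op d I z M f x = (\<Sum>k\<in>I. lattice_coeff d z M f k * trig d k x)"

definition trig_poly ::
  "nat \<Rightarrow> (nat \<Rightarrow> int) set \<Rightarrow> ((nat \<Rightarrow> int) \<Rightarrow> complex) \<Rightarrow> (nat \<Rightarrow> real) \<Rightarrow> complex" where
  "trig_poly d I c x = (\<Sum>k\<in>I. c k * trig d k x)"

definition reconstructing :: "nat \<Rightarrow> (nat \<Rightarrow> int) set \<Rightarrow> (nat \<Rightarrow> int) \<Rightarrow> nat \<Rightarrow> bool" where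
  "reconstructing d I z M \<longleftrightarrow> z \<in> int_vecs d \<and> 0 < M \<and>
     (\<forall>c. \<forall>x\<in>real_vecs d. sampling_op d I z M (trig_poly d I c) x = trig_poly d I c x)"


subsection \<open>The component-by-component strategy\<close>

definition proj_freqs :: "nat \<Rightarrow> (nat \<Rightarrow> int) set \<Rightarrow> (nat \<Rightarrow> int) set" where
  "proj_freqs s I = (\<lambda>k. restrict k {..<s}) ` I"

text \<open>
  \<open>cbc_search I M s z\<close>: the first \<open>s\<close> steps of the search, run on the index set \<open>I\<close> with lattice size
  \<open>M\<close>, can produce the components \<open>z 0, \<dots>, z (s - 1)\<close>. Every step keeps the components already found
  and appends one for which the reconstruction property holds on the projection of \<open>I\<close> to one more
  dimension. Any such component may be chosen, so the order of the search is irrelevant.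
\<close>

inductive cbc_search :: "(nat \<Rightarrow> int) set \<Rightarrow> nat \<Rightarrow> nat \<Rightarrow> (nat \<Rightarrow> int) \<Rightarrow> bool"
  for I :: "(nat \<Rightarrow> int) set" and M :: nat where
  start: "cbc_search I M 0 (\<lambda>_. undefined)"
| extend: "\<lbrakk>cbc_search I M s z; reconstructing (Suc s) (proj_freqs (Suc s) I) (z(s := a)) M\<rbrakk>
     \<Longrightarrow> cbc_search I M (Suc s) (z(s := a))"

text \<open>
  The search takes the lattice size \<open>M\<close> as given. The strategy runs it with sizes of order
  \<open>2\<^bsup>2R\<^esup> R\<^bsup>d-2\<^esup>\<close>, for which it can succeed (Kaemmerer); \<open>K\<close> is the constant in this size guarantee. The
  matching lower bound for \<open>M\<close> is not required, as it follows from the reconstruction property.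
\<close>

definition cbc_constructed :: "real \<Rightarrow> nat \<Rightarrow> real \<Rightarrow> (nat \<Rightarrow> int) \<Rightarrow> nat \<Rightarrow> bool" where
  "cbc_constructed K d R z M \<longleftrightarrow>
     cbc_search (hyp_cross d R) M d z \<and> real M \<le> K * 2 powr (2 * R) * R powr (real d - 2)"

end

theory Submission
  imports Defs "HOL-Probability.Probability_Measure"
begin

text \<open>
  On finite trigonometric polynomials the sampling error splits into the frequencies outside the
  hyperbolic cross and the aliasing error on the cross. Both are measured in \<open>L\<^sub>q\<close> through the endpoint
  embedding of the mixed Sobolev space of smoothness \<open>1/2 - 1/q\<close>, which costs no logarithm; it
  follows from the univariate case by Minkowski's inequality, one coordinate at a time.
  By Cauchy-Schwarz the aliasing error is controlled by the sum of the reciprocal weights over a residue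
  class of \<open>k \<cdot> z\<close> modulo \<open>M\<close> outside the cross. A dyadic block of index \<open>j\<close> contributes at most
  a multiple of \<open>2\<close> to the power \<open>|j|\<^sub>1 - R\<close> frequencies, and only for \<open>\<beta> = 0\<close> do all blocks of
  a given \<open>|j|\<^sub>1\<close> count equally, whence the logarithm.
  The Fourier series of a function in the hybrid space converges uniformly to its continuous
  representative, so the bound passes to the limit.
\<close>

subsection \<open>Endpoint Sobolev embeddings\<close>

text \<open>The obstacle is the power of R. Adding the \<open>L_q\<close> norms of separate dyadic
  blocks would in general cost a further power of R, so the embedding is used with exactly the
  smoothness 1/2 - 1/q, which leaves only a weighted square sum of coefficients to control. Both
  parts of the error then reach the same rate: outside the cross the bound for the quotient of the
  weights decays with the level, while on the cross the embedding weight is at most of order 2 to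
  the power 2 (1/2 - 1/q) R and the alias sums are of order 2 to the power -2 (\<alpha> + \<beta>)
  R, up to the logarithm. Adding the alias errors of different frequencies loses nothing, since a
  frequency outside the cross is aliased to at most one frequency in it. Sampling needs point
  values, whereas f is given up to null sets. Completeness of the trigonometric system identifies f
  with its Fourier series almost everywhere; continuity and periodicity turn this into agreement of
  the continuous representative with the series at the nodes.\<close>

definition lev :: "int \<Rightarrow> nat" where
  "lev m = (LEAST j. \<bar>m\<bar> \<le> 2 ^ j)"

lemma abs_le_two_power_lev: "\<bar>m\<bar> \<le> 2 ^ lev m"
proof -
  have "\<bar>m\<bar> \<le> 2 ^ nat \<bar>m\<bar>"
  proof -
    have "nat \<bar>m\<bar> < 2 ^ nat \<bar>m\<bar>" by (rule less_exp)
    then have "int (nat \<bar>m\<bar>) < int (2 ^ nat \<bar>m\<bar>)" by (subst of_nat_less_iff)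
    then show ?thesis by simp
  qed
  then show ?thesis unfolding lev_def by (rule LeastI)
qed

lemma lev_le_iff: "lev m \<le> j \<longleftrightarrow> \<bar>m\<bar> \<le> 2 ^ j"
proof
  assume "lev m \<le> j"
  then have "(2::int) ^ lev m \<le> 2 ^ j" by simp
  then show "\<bar>m\<bar> \<le> 2 ^ j" using abs_le_two_power_lev[of m] by linarith
qed (auto simp: lev_def intro: Least_le)

text \<open>The blocks \<open>Q j\<close> therefore partition the integers. Defining
  \<open>lev\<close> by the least exponent rather than by the blocks makes
  \<open>lev m \<le> j\<close> a symmetric interval, which is the form needed for counting.\<close>

lemma lev_eq_iff_mem_Q: "lev m = j \<longleftrightarrow> m \<in> Q j"
proof (cases j)
  case 0
  then show ?thesis using lev_le_iff[of m 0] by (auto simp: Q_def)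
next
  case (Suc i)
  have "lev m = Suc i \<longleftrightarrow> lev m \<le> Suc i \<and> \<not> lev m \<le> i" by linarith
  also have "\<dots> \<longleftrightarrow> m \<in> Q j"
    unfolding lev_le_iff using Suc by (auto simp: Q_def abs_if split: if_splits)
  finally show ?thesis using Suc by simp
qed

lemma card_lev_le: "finite {m. lev m \<le> j}" "card {m. lev m \<le> j} \<le> 3 * 2 ^ j"
proof -
  have eq: "{m. lev m \<le> j} = {- (2 ^ j) .. 2 ^ j}"
    unfolding lev_le_iff by (auto simp: abs_le_iff)
  then show "finite {m. lev m \<le> j}" by simp
  have "card {- (2 ^ j) .. 2 ^ j :: int} = nat (2 * 2 ^ j + 1)" by simp
  also have "\<dots> \<le> nat (3 * 2 ^ j)" by (intro nat_mono) simp
  also have "\<dots> = 3 * 2 ^ j" by (simp add: nat_mult_distrib nat_power_eq)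
  finally show "card {m. lev m \<le> j} \<le> 3 * 2 ^ j" using eq by simp
qed

section \<open>Trigonometric polynomials on the circle\<close>

abbreviation circle :: "real measure" where
  "circle \<equiv> restrict_space lborel {0..<1}"

lemma prob_space_circle: "prob_space circle"
  by (rule prob_spaceI) (simp add: emeasure_restrict_space)

interpretation circle: prob_space circle by (rule prob_space_circle)

lemma measurable_circle[measurable (raw)]:
  "f \<in> borel_measurable borel \<Longrightarrow> f \<in> borel_measurable circle"
  by (simp add: measurable_restrict_space1)

lemma measurable_cis[measurable]: "cis \<in> borel_measurable borel"
  by (intro borel_measurable_continuous_onI continuous_intros)

lemma integral_circle_cis:
  "(\<integral>y. cis (2 * pi * (real_of_int m * y)) \<partial>circle) = (if m = 0 then 1 else 0)"
proof (cases "m = 0")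
  case True
  then show ?thesis using circle.prob_space by simp
next
  case False
  define F where "F y = cis (2 * pi * (real_of_int m * y)) / (\<i> * (2 * pi * m))" for y
  have D: "(F has_vector_derivative cis (2 * pi * (real_of_int m * y))) (at y within {0..1})" for y
  proof -
    have "((\<lambda>w. exp (\<i> * (2 * pi * (m * w))) / (\<i> * (2 * pi * m))) has_field_derivative
        exp (\<i> * (2 * pi * (m * y)))) (at (complex_of_real y))"
      using False by (auto intro!: derivative_eq_intros simp: field_simps)
    from has_vector_derivative_real_field[OF this] show ?thesis
      by (simp add: F_def[abs_def] cis_conv_exp)
  qed
  have "has_bochner_integral lborel (\<lambda>y. indicator {0..1} y *\<^sub>R cis (2 * pi * (real_of_int m * y))) (F 1 - F 0)"
    by (rule has_bochner_integral_FTC_Icc) (auto intro!: D continuous_intros)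
  moreover have "F 1 = F 0"
    unfolding F_def using cis_multiple_2pi[of "real_of_int m"] by (simp add: mult_ac)
  ultimately have "(\<integral>y. indicator {0..1} y *\<^sub>R cis (2 * pi * (real_of_int m * y)) \<partial>lborel) = 0"
    by (simp add: has_bochner_integral_iff)
  \<comment> \<open>The fundamental theorem integrates over the closed interval,
    \<open>circle\<close> lives on the half-open one; they differ by a null set.\<close>
  moreover have "(\<integral>y. indicator {0..<1} y *\<^sub>R cis (2 * pi * (real_of_int m * y)) \<partial>lborel)
      = (\<integral>y. indicator {0..1} y *\<^sub>R cis (2 * pi * (real_of_int m * y)) \<partial>lborel)"
    by (rule integral_cong_AE)
       (use AE_lborel_singleton[of 1] in \<open>auto simp: indicator_def elim!: eventually_mono\<close>)
  ultimately show ?thesis using False by (simp add: integral_restrict_space)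
qed

lemma integrable_circle_bounded:
  fixes f :: "real \<Rightarrow> 'b::{banach, second_countable_topology}"
  assumes "f \<in> borel_measurable circle" "\<And>y. norm (f y) \<le> B"
  shows "integrable circle f"
  by (rule circle.integrable_const_bound[where B=B]) (use assms in auto)

lemma parseval_circle:
  fixes c :: "int \<Rightarrow> complex"
  assumes "finite S"
  shows "(\<integral>y. (cmod (\<Sum>m\<in>S. c m * cis (2 * pi * (real_of_int m * y))))\<^sup>2 \<partial>circle)
    = (\<Sum>m\<in>S. (cmod (c m))\<^sup>2)"
proof -
  let ?e = "\<lambda>m y. cis (2 * pi * (real_of_int m * y))"
  have int: "integrable circle (?e m)" for m
    by (rule integrable_circle_bounded[where B=1]) simp_all
  have ee: "?e m y * cnj (?e n y) = ?e (m - n) y" for m n y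
    unfolding cis_cnj cis_mult by (rule arg_cong[where f=cis]) (simp add: algebra_simps)
  have "complex_of_real ((cmod (\<Sum>m\<in>S. c m * ?e m y))\<^sup>2)
      = (\<Sum>m\<in>S. \<Sum>n\<in>S. c m * cnj (c n) * ?e (m - n) y)" for y
    unfolding complex_norm_square cnj_sum sum_product complex_cnj_mult ee[symmetric]
    by (simp only: mult_ac)
  then have "complex_of_real (\<integral>y. (cmod (\<Sum>m\<in>S. c m * ?e m y))\<^sup>2 \<partial>circle)
      = (\<integral>y. (\<Sum>m\<in>S. \<Sum>n\<in>S. c m * cnj (c n) * ?e (m - n) y) \<partial>circle)"
    by (subst integral_complex_of_real[symmetric]) simp
  also have "\<dots> = (\<Sum>m\<in>S. \<Sum>n\<in>S. c m * cnj (c n) * (if m - n = 0 then 1 else 0))"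
    by (subst Bochner_Integration.integral_sum, intro Bochner_Integration.integrable_sum integrable_mult_right int,
        subst Bochner_Integration.integral_sum, intro integrable_mult_right int)
       (simp only: integral_mult_right_zero integral_circle_cis)
  also have "\<dots> = (\<Sum>m\<in>S. c m * cnj (c m))"
    by (intro sum.cong refl, subst sum.remove[OF assms], assumption) (auto intro!: sum.neutral)
  also have "\<dots> = complex_of_real (\<Sum>m\<in>S. (cmod (c m))\<^sup>2)"
    unfolding of_real_sum complex_norm_square ..
  finally show ?thesis by (simp only: of_real_eq_iff)
qed

lemma four_powr: "(4::real) powr x = 2 powr (2 * x)"
  using powr_powr[of 2 2 x] by simp

text \<open>At most \<open>3 * 2 ^ j\<close> integers have level j, so this level contributes at
  most three times the j-th power of \<open>2 powr (1 - 2 * a)\<close>. The bound serves two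
  regimes: a = 1/2 - 1/q gives a ratio above 1, a = \<alpha> + \<beta> a ratio below 1.\<close>

lemma sum_four_powr_lev_le:
  fixes a :: real
  assumes "finite S" "\<And>m. m \<in> S \<Longrightarrow> lev m \<le> n"
  shows "(\<Sum>m\<in>S. 4 powr (- a * real (lev m))) \<le> 3 * (\<Sum>j\<le>n. (2 powr (1 - 2 * a)) ^ j)"
proof -
  define r :: real where "r = 2 powr (1 - 2 * a)"
  have "(\<Sum>m\<in>S. 4 powr (- a * real (lev m))) = (\<Sum>j\<le>n. \<Sum>m\<in>{m\<in>S. lev m = j}. 4 powr (- a * real (lev m)))"
    by (rule sum.group[symmetric]) (use assms in auto)
  also have "\<dots> \<le> (\<Sum>j\<le>n. 3 * r ^ j)"
  proof (rule sum_mono)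
    fix j
    have "(\<Sum>m\<in>{m\<in>S. lev m = j}. 4 powr (- a * real (lev m))) = real (card {m\<in>S. lev m = j}) * 4 powr (- a * real j)"
      by simp
    also have "\<dots> \<le> (3 * 2 ^ j) * 4 powr (- a * real j)"
    proof (rule mult_right_mono)
      have "card {m\<in>S. lev m = j} \<le> card {m. lev m \<le> j}" by (rule card_mono[OF card_lev_le(1)]) auto
      also have "\<dots> \<le> 3 * 2 ^ j" by (rule card_lev_le)
      finally have "real (card {m\<in>S. lev m = j}) \<le> real (3 * 2 ^ j)" by (rule of_nat_mono)
      then show "real (card {m\<in>S. lev m = j}) \<le> 3 * 2 ^ j" by simp
    qed simp
    also have "\<dots> = 3 * r ^ j"
    proof -
      have "(2::real) ^ j * 4 powr (- a * real j) = 2 powr (real j + 2 * (- a * real j))"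
        by (subst powr_add) (simp add: four_powr powr_realpow)
      also have "\<dots> = r ^ j" by (simp add: r_def powr_powr algebra_simps flip: powr_realpow)
      finally show ?thesis by simp
    qed
    finally show "(\<Sum>m\<in>{m\<in>S. lev m = j}. 4 powr (- a * real (lev m))) \<le> 3 * r ^ j" .
  qed
  also have "\<dots> = 3 * (\<Sum>j\<le>n. r ^ j)" by (rule sum_distrib_left[symmetric])
  finally show ?thesis unfolding r_def .
qed

text \<open>A growing geometric sum is dominated by its last term. This is the second factor when
  Cauchy-Schwarz is applied to the part of a polynomial with levels up to i.\<close>

lemma low_frequency_weights:
  fixes q :: real
  assumes "2 < q" "finite S"
  shows "(\<Sum>m | m \<in> S \<and> lev m \<le> i. 4 powr (- (1/2 - 1/q) * real (lev m)))
    \<le> 3 * 2 powr (2/q) / (2 powr (2/q) - 1) * (2 powr (2/q)) ^ i"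
proof -
  define r :: real where "r = 2 powr (2/q)"
  have r1: "r > 1" using assms by (simp add: r_def)
  have e: "1 - 2 * (1/2 - 1/q) = 2/q" by simp
  have "(\<Sum>m | m \<in> S \<and> lev m \<le> i. 4 powr (- (1/2 - 1/q) * real (lev m))) \<le> 3 * (\<Sum>j\<le>i. r ^ j)"
    unfolding r_def e[symmetric] by (rule sum_four_powr_lev_le) (use assms(2) in auto)
  also have "\<dots> = 3 * ((r ^ Suc i - 1) / (r - 1))"
    unfolding lessThan_Suc_atMost[symmetric] using r1 by (subst geometric_sum) auto
  also have "\<dots> \<le> 3 * r / (r - 1) * r ^ i"
    using r1 by (simp add: field_simps)
  finally show ?thesis by (simp add: r_def)
qed

text \<open>The endpoint embedding is obtained by splitting the polynomial, at each height \<open>\<lambda>\<close>, at the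
  frequency up to which Cauchy-Schwarz bounds the low part by \<open>\<lambda> / 2\<close>.\<close>

lemma sobolev_circle:
  fixes q :: real
  assumes q: "2 < q"
  shows "\<exists>C>0. \<forall>S c. finite S \<longrightarrow>
    (\<integral>y. cmod (\<Sum>m\<in>S. c m * cis (2 * pi * (real_of_int m * y))) powr q \<partial>circle)
      \<le> C * (\<Sum>m\<in>S. 4 powr ((1/2 - 1/q) * real (lev m)) * (cmod (c m))\<^sup>2) powr (q/2)"
proof -
  define \<tau> where "\<tau> = 1/2 - 1/q"
  have \<tau>: "\<tau> > 0" using q by (simp add: \<tau>_def field_simps)
  define r :: real where "r = 2 powr (2/q)"
  define \<rho> where "\<rho> = sqrt r"
  define \<sigma> :: real where "\<sigma> = 4 powr \<tau>"
  define C0 where "C0 = sqrt (3 * r / (r - 1))"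
  have r1: "r > 1" using q by (simp add: r_def)
  have \<rho>1: "\<rho> > 1" using r1 by (simp add: \<rho>_def)
  have C0: "C0 > 0" using r1 by (simp add: C0_def)
  have \<sigma>1: "\<sigma> > 1" using \<tau> by (simp add: \<sigma>_def)
  \<comment> \<open>This balance is what makes the endpoint work: the heights grow by the factor
    \<rho> per level, and their (q - 2)-th powers grow exactly as fast as the weights
    \<open>4 powr (\<tau> * real (lev m))\<close>.\<close>
  have \<rho>\<sigma>: "\<rho> powr (q - 2) = \<sigma>"
  proof -
    have "\<rho> = 2 powr (1/q)" unfolding \<rho>_def r_def by (simp add: powr_half_sqrt[symmetric] powr_powr)
    then have "\<rho> powr (q - 2) = 2 powr (1/q * (q - 2))" by (simp add: powr_powr)
    also have "1/q * (q - 2) = 2 * \<tau>" using q by (simp add: \<tau>_def field_simps)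
    finally show ?thesis by (simp add: \<sigma>_def four_powr)
  qed
  \<comment> \<open>The first summand accounts for the points where the polynomial stays below the
    lowest height, the second for all higher ones, summed as a geometric series with ratio
    \<sigma>.\<close>
  define C where "C = (2 * C0) powr q + 4 * (2 * C0) powr (q - 2) * (\<sigma> / (\<sigma> - 1))"
  have "C > 0" unfolding C_def using C0 \<sigma>1 by (intro add_pos_pos mult_pos_pos) auto
  moreover have "(\<integral>y. cmod (\<Sum>m\<in>S. c m * cis (2 * pi * (real_of_int m * y))) powr q \<partial>circle)
      \<le> C * (\<Sum>m\<in>S. 4 powr (\<tau> * real (lev m)) * (cmod (c m))\<^sup>2) powr (q/2)"
    if S: "finite S" for S and c :: "int \<Rightarrow> complex"
  proof -
    define A where "A = (\<Sum>m\<in>S. 4 powr (\<tau> * real (lev m)) * (cmod (c m))\<^sup>2)"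
    define B where "B = sqrt A"
    define p where "p T y = (\<Sum>m\<in>T. c m * cis (2 * pi * (real_of_int m * y)))" for T y
    have A0: "A \<ge> 0" unfolding A_def by (intro sum_nonneg) simp
    show ?thesis
    proof (cases "A = 0")
      case True
      then have "c m = 0" if "m \<in> S" for m
        using that S unfolding A_def by (subst (asm) sum_nonneg_eq_0_iff) auto
      then have "p S y = 0" for y by (simp add: p_def)
      then show ?thesis using q True unfolding p_def by (simp add: A_def)
    next
      case False
      with A0 have B: "B > 0" by (simp add: B_def)
      \<comment> \<open>Twice the Cauchy-Schwarz bound for the levels up to i: where the polynomial
        exceeds this height, the levels above i carry at least half of its modulus.\<close>
      define \<Lambda> where "\<Lambda> i = 2 * B * C0 * \<rho> ^ i" for i
      have \<Lambda>0: "\<Lambda> i > 0" for i using B C0 \<rho>1 by (simp add: \<Lambda>_def)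
      have low: "cmod (p {m\<in>S. lev m \<le> i} y) \<le> \<Lambda> i / 2" for i y
      proof -
        have "cmod (p {m\<in>S. lev m \<le> i} y) \<le> (\<Sum>m\<in>{m\<in>S. lev m \<le> i}. cmod (c m))"
          unfolding p_def by (rule sum_norm_le) (simp add: norm_mult)
        also have "\<dots> = (\<Sum>m\<in>{m\<in>S. lev m \<le> i}. (2 powr (\<tau> * real (lev m)) * cmod (c m)) * 2 powr (- \<tau> * real (lev m)))"
          by (intro sum.cong refl) (simp add: powr_minus field_simps)
        finally have "(cmod (p {m\<in>S. lev m \<le> i} y))\<^sup>2
            \<le> (\<Sum>m\<in>{m\<in>S. lev m \<le> i}. (2 powr (\<tau> * real (lev m)) * cmod (c m)) * 2 powr (- \<tau> * real (lev m)))\<^sup>2"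
          by (rule power_mono) simp
        also have "\<dots> \<le> (\<Sum>m\<in>{m\<in>S. lev m \<le> i}. (2 powr (\<tau> * real (lev m)) * cmod (c m))\<^sup>2)
            * (\<Sum>m\<in>{m\<in>S. lev m \<le> i}. (2 powr (- \<tau> * real (lev m)))\<^sup>2)"
          by (rule Cauchy_Schwarz_ineq_sum)
        also have "\<dots> = (\<Sum>m\<in>{m\<in>S. lev m \<le> i}. 4 powr (\<tau> * real (lev m)) * (cmod (c m))\<^sup>2)
            * (\<Sum>m\<in>{m\<in>S. lev m \<le> i}. 4 powr (- \<tau> * real (lev m)))"
        proof -
          have "((2::real) powr x)\<^sup>2 = 4 powr x" for x
            unfolding four_powr power2_eq_square powr_add[symmetric] by simp
          then show ?thesis by (simp add: power_mult_distrib)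
        qed
        also have "\<dots> \<le> A * (C0\<^sup>2 * r ^ i)"
        proof (rule mult_mono)
          show "(\<Sum>m\<in>{m\<in>S. lev m \<le> i}. 4 powr (\<tau> * real (lev m)) * (cmod (c m))\<^sup>2) \<le> A"
            unfolding A_def by (rule sum_mono2[OF S]) auto
          show "(\<Sum>m\<in>{m\<in>S. lev m \<le> i}. 4 powr (- \<tau> * real (lev m))) \<le> C0\<^sup>2 * r ^ i"
            using low_frequency_weights[OF q S, of i] r1 by (simp add: C0_def r_def \<tau>_def)
        qed (auto intro: A0 sum_nonneg)
        also have "\<dots> = (\<Lambda> i / 2)\<^sup>2"
        proof -
          have "r = \<rho>\<^sup>2" "A = B\<^sup>2" using r1 A0 by (auto simp: \<rho>_def B_def)
          then show ?thesis by (simp add: \<Lambda>_def power_mult_distrib power_mult[symmetric] mult_ac)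
        qed
        finally have le: "(cmod (p {m\<in>S. lev m \<le> i} y))\<^sup>2 \<le> (\<Lambda> i / 2)\<^sup>2" .
        show ?thesis by (rule power2_le_imp_le[OF le]) (use \<Lambda>0[of i] in simp)
      qed
      define n where "n = (\<Sum>m\<in>S. lev m)"
      have lev_n: "lev m \<le> n" if "m \<in> S" for m
        unfolding n_def using member_le_sum[OF that _ S, of lev] by simp
      \<comment> \<open>A discrete layer-cake bound. If \<Lambda> (i + 1) is the first height not
        exceeded at y, then q - 2 powers of the modulus are bounded by this height and the remaining
        two by the part above level i, which leaves a square for Parseval. Summing over all i
        removes the dependence of i on y.\<close>
      have pt: "cmod (p S y) powr q \<le> \<Lambda> 0 powr q
          + (\<Sum>i<n. 4 * \<Lambda> (Suc i) powr (q - 2) * (cmod (p {m\<in>S. lev m > i} y))\<^sup>2)" for y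
      proof -
        let ?v = "cmod (p S y)"
        have vn: "?v \<le> \<Lambda> n"
        proof -
          have "{m\<in>S. lev m \<le> n} = S" using lev_n by auto
          then show ?thesis using low[of n y] \<Lambda>0[of n] by simp
        qed
        define k where "k = (LEAST k. ?v \<le> \<Lambda> k)"
        have k: "?v \<le> \<Lambda> k" unfolding k_def by (rule LeastI, rule vn)
        have kn: "k \<le> n" unfolding k_def by (rule Least_le, rule vn)
        show ?thesis
        proof (cases k)
          case 0
          then have "?v powr q \<le> \<Lambda> 0 powr q" using k q by (intro powr_mono2) auto
          moreover have "0 \<le> (\<Sum>i<n. 4 * \<Lambda> (Suc i) powr (q - 2) * (cmod (p {m\<in>S. lev m > i} y))\<^sup>2)"
            by (intro sum_nonneg) auto
          ultimately show ?thesis by linarith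
        next
          case (Suc i)
          have vi: "?v > \<Lambda> i"
            using not_less_Least[of i "\<lambda>k. ?v \<le> \<Lambda> k"] Suc by (simp add: k_def)
          have "p S y = p {m\<in>S. lev m \<le> i} y + p {m\<in>S. lev m > i} y"
            unfolding p_def using S
            by (subst sum.union_disjoint[symmetric]) (auto intro!: sum.cong)
          then have "?v \<le> cmod (p {m\<in>S. lev m \<le> i} y) + cmod (p {m\<in>S. lev m > i} y)"
            by (simp add: norm_triangle_ineq)
          with low[of i y] vi have v2: "?v \<le> 2 * cmod (p {m\<in>S. lev m > i} y)" by linarith
          have v0: "?v > 0" using vi \<Lambda>0[of i] by linarith
          have "?v powr q = ?v powr (q - 2) * ?v\<^sup>2"
            using v0 by (simp add: powr_diff)
          also have "\<dots> \<le> \<Lambda> (Suc i) powr (q - 2) * (2 * cmod (p {m\<in>S. lev m > i} y))\<^sup>2"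
            using k Suc q v2 by (intro mult_mono powr_mono2 power_mono) auto
          also have "\<dots> = 4 * \<Lambda> (Suc i) powr (q - 2) * (cmod (p {m\<in>S. lev m > i} y))\<^sup>2"
            by (simp add: power_mult_distrib)
          also have "\<dots> \<le> (\<Sum>i<n. 4 * \<Lambda> (Suc i) powr (q - 2) * (cmod (p {m\<in>S. lev m > i} y))\<^sup>2)"
            by (rule member_le_sum) (use Suc kn in auto)
          finally show ?thesis by (simp add: add_increasing)
        qed
      qed
      have pm[measurable]: "p T \<in> borel_measurable circle" for T
        unfolding p_def by measurable
      have pb: "cmod (p T y) \<le> (\<Sum>m\<in>T. cmod (c m))" for T y
        unfolding p_def by (rule sum_norm_le) (simp add: norm_mult)
      have i2: "integrable circle (\<lambda>y. (cmod (p T y))\<^sup>2)" for T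
        by (rule integrable_circle_bounded[where B="(\<Sum>m\<in>T. cmod (c m))\<^sup>2"])
           (auto intro!: power_mono pb)
      have iq: "integrable circle (\<lambda>y. cmod (p S y) powr q)"
        by (rule integrable_circle_bounded[where B="(\<Sum>m\<in>S. cmod (c m)) powr q"])
           (use q in \<open>auto intro!: powr_mono2 pb\<close>)
      have "(\<integral>y. cmod (p S y) powr q \<partial>circle) \<le> (\<integral>y. \<Lambda> 0 powr q
          + (\<Sum>i<n. 4 * \<Lambda> (Suc i) powr (q - 2) * (cmod (p {m\<in>S. lev m > i} y))\<^sup>2) \<partial>circle)"
        by (rule integral_mono[OF iq _ pt])
           (intro Bochner_Integration.integrable_add Bochner_Integration.integrable_sum integrable_mult_right i2
             circle.integrable_const)
      also have "\<dots> = \<Lambda> 0 powr q + (\<Sum>i<n. 4 * \<Lambda> (Suc i) powr (q - 2) * (\<Sum>m\<in>{m\<in>S. lev m > i}. (cmod (c m))\<^sup>2))"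
      proof -
        have "(\<integral>y. (cmod (p {m\<in>S. lev m > i} y))\<^sup>2 \<partial>circle) = (\<Sum>m\<in>{m\<in>S. lev m > i}. (cmod (c m))\<^sup>2)" for i
          unfolding p_def by (rule parseval_circle) (use S in simp)
        then show ?thesis
          using circle.prob_space
          by (subst Bochner_Integration.integral_add, (auto intro!: i2)[2], subst Bochner_Integration.integral_sum)
             (auto intro!: i2)
      qed
      \<comment> \<open>After exchanging the sums, the frequency m collects the heights with index
        below \<open>lev m\<close>; they grow geometrically, so the last one decides, and it is the
        weight of m.\<close>
      also have "(\<Sum>i<n. 4 * \<Lambda> (Suc i) powr (q - 2) * (\<Sum>m\<in>{m\<in>S. lev m > i}. (cmod (c m))\<^sup>2))
          = (\<Sum>m\<in>S. (cmod (c m))\<^sup>2 * (\<Sum>i<lev m. 4 * \<Lambda> (Suc i) powr (q - 2)))"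
      proof -
        have "(\<Sum>i<n. 4 * \<Lambda> (Suc i) powr (q - 2) * (\<Sum>m\<in>{m\<in>S. lev m > i}. (cmod (c m))\<^sup>2))
           = (\<Sum>i<n. \<Sum>m\<in>S. if i < lev m then (cmod (c m))\<^sup>2 * (4 * \<Lambda> (Suc i) powr (q - 2)) else 0)"
          using S by (auto simp: sum_distrib_left sum.inter_filter intro!: sum.cong)
        also have "\<dots> = (\<Sum>m\<in>S. \<Sum>i<n. if i < lev m then (cmod (c m))\<^sup>2 * (4 * \<Lambda> (Suc i) powr (q - 2)) else 0)"
          by (rule sum.swap)
        also have "\<dots> = (\<Sum>m\<in>S. (cmod (c m))\<^sup>2 * (\<Sum>i<lev m. 4 * \<Lambda> (Suc i) powr (q - 2)))"
        proof (rule sum.cong[OF refl])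
          fix m assume m: "m \<in> S"
          have "{i \<in> {..<n}. i < lev m} = {..<lev m}" using lev_n[OF m] by auto
          then show "(\<Sum>i<n. if i < lev m then (cmod (c m))\<^sup>2 * (4 * \<Lambda> (Suc i) powr (q - 2)) else 0)
             = (cmod (c m))\<^sup>2 * (\<Sum>i<lev m. 4 * \<Lambda> (Suc i) powr (q - 2))"
            by (simp add: sum.inter_filter[symmetric] sum_distrib_left)
        qed
        finally show ?thesis .
      qed
      also have "\<dots> \<le> (\<Sum>m\<in>S. (cmod (c m))\<^sup>2 * (4 * (2 * B * C0) powr (q - 2) * (\<sigma> / (\<sigma> - 1)) * 4 powr (\<tau> * real (lev m))))"
      proof (intro sum_mono mult_left_mono)
        fix m
        have pw: "\<Lambda> (Suc i) powr (q - 2) = (2 * B * C0) powr (q - 2) * (\<sigma> * \<sigma> ^ i)" for i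
        proof -
          have "(\<rho> ^ Suc i) powr (q - 2) = (\<rho> powr (q - 2)) ^ Suc i"
            using \<rho>1 by (simp add: powr_powr mult.commute del: power_Suc flip: powr_realpow)
          moreover have "\<Lambda> (Suc i) powr (q - 2) = (2 * B * C0) powr (q - 2) * (\<rho> ^ Suc i) powr (q - 2)"
            unfolding \<Lambda>_def by (rule powr_mult)
          ultimately show ?thesis by (simp add: \<rho>\<sigma>)
        qed
        have "(\<Sum>i<lev m. 4 * \<Lambda> (Suc i) powr (q - 2))
           = 4 * (2 * B * C0) powr (q - 2) * (\<sigma> * (\<Sum>i<lev m. \<sigma> ^ i))"
          unfolding pw sum_distrib_left by (simp only: mult_ac)
        also have "\<dots> = 4 * (2 * B * C0) powr (q - 2) * (\<sigma> * ((\<sigma> ^ lev m - 1) / (\<sigma> - 1)))"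
          using \<sigma>1 by (simp add: geometric_sum)
        also have "\<dots> \<le> 4 * (2 * B * C0) powr (q - 2) * (\<sigma> / (\<sigma> - 1) * \<sigma> ^ lev m)"
          using \<sigma>1 by (intro mult_left_mono) (auto simp: field_simps)
        also have "\<sigma> ^ lev m = 4 powr (\<tau> * real (lev m))"
          by (simp add: \<sigma>_def powr_powr flip: powr_realpow)
        finally show "(\<Sum>i<lev m. 4 * \<Lambda> (Suc i) powr (q - 2))
            \<le> 4 * (2 * B * C0) powr (q - 2) * (\<sigma> / (\<sigma> - 1)) * 4 powr (\<tau> * real (lev m))"
          by (simp add: mult_ac)
      qed simp
      also have "\<dots> = 4 * (2 * B * C0) powr (q - 2) * (\<sigma> / (\<sigma> - 1)) * A"
        unfolding A_def sum_distrib_left by (simp only: mult_ac)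
      also have "A = B\<^sup>2" using A0 by (simp add: B_def)
      also have "\<Lambda> 0 powr q + 4 * (2 * B * C0) powr (q - 2) * (\<sigma> / (\<sigma> - 1)) * B\<^sup>2 = C * B powr q"
      proof -
        have "B powr q = B powr (q - 2) * B\<^sup>2" using B by (simp add: powr_diff)
        then show ?thesis
          unfolding C_def \<Lambda>_def using powr_mult[of "2 * C0" B q] powr_mult[of "2 * C0" B "q - 2"] B C0
          by (simp add: algebra_simps)
      qed
      also have "B powr q = A powr (q/2)"
        using A0 by (simp add: B_def powr_half_sqrt[symmetric] powr_powr)
      finally show ?thesis by (simp add: p_def A_def)
    qed
  qed
  ultimately show ?thesis unfolding \<tau>_def by blast
qed

section \<open>Minkowski's inequality and the passage from the circle to the torus\<close>

lemma convex_on_nonneg_powr: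
  assumes "p \<ge> 1"
  shows "convex_on {0..} (\<lambda>x::real. x powr p)"
proof (rule convex_onI)
  fix t x y :: real
  assume t: "0 < t" "t < 1" and xy: "x \<in> {0..}" "y \<in> {0..}"
  \<comment> \<open>If one of the two points is 0, convexity reduces to this inequality.\<close>
  have scale: "s powr p \<le> s" if "0 < s" "s < 1" for s :: real
    using powr_mono'[of 1 p s] assms that by simp
  consider "x = 0" | "y = 0" | "x > 0" "y > 0" using xy by fastforce
  then show "((1 - t) *\<^sub>R x + t *\<^sub>R y) powr p \<le> (1 - t) * x powr p + t * y powr p"
  proof cases
    case 1
    then show ?thesis using t xy scale[of t] by (auto simp: powr_mult intro!: mult_right_mono)
  next
    case 2
    then show ?thesis using t xy scale[of "1 - t"] by (auto simp: powr_mult intro!: mult_right_mono)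
  next
    case 3
    then show ?thesis using convex_onD[OF powr_convex[OF assms], of t x y] t by auto
  qed
qed simp

text \<open>Jensen's inequality after normalisation: the sum of the \<open>u i\<close> is T times
  the convex combination of the functions \<open>u i / N i\<close> with weights
  \<open>N i / T\<close>, and each of these has p-th moment at most 1.\<close>

lemma minkowski_powr_sum:
  fixes u :: "'i \<Rightarrow> 'a \<Rightarrow> real"
  assumes p: "p \<ge> 1" and S: "finite S"
    and N: "\<And>i. i \<in> S \<Longrightarrow> N i > 0"
    and u: "\<And>i x. i \<in> S \<Longrightarrow> u i x \<ge> 0"
    and int: "\<And>i. i \<in> S \<Longrightarrow> integrable M (\<lambda>x. u i x powr p)"
    and le: "\<And>i. i \<in> S \<Longrightarrow> (\<integral>x. u i x powr p \<partial>M) \<le> N i powr p"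
  shows "(\<integral>x. (\<Sum>i\<in>S. u i x) powr p \<partial>M) \<le> (\<Sum>i\<in>S. N i) powr p"
proof (cases "S = {}")
  case False
  define T where "T = (\<Sum>i\<in>S. N i)"
  have T: "T > 0" unfolding T_def using S False N by (rule sum_pos)
  have pt: "(\<Sum>i\<in>S. u i x) powr p \<le> (\<Sum>i\<in>S. T powr p * (N i / T) / N i powr p * u i x powr p)" for x
  proof -
    have "(\<Sum>i\<in>S. u i x) = T * (\<Sum>i\<in>S. (N i / T) *\<^sub>R (u i x / N i))"
      unfolding sum_distrib_left using T N by (intro sum.cong refl) (auto simp: field_simps less_imp_neq[symmetric])
    then have "(\<Sum>i\<in>S. u i x) powr p = T powr p * (\<Sum>i\<in>S. (N i / T) *\<^sub>R (u i x / N i)) powr p"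
      using T u N by (simp add: powr_mult sum_nonneg less_imp_le)
    also have "\<dots> \<le> T powr p * (\<Sum>i\<in>S. N i / T * (u i x / N i) powr p)"
    proof (intro mult_left_mono convex_on_sum[OF S False convex_on_nonneg_powr[OF p]])
      show "(\<Sum>i\<in>S. N i / T) = 1" using T by (simp add: sum_divide_distrib[symmetric] T_def)
    qed (use T u N in \<open>auto simp: less_imp_le\<close>)
    also have "\<dots> = (\<Sum>i\<in>S. T powr p * (N i / T) / N i powr p * u i x powr p)"
      unfolding sum_distrib_left using u N by (intro sum.cong refl) (simp add: powr_divide less_imp_le)
    finally show ?thesis .
  qed
  have "(\<integral>x. (\<Sum>i\<in>S. u i x) powr p \<partial>M)
      \<le> (\<integral>x. (\<Sum>i\<in>S. T powr p * (N i / T) / N i powr p * u i x powr p) \<partial>M)"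
    by (rule integral_mono'[OF _ pt])
       (use T N in \<open>auto intro!: Bochner_Integration.integrable_sum integrable_mult_right int sum_nonneg simp: less_imp_le\<close>)
  also have "\<dots> = (\<Sum>i\<in>S. T powr p * (N i / T) / N i powr p * (\<integral>x. u i x powr p \<partial>M))"
    by (subst Bochner_Integration.integral_sum) (auto intro!: integrable_mult_right int)
  also have "\<dots> \<le> (\<Sum>i\<in>S. T powr p * (N i / T) / N i powr p * N i powr p)"
    using T N by (intro sum_mono mult_left_mono le) (auto simp: less_imp_le)
  also have "\<dots> = (\<Sum>i\<in>S. T powr p * (N i / T))"
    using N by (intro sum.cong refl) (simp add: less_imp_neq[symmetric])
  also have "\<dots> = T powr p"
    using T by (simp add: sum_distrib_left[symmetric] sum_divide_distrib[symmetric] T_def[symmetric])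
  finally show ?thesis by (simp add: T_def)
qed simp

interpretation circles: product_sigma_finite "\<lambda>_::nat. circle"
  by standard

lemma prob_space_torus: "prob_space (torus d)"
proof (rule prob_spaceI)
  have "emeasure (torus d) (\<Pi>\<^sub>E s\<in>{..<d}. {0..<1}) = (\<Prod>s<d. emeasure circle {0..<1})"
    unfolding torus_def by (rule circles.emeasure_PiM) (auto simp: sets_restrict_space_iff)
  then show "emeasure (torus d) (space (torus d)) = 1"
    using circle.emeasure_space_1 by (simp add: torus_def space_PiM)
qed

lemma measurable_trig[measurable]: "trig d k \<in> borel_measurable (torus d)"
proof -
  have [measurable]: "(\<lambda>x. x s) \<in> borel_measurable (torus d)" if "s < d" for s
  proof -
    have "(\<lambda>x. x s) \<in> torus d \<rightarrow>\<^sub>M circle"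
      unfolding torus_def by (rule measurable_component_singleton) (use that in simp)
    moreover have "(\<lambda>y. y) \<in> circle \<rightarrow>\<^sub>M borel" by measurable
    ultimately show ?thesis by (rule measurable_compose)
  qed
  have "(\<lambda>x. \<Sum>s<d. real_of_int (k s) * x s) \<in> borel_measurable (torus d)"
    by (intro borel_measurable_sum borel_measurable_times borel_measurable_const) simp_all
  then show ?thesis unfolding trig_def[abs_def] by measurable
qed

lemma norm_trig[simp]: "cmod (trig d k x) = 1"
  by (simp add: trig_def)

lemma trig_Suc_upd:
  "trig (Suc d) k (x(d := y)) = trig d k x * cis (2 * pi * (real_of_int (k d) * y))"
  unfolding trig_def cis_mult by (simp add: algebra_simps)

lemma integrable_torus_bounded:
  fixes f :: "(nat \<Rightarrow> real) \<Rightarrow> 'b::{banach, second_countable_topology}"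
  assumes "f \<in> borel_measurable (torus d)" "\<And>y. norm (f y) \<le> B"
  shows "integrable (torus d) f"
proof -
  interpret prob_space "torus d" by (rule prob_space_torus)
  show ?thesis by (rule integrable_const_bound[where B=B]) (use assms in auto)
qed

lemma torus_Suc: "torus (Suc d) = (\<Pi>\<^sub>M s\<in>insert d {..<d}. circle)"
  by (simp add: torus_def lessThan_Suc)

lemma integral_torus_Suc:
  fixes f :: "(nat \<Rightarrow> real) \<Rightarrow> 'b::{banach, second_countable_topology}"
  assumes "integrable (torus (Suc d)) f"
  shows "(\<integral>x. f x \<partial>torus (Suc d)) = (\<integral>x. \<integral>y. f (x(d := y)) \<partial>circle \<partial>torus d)"
  using circles.product_integral_insert[of "{..<d}" d f] assms
  by (simp add: torus_Suc) (simp add: torus_def)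

text \<open>Frequencies are grouped by their last coordinate m. For fixed remaining variables the
  circle embedding applies with the partial polynomials \<open>P m x\<close> as coefficients;
  Minkowski with exponent q/2 then moves the sum over m out of the integral over these variables.
  The frequencies in a group still carry the last coordinate, so the hypothesis speaks of
  injectivity of the restriction instead of membership in \<open>int_vecs d\<close>; it passes to
  the groups.\<close>

lemma sobolev_torus:
  fixes q :: real
  assumes q: "2 < q"
  shows "\<exists>C>0. \<forall>F a. finite F \<and> inj_on (\<lambda>k. restrict k {..<d}) F \<longrightarrow>
    (\<integral>x. cmod (\<Sum>k\<in>F. a k * trig d k x) powr q \<partial>torus d)
      \<le> C * (\<Sum>k\<in>F. 4 powr ((1/2 - 1/q) * real (\<Sum>s<d. lev (k s))) * (cmod (a k))\<^sup>2) powr (q/2)"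
proof (induction d)
  case 0
  interpret prob_space "torus 0" by (rule prob_space_torus)
  have "(\<integral>x. cmod (\<Sum>k\<in>F. a k * trig 0 k x) powr q \<partial>torus 0)
      \<le> 1 * (\<Sum>k\<in>F. 4 powr ((1/2 - 1/q) * real (\<Sum>s<0. lev (k s))) * (cmod (a k))\<^sup>2) powr (q/2)"
    if F: "finite F" "inj_on (\<lambda>k. restrict k {..<0}) F" for F and a :: "(nat \<Rightarrow> int) \<Rightarrow> complex"
  proof (cases "F = {}")
    case False
    then obtain k where k: "k \<in> F" by blast
    \<comment> \<open>All functions have the same restriction to the empty set, so injectivity
      leaves a single frequency.\<close>
    have "F = {k}"
      using F(2) k by (auto simp: inj_on_def restrict_def)
    moreover have "((cmod z)\<^sup>2) powr (q/2) = cmod z powr q" for z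
      by (simp add: powr_powr flip: powr_numeral)
    ultimately show ?thesis using prob_space by (simp add: trig_def)
  qed (use q in simp)
  then show ?case by (intro exI[of _ 1] conjI zero_less_one) blast
next
  case (Suc d)
  define \<tau> where "\<tau> = 1/2 - 1/q"
  from Suc.IH obtain C where C: "C > 0" and IH: "\<And>F a. finite F \<Longrightarrow> inj_on (\<lambda>k. restrict k {..<d}) F \<Longrightarrow>
      (\<integral>x. cmod (\<Sum>k\<in>F. a k * trig d k x) powr q \<partial>torus d)
      \<le> C * (\<Sum>k\<in>F. 4 powr (\<tau> * real (\<Sum>s<d. lev (k s))) * (cmod (a k))\<^sup>2) powr (q/2)"
    unfolding \<tau>_def by blast
  from sobolev_circle[OF q] obtain C1 where C1: "C1 > 0" and one: "\<And>S c. finite S \<Longrightarrow>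
      (\<integral>y. cmod (\<Sum>m\<in>S. c m * cis (2 * pi * (real_of_int m * y))) powr q \<partial>circle)
      \<le> C1 * (\<Sum>m\<in>S. 4 powr (\<tau> * real (lev m)) * (cmod (c m))\<^sup>2) powr (q/2)"
    unfolding \<tau>_def by blast
  have "(\<integral>x. cmod (\<Sum>k\<in>F. a k * trig (Suc d) k x) powr q \<partial>torus (Suc d))
      \<le> C1 * C * (\<Sum>k\<in>F. 4 powr (\<tau> * real (\<Sum>s<Suc d. lev (k s))) * (cmod (a k))\<^sup>2) powr (q/2)"
    if F: "finite F" and inj: "inj_on (\<lambda>k. restrict k {..<Suc d}) F" for F a
  proof -
    define S where "S = (\<lambda>k. k d) ` F"
    define G where "G m = {k\<in>F. k d = m}" for m
    define P where "P m x = (\<Sum>k\<in>G m. a k * trig d k x)" for m x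
    define A where "A m = (\<Sum>k\<in>G m. 4 powr (\<tau> * real (\<Sum>s<d. lev (k s))) * (cmod (a k))\<^sup>2)" for m
    have S: "finite S" using F by (simp add: S_def)
    have G: "finite (G m)" for m using F by (simp add: G_def)
    have injG: "inj_on (\<lambda>k. restrict k {..<d}) (G m)" for m
    proof (rule inj_onI)
      fix k l assume kl: "k \<in> G m" "l \<in> G m" "restrict k {..<d} = restrict l {..<d}"
      have "restrict k {..<Suc d} = restrict l {..<Suc d}"
      proof
        fix s show "restrict k {..<Suc d} s = restrict l {..<Suc d} s"
          using kl(1,2) fun_cong[OF kl(3), of s] by (cases "s = d") (auto simp: G_def restrict_def)
      qed
      then show "k = l" using inj kl by (auto simp: G_def inj_on_def)
    qed
    have Pm[measurable]: "P m \<in> borel_measurable (torus d)" for m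
      unfolding P_def by measurable
    have Pb: "cmod (P m x) \<le> (\<Sum>k\<in>G m. cmod (a k))" for m x
      unfolding P_def by (rule sum_norm_le) (simp add: norm_mult)
    have split: "(\<Sum>k\<in>F. a k * trig (Suc d) k (x(d := y)))
        = (\<Sum>m\<in>S. P m x * cis (2 * pi * (real_of_int m * y)))" for x y
    proof -
      have "(\<Sum>k\<in>F. a k * trig (Suc d) k (x(d := y)))
         = (\<Sum>m\<in>S. \<Sum>k\<in>{k\<in>F. k d = m}. a k * trig (Suc d) k (x(d := y)))"
        by (rule sum.group[symmetric]) (use F S in \<open>auto simp: S_def\<close>)
      also have "\<dots> = (\<Sum>m\<in>S. P m x * cis (2 * pi * (real_of_int m * y)))"
        unfolding P_def sum_distrib_right G_def
        by (intro sum.cong refl) (auto simp: trig_Suc_upd)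
      finally show ?thesis .
    qed
    have "integrable (torus (Suc d)) (\<lambda>x. cmod (\<Sum>k\<in>F. a k * trig (Suc d) k x) powr q)"
    proof (rule integrable_torus_bounded)
      fix x
      have "cmod (\<Sum>k\<in>F. a k * trig (Suc d) k x) \<le> (\<Sum>k\<in>F. cmod (a k))"
        by (rule sum_norm_le) (simp add: norm_mult)
      then show "norm (cmod (\<Sum>k\<in>F. a k * trig (Suc d) k x) powr q) \<le> (\<Sum>k\<in>F. cmod (a k)) powr q"
        using q by (simp add: powr_mono2)
    qed measurable
    then have "(\<integral>x. cmod (\<Sum>k\<in>F. a k * trig (Suc d) k x) powr q \<partial>torus (Suc d))
        = (\<integral>x. \<integral>y. cmod (\<Sum>m\<in>S. P m x * cis (2 * pi * (real_of_int m * y))) powr q \<partial>circle \<partial>torus d)"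
      by (simp add: integral_torus_Suc split)
    also have "\<dots> \<le> (\<integral>x. C1 * (\<Sum>m\<in>S. 4 powr (\<tau> * real (lev m)) * (cmod (P m x))\<^sup>2) powr (q/2) \<partial>torus d)"
    proof (rule integral_mono'[OF integrable_mult_right])
      show "integrable (torus d) (\<lambda>x. (\<Sum>m\<in>S. 4 powr (\<tau> * real (lev m)) * (cmod (P m x))\<^sup>2) powr (q/2))"
        by (rule integrable_torus_bounded[where B="(\<Sum>m\<in>S. 4 powr (\<tau> * real (lev m)) * (\<Sum>k\<in>G m. cmod (a k))\<^sup>2) powr (q/2)"])
           (use q in \<open>auto intro!: powr_mono2 sum_mono mult_left_mono power_mono Pb sum_nonneg\<close>)
    qed (use C1 S in \<open>auto intro!: one\<close>)
    also have "\<dots> = C1 * (\<integral>x. (\<Sum>m\<in>S. 4 powr (\<tau> * real (lev m)) * (cmod (P m x))\<^sup>2) powr (q/2) \<partial>torus d)"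
      by simp
    also have "\<dots> \<le> C1 * (\<Sum>m\<in>{m\<in>S. A m > 0}. 4 powr (\<tau> * real (lev m)) * (C powr (2/q) * A m)) powr (q/2)"
    proof (rule mult_left_mono)
      have A0: "A m \<ge> 0" for m unfolding A_def by (intro sum_nonneg) auto
      \<comment> \<open>Minkowski is applied with positive bounds, so groups with
        \<open>A m = 0\<close> are removed; their partial polynomials vanish.\<close>
      have "P m x = 0" if "\<not> A m > 0" for m x
      proof -
        have "A m = 0" using A0[of m] that by linarith
        then have "a k = 0" if "k \<in> G m" for k
          using that G unfolding A_def by (subst (asm) sum_nonneg_eq_0_iff) auto
        then show ?thesis by (simp add: P_def)
      qed
      then have "(\<Sum>m\<in>S. 4 powr (\<tau> * real (lev m)) * (cmod (P m x))\<^sup>2)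
          = (\<Sum>m\<in>{m\<in>S. A m > 0}. 4 powr (\<tau> * real (lev m)) * (cmod (P m x))\<^sup>2)" for x
        using S by (intro sum.mono_neutral_right) auto
      moreover have "(\<integral>x. (\<Sum>m\<in>{m\<in>S. A m > 0}. 4 powr (\<tau> * real (lev m)) * (cmod (P m x))\<^sup>2) powr (q/2) \<partial>torus d)
          \<le> (\<Sum>m\<in>{m\<in>S. A m > 0}. 4 powr (\<tau> * real (lev m)) * (C powr (2/q) * A m)) powr (q/2)"
      proof (rule minkowski_powr_sum)
        fix m assume "m \<in> {m\<in>S. A m > 0}"
        then have Am: "A m > 0" by simp
        show "4 powr (\<tau> * real (lev m)) * (C powr (2/q) * A m) > 0" using Am C by simp
        show "integrable (torus d) (\<lambda>x. (4 powr (\<tau> * real (lev m)) * (cmod (P m x))\<^sup>2) powr (q/2))"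
          by (rule integrable_torus_bounded[where B="(4 powr (\<tau> * real (lev m)) * (\<Sum>k\<in>G m. cmod (a k))\<^sup>2) powr (q/2)"])
             (use q in \<open>auto intro!: powr_mono2 mult_left_mono power_mono Pb\<close>)
        have sq: "(z\<^sup>2) powr (q/2) = z powr q" if "z \<ge> 0" for z :: real
          using that by (simp add: powr_powr flip: powr_numeral)
        have "(\<integral>x. (4 powr (\<tau> * real (lev m)) * (cmod (P m x))\<^sup>2) powr (q/2) \<partial>torus d)
            = (4 powr (\<tau> * real (lev m))) powr (q/2) * (\<integral>x. cmod (P m x) powr q \<partial>torus d)"
          by (subst integral_mult_right_zero[symmetric]) (simp only: powr_mult sq norm_ge_zero)
        also have "\<dots> \<le> (4 powr (\<tau> * real (lev m))) powr (q/2) * (C * A m powr (q/2))"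
          unfolding P_def A_def by (intro mult_left_mono IH G injG) simp
        \<comment> \<open>The constant is drawn into the power because Minkowski wants the bound as
          a single (q/2)-th power.\<close>
        also have "C * A m powr (q/2) = (C powr (2/q) * A m) powr (q/2)"
          using C Am q by (simp add: powr_mult powr_powr)
        also have "(4 powr (\<tau> * real (lev m))) powr (q/2) * (C powr (2/q) * A m) powr (q/2)
            = (4 powr (\<tau> * real (lev m)) * (C powr (2/q) * A m)) powr (q/2)"
          by (rule powr_mult[symmetric])
        finally show "(\<integral>x. (4 powr (\<tau> * real (lev m)) * (cmod (P m x))\<^sup>2) powr (q/2) \<partial>torus d)
            \<le> (4 powr (\<tau> * real (lev m)) * (C powr (2/q) * A m)) powr (q/2)" .
      qed (use q S in auto)
      ultimately show "(\<integral>x. (\<Sum>m\<in>S. 4 powr (\<tau> * real (lev m)) * (cmod (P m x))\<^sup>2) powr (q/2) \<partial>torus d)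
          \<le> (\<Sum>m\<in>{m\<in>S. A m > 0}. 4 powr (\<tau> * real (lev m)) * (C powr (2/q) * A m)) powr (q/2)" by simp
    qed (use C1 in simp)
    also have "\<dots> \<le> C1 * (\<Sum>m\<in>S. 4 powr (\<tau> * real (lev m)) * (C powr (2/q) * A m)) powr (q/2)"
      using C1 q S
      by (intro mult_left_mono powr_mono2 sum_mono2 sum_nonneg)
         (auto simp: A_def intro!: mult_nonneg_nonneg sum_nonneg)
    also have "(\<Sum>m\<in>S. 4 powr (\<tau> * real (lev m)) * (C powr (2/q) * A m))
        = C powr (2/q) * (\<Sum>m\<in>S. \<Sum>k\<in>{k\<in>F. k d = m}. 4 powr (\<tau> * real (\<Sum>s<Suc d. lev (k s))) * (cmod (a k))\<^sup>2)"
      unfolding A_def G_def sum_distrib_left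
      by (intro sum.cong refl) (auto simp: powr_add algebra_simps)
    also have "(\<Sum>m\<in>S. \<Sum>k\<in>{k\<in>F. k d = m}. 4 powr (\<tau> * real (\<Sum>s<Suc d. lev (k s))) * (cmod (a k))\<^sup>2)
        = (\<Sum>k\<in>F. 4 powr (\<tau> * real (\<Sum>s<Suc d. lev (k s))) * (cmod (a k))\<^sup>2)"
      by (rule sum.group) (use F S in \<open>auto simp: S_def\<close>)
    also have "C1 * (C powr (2/q) * \<dots>) powr (q/2) = C1 * C * \<dots> powr (q/2)"
    proof -
      have "0 \<le> (\<Sum>k\<in>F. 4 powr (\<tau> * real (\<Sum>s<Suc d. lev (k s))) * (cmod (a k))\<^sup>2)"
        by (intro sum_nonneg) auto
      then show ?thesis using C q by (simp add: powr_mult powr_powr)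
    qed
    finally show ?thesis .
  qed
  note step = this
  show ?case unfolding \<tau>_def[symmetric]
  proof (intro exI[of _ "C1 * C"] conjI mult_pos_pos C C1 allI impI)
    fix F :: "(nat \<Rightarrow> int) set" and a :: "(nat \<Rightarrow> int) \<Rightarrow> complex"
    assume "finite F \<and> inj_on (\<lambda>k. restrict k {..<Suc d}) F"
    then show "(\<integral>x. cmod (\<Sum>k\<in>F. a k * trig (Suc d) k x) powr q \<partial>torus (Suc d))
      \<le> C1 * C * (\<Sum>k\<in>F. 4 powr (\<tau> * real (\<Sum>s<Suc d. lev (k s))) * (cmod (a k))\<^sup>2) powr (q/2)"
      by (intro step) auto
  qed
qed

subsection \<open>Hyperbolic crosses and aliasing\<close>

definition level :: "nat \<Rightarrow> (nat \<Rightarrow> int) \<Rightarrow> nat" where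
  "level d k = (\<Sum>s<d. lev (k s))"

definition freq_dot :: "nat \<Rightarrow> (nat \<Rightarrow> int) \<Rightarrow> (nat \<Rightarrow> int) \<Rightarrow> int" where
  "freq_dot d k z = (\<Sum>s<d. k s * z s)"

text \<open>Since the blocks partition the integers, the only block index that can contain k is the
  vector of the levels of its components. The cross thus becomes a sublevel set of
  \<open>level\<close>.\<close>

lemma mem_hyp_cross_iff: "k \<in> hyp_cross d R \<longleftrightarrow> k \<in> int_vecs d \<and> real (level d k) \<le> R + real d - 1"
proof
  assume "k \<in> hyp_cross d R"
  then obtain j where j: "j \<in> J d R" "k \<in> (\<Pi>\<^sub>E s\<in>{..<d}. Q (j s))" by (auto simp: hyp_cross_def)
  have "lev (k s) = j s" if "s < d" for s
    using j(2) that by (auto simp: lev_eq_iff_mem_Q PiE_def)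
  then have "level d k = (\<Sum>s<d. j s)" by (simp add: level_def)
  with j show "k \<in> int_vecs d \<and> real (level d k) \<le> R + real d - 1"
    by (auto simp: J_def int_vecs_def PiE_def)
next
  assume k: "k \<in> int_vecs d \<and> real (level d k) \<le> R + real d - 1"
  define j where "j = (\<lambda>s\<in>{..<d}. lev (k s))"
  have "j \<in> J d R"
    using k by (auto simp: J_def nat_vecs_def j_def level_def)
  moreover have "k \<in> (\<Pi>\<^sub>E s\<in>{..<d}. Q (j s))"
    using k by (auto simp: j_def int_vecs_def PiE_def simp flip: lev_eq_iff_mem_Q)
  ultimately show "k \<in> hyp_cross d R" by (auto simp: hyp_cross_def)
qed

lemma finite_hyp_cross: "finite (hyp_cross d R)"
proof (rule finite_subset)
  show "hyp_cross d R \<subseteq> (\<Pi>\<^sub>E s\<in>{..<d}. {m. lev m \<le> nat \<lfloor>R + real d - 1\<rfloor>})"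
  proof
    fix k assume "k \<in> hyp_cross d R"
    then have k: "k \<in> int_vecs d" "real (level d k) \<le> R + real d - 1" by (auto simp: mem_hyp_cross_iff)
    have "lev (k s) \<le> nat \<lfloor>R + real d - 1\<rfloor>" if "s < d" for s
    proof -
      have "lev (k s) \<le> level d k" unfolding level_def by (rule member_le_sum) (use that in auto)
      also have "\<dots> \<le> nat \<lfloor>R + real d - 1\<rfloor>" using k(2) by linarith
      finally show ?thesis .
    qed
    then show "k \<in> (\<Pi>\<^sub>E s\<in>{..<d}. {m. lev m \<le> nat \<lfloor>R + real d - 1\<rfloor>})"
      using k(1) by (auto simp: int_vecs_def PiE_def)
  qed
  show "finite (\<Pi>\<^sub>E s\<in>{..<d}. {m. lev m \<le> nat \<lfloor>R + real d - 1\<rfloor>})"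
    by (intro finite_PiE card_lev_le) auto
qed

lemma hyp_cross_subset: "hyp_cross d R \<subseteq> int_vecs d"
  by (auto simp: mem_hyp_cross_iff)

lemma sum_roots_of_unity:
  fixes n :: int
  assumes "0 < M"
  shows "(\<Sum>j<M. cis (2 * pi * (real j / real M) * real_of_int n)) = (if int M dvd n then of_nat M else 0)"
proof -
  define w where "w = cis (2 * pi * (real_of_int n / real M))"
  have wj: "cis (2 * pi * (real j / real M) * real_of_int n) = w ^ j" for j
    unfolding w_def Complex.DeMoivre by (rule arg_cong[where f=cis]) (simp add: field_simps)
  have wM: "w ^ M = 1"
    unfolding w_def Complex.DeMoivre using assms cis_multiple_2pi[of "real_of_int n"] by (simp add: field_simps)
  have w1: "w = 1 \<longleftrightarrow> int M dvd n"
  proof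
    assume "w = 1"
    then have "cos (2 * pi * (real_of_int n / real M)) = 1" by (simp add: w_def complex_eq_iff)
    then obtain m :: int where "2 * pi * (real_of_int n / real M) = real_of_int m * 2 * pi"
      unfolding cos_one_2pi_int by blast
    then have "real_of_int n = real_of_int (m * int M)" using assms by (simp add: field_simps)
    then have "n = m * int M" by (simp only: of_int_eq_iff)
    then show "int M dvd n" by simp
  next
    assume "int M dvd n"
    then obtain m where "n = int M * m" by (elim dvdE)
    then show "w = 1" using assms cis_multiple_2pi[of "real_of_int m"] by (simp add: w_def)
  qed
  show ?thesis
  proof (cases "w = 1")
    case True
    then show ?thesis unfolding wj using w1 by simp
  next
    case False
    then show ?thesis unfolding wj using w1 wM geometric_sum[of w M] by simp
  qed
qed

text \<open>Aliasing: on the lattice the product of the two exponentials runs through powers of an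
  M-th root of unity, so the sum over the nodes sees only the residue of the difference of the two
  scalar products.\<close>

lemma lattice_coeff_trig:
  assumes "0 < M"
  shows "lattice_coeff d z M (trig d h) k = (if int M dvd freq_dot d h z - freq_dot d k z then 1 else 0)"
proof -
  have "trig d h (lattice_node d z M j)
        * cis (- 2 * pi * (real j / real M) * (\<Sum>s<d. real_of_int (k s) * real_of_int (z s)))
      = cis (2 * pi * (real j / real M) * real_of_int (freq_dot d h z - freq_dot d k z))" for j
  proof -
    have "(\<Sum>s<d. real_of_int (h s) * lattice_node d z M j s)
        = real j / real M * real_of_int (freq_dot d h z)"
      unfolding freq_dot_def of_int_sum sum_distrib_left
      by (intro sum.cong refl) (simp add: lattice_node_def)
    then have "trig d h (lattice_node d z M j) = cis (2 * pi * (real j / real M * real_of_int (freq_dot d h z)))"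
      by (simp add: trig_def)
    moreover have "(\<Sum>s<d. real_of_int (k s) * real_of_int (z s)) = real_of_int (freq_dot d k z)"
      by (simp add: freq_dot_def)
    ultimately show ?thesis
      by (simp only: cis_mult) (rule arg_cong[where f=cis], simp add: algebra_simps diff_divide_distrib)
  qed
  note phase = this
  show ?thesis
    unfolding lattice_coeff_def phase sum_roots_of_unity[OF assms] using assms by simp
qed

lemma lattice_coeff_trig_poly:
  assumes "0 < M"
  shows "lattice_coeff d z M (trig_poly d F c) k
    = (\<Sum>h\<in>F. if int M dvd freq_dot d h z - freq_dot d k z then c h else 0)"
proof -
  have "lattice_coeff d z M (trig_poly d F c) k = (\<Sum>h\<in>F. c h * lattice_coeff d z M (trig d h) k)"
    unfolding lattice_coeff_def trig_poly_def sum_distrib_right sum_distrib_left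
    by (subst sum.swap) (simp add: mult_ac)
  then show ?thesis
    by (simp add: lattice_coeff_trig[OF assms] if_distrib[of "\<lambda>x. _ * x"] cong: if_cong)
qed

text \<open>Sampling the single exponential with frequency k and evaluating at the origin yields the
  number of frequencies in I congruent to k modulo M. Reconstruction forces this number to be
  1.\<close>

lemma reconstructing_inj:
  assumes rec: "reconstructing d I z M" and I: "finite I"
    and k: "k \<in> I" "l \<in> I" and dvd: "int M dvd freq_dot d k z - freq_dot d l z"
  shows "k = l"
proof -
  have M: "0 < M" using rec by (simp add: reconstructing_def)
  define c where "c h = (if h = k then 1 else 0 :: complex)" for h
  define x where "x = (\<lambda>s\<in>{..<d}. 0 :: real)"
  have x: "x \<in> real_vecs d" by (simp add: x_def real_vecs_def)
  have t1: "trig d h x = 1" for h by (simp add: trig_def x_def)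
  have "sampling_op d I z M (trig_poly d I c) x = trig_poly d I c x"
    using rec x by (simp add: reconstructing_def)
  moreover have "(\<Sum>h\<in>I. if int M dvd freq_dot d h z - freq_dot d m z then c h else 0)
      = (if int M dvd freq_dot d k z - freq_dot d m z then 1 else 0)" for m
  proof -
    have "(\<Sum>h\<in>I. if int M dvd freq_dot d h z - freq_dot d m z then c h else 0)
        = (\<Sum>h\<in>I. if h = k then if int M dvd freq_dot d k z - freq_dot d m z then 1 else 0 else 0)"
      by (intro sum.cong) (auto simp: c_def)
    then show ?thesis using I k by simp
  qed
  moreover have "trig_poly d I c x = 1"
    unfolding trig_poly_def t1 c_def using I k by simp
  ultimately have "(\<Sum>m\<in>I. if int M dvd freq_dot d k z - freq_dot d m z then 1 else 0) = (1 :: complex)"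
    by (simp add: sampling_op_def lattice_coeff_trig_poly[OF M] t1)
  then have "of_nat (card {m\<in>I. int M dvd freq_dot d k z - freq_dot d m z}) = (1 :: complex)"
    using I by (simp add: sum.If_cases Int_def)
  then have "card {m\<in>I. int M dvd freq_dot d k z - freq_dot d m z} = 1"
    using of_nat_eq_1_iff by blast
  then obtain a where "{m\<in>I. int M dvd freq_dot d k z - freq_dot d m z} = {a}"
    by (auto simp: card_1_singleton_iff)
  moreover have "k \<in> {m\<in>I. int M dvd freq_dot d k z - freq_dot d m z}"
    "l \<in> {m\<in>I. int M dvd freq_dot d k z - freq_dot d m z}"
    using k dvd by auto
  ultimately show ?thesis by auto
qed

text \<open>Selects the side lengths of a smaller box: exponents below those of a given block whose
  total is just small enough for the cross.\<close>

lemma sub_sum_exists: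
  fixes j :: "'s \<Rightarrow> nat"
  assumes "finite S" "n \<le> (\<Sum>s\<in>S. j s)"
  shows "\<exists>i. (\<forall>s. i s \<le> j s) \<and> (\<Sum>s\<in>S. i s) = n"
  using assms(2)
proof (induction n)
  case 0
  then show ?case by (intro exI[of _ "\<lambda>_. 0"]) simp
next
  case (Suc n)
  then obtain i where i: "\<And>s. i s \<le> j s" "(\<Sum>s\<in>S. i s) = n" by auto
  have "\<exists>s\<in>S. i s < j s"
  proof (rule ccontr)
    assume "\<not> (\<exists>s\<in>S. i s < j s)"
    then have "(\<Sum>s\<in>S. j s) \<le> (\<Sum>s\<in>S. i s)" by (intro sum_mono) force
    with i Suc.prems show False by simp
  qed
  then obtain s where s: "s \<in> S" "i s < j s" by blast
  have "(\<Sum>t\<in>S. (i(s := Suc (i s))) t) = Suc n"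
    using assms(1) s i(2) by (simp add: sum.remove)
  then show ?case using i s by (intro exI[of _ "i(s := Suc (i s))"]) auto
qed

text \<open>A dyadic block splits into translates of boxes that fit into the hyperbolic cross, and such
  a box meets every residue class at most once.\<close>

lemma card_alias_block:
  assumes rec: "reconstructing d (hyp_cross d R) z M" and d: "d \<ge> 1"
    and n: "real n \<le> R" "n \<le> (\<Sum>s<d. j s)"
    and H: "H \<subseteq> int_vecs d" "\<And>h s. h \<in> H \<Longrightarrow> s < d \<Longrightarrow> lev (h s) = j s"
      "\<And>h. h \<in> H \<Longrightarrow> int M dvd freq_dot d h z - a"
  shows "card H \<le> 3 ^ d * 2 ^ ((\<Sum>s<d. j s) - n)"
proof -
  from sub_sum_exists[OF _ n(2)] obtain i where i: "\<And>s. i s \<le> j s" "(\<Sum>s<d. i s) = n" by auto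
  \<comment> \<open>The quotient names the translate containing h and the remainder its position
    there. The remainders lie in the cross because the exponents \<open>i s\<close> add up to n
    \<le> R.\<close>
  define \<phi> where "\<phi> h = (\<lambda>s\<in>{..<d}. h s div 2 ^ i s)" for h :: "nat \<Rightarrow> int"
  define rem where "rem h = (\<lambda>s\<in>{..<d}. h s mod 2 ^ i s)" for h :: "nat \<Rightarrow> int"
  define B where "B = (\<Pi>\<^sub>E s\<in>{..<d}. {- (2 ^ (j s - i s)) .. 2 ^ (j s - i s) :: int})"
  have rem: "rem h \<in> hyp_cross d R" for h
  proof -
    have "lev (rem h s) \<le> i s" if "s < d" for s
      using that pos_mod_bound[of "2 ^ i s" "h s"] by (auto simp: lev_le_iff rem_def intro: less_imp_le)
    then have "level d (rem h) \<le> n" unfolding level_def i(2)[symmetric] by (intro sum_mono) auto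
    then have "real (level d (rem h)) \<le> R + real d - 1" using n(1) d by linarith
    then show ?thesis by (auto simp: mem_hyp_cross_iff int_vecs_def rem_def)
  qed
  \<comment> \<open>In a common translate the difference of two frequencies is the difference of
    their remainders. Congruent frequencies thus have congruent remainders, which coincide by
    reconstruction.\<close>
  have inj: "inj_on \<phi> H"
  proof (rule inj_onI)
    fix h g assume hg: "h \<in> H" "g \<in> H" "\<phi> h = \<phi> g"
    have eq: "h s div 2 ^ i s = g s div 2 ^ i s" if "s < d" for s
      using fun_cong[OF hg(3), of s] that by (simp add: \<phi>_def)
    have diff: "h s - g s = rem h s - rem g s" if "s < d" for s
      using that eq[OF that] div_mult_mod_eq[of "h s" "2 ^ i s"] div_mult_mod_eq[of "g s" "2 ^ i s"]
      by (simp add: rem_def)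
    have "freq_dot d h z - freq_dot d g z = freq_dot d (rem h) z - freq_dot d (rem g) z"
      unfolding freq_dot_def sum_subtractf[symmetric] left_diff_distrib[symmetric]
      by (intro sum.cong refl) (simp add: diff)
    moreover have "int M dvd freq_dot d h z - freq_dot d g z"
      using dvd_diff[OF H(3)[OF hg(1)] H(3)[OF hg(2)]] by simp
    ultimately have "rem h = rem g"
      using reconstructing_inj[OF rec finite_hyp_cross rem rem] by simp
    then have "h s = g s" if "s < d" for s using diff[OF that] by simp
    then show "h = g"
      using H(1) hg by (intro PiE_ext[of h "{..<d}" "\<lambda>_. UNIV" g]) (auto simp: int_vecs_def)
  qed
  \<comment> \<open>The upper end of each interval is included because a component may equal
    \<open>2 ^ j s\<close>.\<close>
  have sub: "\<phi> ` H \<subseteq> B"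
  proof safe
    fix h assume h: "h \<in> H"
    have "h s div 2 ^ i s \<in> {- (2 ^ (j s - i s)) .. 2 ^ (j s - i s)}" if "s < d" for s
    proof -
      have pw: "(2::int) ^ j s = 2 ^ (j s - i s) * 2 ^ i s"
        using i(1)[of s] by (simp flip: power_add)
      have "\<bar>h s\<bar> \<le> 2 ^ j s" using H(2)[OF h that] by (simp flip: lev_le_iff)
      then have "h s \<le> 2 ^ (j s - i s) * 2 ^ i s" "(- (2 ^ (j s - i s))) * 2 ^ i s \<le> h s"
        unfolding pw by auto
      from zdiv_mono1[OF this(1), of "2 ^ i s"] zdiv_mono1[OF this(2), of "2 ^ i s"]
      show ?thesis by (simp del: minus_mult_left[symmetric])
    qed
    then show "\<phi> h \<in> B" by (auto simp: \<phi>_def B_def)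
  qed
  have "card H = card (\<phi> ` H)" by (rule card_image[OF inj, symmetric])
  also have "\<dots> \<le> card B" by (rule card_mono[OF _ sub]) (auto simp: B_def intro: finite_PiE)
  also have "\<dots> = (\<Prod>s<d. card {- (2 ^ (j s - i s)) .. 2 ^ (j s - i s) :: int})"
    unfolding B_def by (rule card_PiE) simp
  also have "\<dots> \<le> (\<Prod>s<d. 3 * 2 ^ (j s - i s))"
  proof (rule prod_mono)
    fix s
    have "{- (2 ^ (j s - i s)) .. 2 ^ (j s - i s) :: int} = {m. lev m \<le> j s - i s}"
      by (auto simp: lev_le_iff abs_le_iff)
    then show "0 \<le> card {- (2 ^ (j s - i s)) .. 2 ^ (j s - i s) :: int}
        \<and> card {- (2 ^ (j s - i s)) .. 2 ^ (j s - i s) :: int} \<le> 3 * 2 ^ (j s - i s)"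
      using card_lev_le(2)[of "j s - i s"] by simp
  qed
  also have "\<dots> = 3 ^ d * 2 ^ (\<Sum>s<d. j s - i s)"
    by (simp add: prod.distrib power_sum)
  also have "(\<Sum>s<d. j s - i s) = (\<Sum>s<d. j s) - n"
    unfolding i(2)[symmetric] by (rule sum_subtractf_nat) (rule i(1))
  finally show ?thesis .
qed

subsection \<open>Hybrid weights\<close>

text \<open>Separated from the Fourier coefficients so that coefficient families of trigonometric
  polynomials can be measured without referring to a function.\<close>

definition hybrid_weight :: "nat \<Rightarrow> real \<Rightarrow> real \<Rightarrow> (nat \<Rightarrow> int) \<Rightarrow> real" where
  "hybrid_weight d \<alpha> \<beta> k = (1 + (\<Sum>s<d. (real_of_int (k s))\<^sup>2)) powr \<beta>
       * (\<Prod>s<d. (1 + (real_of_int (k s))\<^sup>2) powr \<alpha>)"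

lemma hybrid_term_eq: "hybrid_term d \<alpha> \<beta> f k = hybrid_weight d \<alpha> \<beta> k * (cmod (fourier_coeff d f k))\<^sup>2"
  by (simp add: hybrid_term_def hybrid_weight_def)

lemma hybrid_weight_pos: "hybrid_weight d \<alpha> \<beta> k > 0"
proof -
  have "0 < 1 + (real_of_int m)\<^sup>2" for m by (simp add: add_pos_nonneg)
  moreover have "0 < 1 + (\<Sum>s<d. (real_of_int (k s))\<^sup>2)"
    by (intro add_pos_nonneg sum_nonneg) auto
  ultimately show ?thesis
    unfolding hybrid_weight_def by (intro mult_pos_pos prod_pos) (auto simp: less_imp_neq[symmetric])
qed

lemma square_le_four_power_lev: "(real_of_int m)\<^sup>2 \<le> 4 ^ lev m"
proof -
  have "real_of_int \<bar>m\<bar> \<le> real_of_int (2 ^ lev m)"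
    using abs_le_two_power_lev[of m] by (simp only: of_int_le_iff)
  then have "\<bar>real_of_int m\<bar> \<le> 2 ^ lev m" by simp
  then have "\<bar>real_of_int m\<bar>\<^sup>2 \<le> (2 ^ lev m)\<^sup>2" by (rule power_mono) simp
  also have "((2::real) ^ lev m)\<^sup>2 = 4 ^ lev m"
    by (simp add: power2_eq_square flip: power_mult_distrib)
  finally show ?thesis by simp
qed

lemma four_power_lev_le: "4 ^ lev m \<le> 4 * (1 + (real_of_int m)\<^sup>2)"
proof (cases "lev m")
  case (Suc j)
  then have "\<not> lev m \<le> j" by simp
  then have "real_of_int (2 ^ j) \<le> real_of_int \<bar>m\<bar>" by (simp only: lev_le_iff of_int_le_iff)
  then have "(2 ^ j)\<^sup>2 \<le> \<bar>real_of_int m\<bar>\<^sup>2" by (intro power_mono) auto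
  moreover have "((2::real) ^ j)\<^sup>2 = 4 ^ j"
    by (simp add: power2_eq_square flip: power_mult_distrib)
  ultimately show ?thesis using Suc by simp
qed simp

text \<open>The sum is at most its number of terms times the largest term. This covers exponents
  below and above 1 alike, with no recourse to convexity.\<close>

lemma powr_sum_le:
  fixes x :: "'i \<Rightarrow> real"
  assumes "finite S" "S \<noteq> {}" "\<And>i. i \<in> S \<Longrightarrow> x i \<ge> 0" "b \<ge> 0"
  shows "(\<Sum>i\<in>S. x i) powr b \<le> real (card S) powr b * (\<Sum>i\<in>S. x i powr b)"
proof -
  have "Max (x ` S) \<in> x ` S" using assms by (intro Max_in) auto
  then obtain t where t: "t \<in> S" "Max (x ` S) = x t" by auto
  have "x i \<le> x t" if "i \<in> S" for i unfolding t(2)[symmetric] using assms that by simp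
  then have "(\<Sum>i\<in>S. x i) \<le> real (card S) * x t" by (rule sum_bounded_above)
  then have "(\<Sum>i\<in>S. x i) powr b \<le> (real (card S) * x t) powr b"
    using assms by (intro powr_mono2 sum_nonneg) auto
  also have "\<dots> = real (card S) powr b * x t powr b" by (rule powr_mult)
  also have "\<dots> \<le> real (card S) powr b * (\<Sum>i\<in>S. x i powr b)"
    using assms t by (intro mult_left_mono member_le_sum) auto
  finally show ?thesis .
qed

text \<open>Up to constants the reciprocal weight is \<open>4\<close> to the power \<open>-\<alpha> |j|\<^sub>1 - \<beta> |j|\<^sub>\<infinity>\<close> on the dyadic
  block with index \<open>j\<close>; the maximum is replaced by a sum over the coordinates.\<close>

lemma inverse_hybrid_weight_le:
  fixes \<alpha> \<beta> :: real
  assumes "\<alpha> > 0" "\<beta> \<le> 0" "d \<ge> 1"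
  shows "1 / hybrid_weight d \<alpha> \<beta> k \<le> 4 powr (\<alpha> * d) * (2 * real d) powr (- \<beta>)
    * (\<Sum>s<d. 4 powr (- \<alpha> * level d k - \<beta> * lev (k s)))"
proof -
  define b where "b = - \<beta>"
  have b: "b \<ge> 0" using assms by (simp add: b_def)
  define X where "X = 1 + (\<Sum>s<d. (real_of_int (k s))\<^sup>2)"
  have X: "X > 0" unfolding X_def by (intro add_pos_nonneg sum_nonneg) auto
  \<comment> \<open>The summand 1 of X is absorbed by the coordinate 0, whose term is at least 1;
    hence the factor 2.\<close>
  have "X \<le> 2 * (\<Sum>s<d. 4 ^ lev (k s))"
  proof -
    have "(1::real) \<le> 4 ^ lev (k 0)" by simp
    also have "\<dots> \<le> (\<Sum>s<d. 4 ^ lev (k s))"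
      using assms by (intro member_le_sum) auto
    finally have "1 \<le> (\<Sum>s<d. (4::real) ^ lev (k s))" .
    moreover have "(\<Sum>s<d. (real_of_int (k s))\<^sup>2) \<le> (\<Sum>s<d. 4 ^ lev (k s))"
      by (intro sum_mono square_le_four_power_lev)
    ultimately show ?thesis by (simp add: X_def)
  qed
  then have "X powr b \<le> (2 * (\<Sum>s<d. 4 ^ lev (k s))) powr b"
    using b X by (intro powr_mono2) auto
  also have "\<dots> = 2 powr b * (\<Sum>s<d. 4 ^ lev (k s)) powr b" by (rule powr_mult)
  also have "\<dots> \<le> 2 powr b * (real (card {..<d}) powr b * (\<Sum>s<d. (4 ^ lev (k s)) powr b))"
    using assms b by (intro mult_left_mono powr_sum_le) (auto simp: lessThan_empty_iff)
  also have "\<dots> = (2 * real d) powr b * (\<Sum>s<d. 4 powr (b * lev (k s)))"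
    by (simp add: powr_mult powr_powr mult.commute flip: powr_realpow)
  finally have 1: "X powr b \<le> (2 * real d) powr b * (\<Sum>s<d. 4 powr (b * lev (k s)))" .
  have 2: "(\<Prod>s<d. (1 + (real_of_int (k s))\<^sup>2) powr (- \<alpha>)) \<le> 4 powr (\<alpha> * d) * 4 powr (- \<alpha> * level d k)"
  proof -
    \<comment> \<open>The exponent is negative, so each factor is estimated through its lower bound
      \<open>4 ^ lev (k s) / 4\<close>; the d quarters make up the constant
      \<open>4 powr (\<alpha> * d)\<close>.\<close>
    have "(\<Prod>s<d. (1 + (real_of_int (k s))\<^sup>2) powr (- \<alpha>)) \<le> (\<Prod>s<d. (4 ^ lev (k s) / 4) powr (- \<alpha>))"
      using assms four_power_lev_le by (intro prod_mono conjI powr_mono2') (auto simp: field_simps)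
    also have "\<dots> = (\<Prod>s<d. 4 powr \<alpha> * 4 powr (- \<alpha> * lev (k s)))"
      by (intro prod.cong refl)
         (simp add: powr_divide powr_powr powr_minus divide_simps mult.commute flip: powr_realpow)
    also have "\<dots> = (4 powr \<alpha>) ^ d * 4 powr (\<Sum>s<d. - \<alpha> * lev (k s))"
      by (simp add: prod.distrib powr_sum)
    also have "\<dots> = 4 powr (\<alpha> * d) * 4 powr (- \<alpha> * level d k)"
      unfolding level_def of_nat_sum sum_distrib_left by (simp add: powr_powr flip: powr_realpow)
    finally show ?thesis .
  qed
  have "1 / hybrid_weight d \<alpha> \<beta> k = X powr b * (\<Prod>s<d. (1 + (real_of_int (k s))\<^sup>2) powr (- \<alpha>))"
    by (simp add: hybrid_weight_def X_def b_def powr_minus_divide prod_dividef)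
  also have "\<dots> \<le> ((2 * real d) powr b * (\<Sum>s<d. 4 powr (b * lev (k s)))) * (4 powr (\<alpha> * d) * 4 powr (- \<alpha> * level d k))"
    by (intro mult_mono 1 2 prod_nonneg mult_nonneg_nonneg sum_nonneg) auto
  also have "\<dots> = 4 powr (\<alpha> * d) * (2 * real d) powr b * (\<Sum>s<d. 4 powr (- \<alpha> * level d k) * 4 powr (b * lev (k s)))"
    unfolding sum_distrib_left sum_distrib_right by (simp only: mult_ac)
  also have "\<dots> = 4 powr (\<alpha> * d) * (2 * real d) powr (- \<beta>) * (\<Sum>s<d. 4 powr (- \<alpha> * level d k - \<beta> * lev (k s)))"
    unfolding powr_add[symmetric] b_def by simp
  finally show ?thesis .
qed

text \<open>As -\<beta> is nonnegative, each coordinate level may be replaced by the total level.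
  This coarser bound suffices for single frequencies and for summability; the alias sums keep the
  finer one, since the excess decay away from the axes is what saves the logarithm when \<beta> <
  0.\<close>

lemma inverse_hybrid_weight_le_level:
  fixes \<alpha> \<beta> :: real
  assumes "\<alpha> > 0" "\<beta> \<le> 0" "d \<ge> 1"
  shows "1 / hybrid_weight d \<alpha> \<beta> k \<le> 4 powr (\<alpha> * d) * (2 * real d) powr (- \<beta>) * d
    * 4 powr (- (\<alpha> + \<beta>) * level d k)"
proof -
  have "(\<Sum>s<d. 4 powr (- \<alpha> * level d k - \<beta> * lev (k s))) \<le> real (card {..<d}) * 4 powr (- (\<alpha> + \<beta>) * level d k)"
  proof (rule sum_bounded_above)
    fix s assume "s \<in> {..<d}"
    then have "lev (k s) \<le> level d k" unfolding level_def by (intro member_le_sum) auto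
    then have "- \<beta> * real (lev (k s)) \<le> - \<beta> * real (level d k)"
      using assms by (intro mult_left_mono) auto
    then have "- \<alpha> * level d k - \<beta> * lev (k s) \<le> - (\<alpha> + \<beta>) * level d k" by (simp add: algebra_simps)
    then show "4 powr (- \<alpha> * level d k - \<beta> * lev (k s)) \<le> 4 powr (- (\<alpha> + \<beta>) * level d k)"
      by (intro powr_mono) auto
  qed
  then have "4 powr (\<alpha> * d) * (2 * real d) powr (- \<beta>) * (\<Sum>s<d. 4 powr (- \<alpha> * level d k - \<beta> * lev (k s)))
      \<le> 4 powr (\<alpha> * d) * (2 * real d) powr (- \<beta>) * (real (card {..<d}) * 4 powr (- (\<alpha> + \<beta>) * level d k))"
    by (intro mult_left_mono) auto
  from order_trans[OF inverse_hybrid_weight_le[OF assms] this] show ?thesis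
    by (simp only: mult.assoc card_lessThan)
qed

section \<open>Tail sums over dyadic levels\<close>

lemma power_le_exp_scaled:
  fixes x \<eta> :: real
  assumes "\<eta> > 0" "x \<ge> 0"
  shows "x ^ k \<le> fact k / \<eta> ^ k * exp (\<eta> * x)"
proof -
  have "(\<eta> * x) ^ k / fact k \<le> exp (\<eta> * x)"
  proof -
    have "(\<Sum>n\<in>{k}. (\<eta> * x) ^ n /\<^sub>R fact n) \<le> (\<Sum>n. (\<eta> * x) ^ n /\<^sub>R fact n)"
      using assms by (intro sum_le_suminf summable_exp_generic) auto
    then show ?thesis by (simp add: exp_def divide_inverse mult.commute)
  qed
  then show ?thesis using assms by (simp add: field_simps power_mult_distrib)
qed

text \<open>The decay is split in two halves, each with rate \<eta>. One absorbs the polynomial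
  growth in the distance from the start of the tail, the other is summed as a geometric series; of
  the polynomial only its size at the start, of order \<open>R ^ k\<close>, survives.\<close>

lemma exponential_tail_sum:
  fixes \<delta> :: real
  assumes "\<delta> > 0"
  shows "\<exists>C>0. \<forall>R A. R \<ge> 1 \<and> finite A \<and> (\<forall>n\<in>A. real n > R) \<longrightarrow>
    (\<Sum>n\<in>A. 2 powr (- \<delta> * real n) * (real n + 1) ^ k) \<le> C * 2 powr (- \<delta> * R) * R ^ k"
proof -
  define \<eta> where "\<eta> = \<delta> * ln 2 / 2"
  define r where "r = exp (- \<eta>)"
  define c where "c = fact k / \<eta> ^ k * exp (2 * \<eta>)"
  have \<eta>: "\<eta> > 0" using assms by (simp add: \<eta>_def)
  have r: "0 < r" "r < 1" using \<eta> by (auto simp: r_def)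
  have c: "c > 0" using \<eta> by (simp add: c_def)
  have "(\<Sum>n\<in>A. 2 powr (- \<delta> * real n) * (real n + 1) ^ k) \<le> 2 ^ k * c / (1 - r) * 2 powr (- \<delta> * R) * R ^ k"
    if R: "R \<ge> 1" and A: "finite A" "\<And>n. n \<in> A \<Longrightarrow> real n > R" for R A
  proof -
    define n0 where "n0 = nat \<lceil>R\<rceil>"
    have n0: "R \<le> real n0" "real n0 < R + 1" using R by (auto simp: n0_def) linarith
    have n0A: "n0 \<le> n" if "n \<in> A" for n using A(2)[OF that] R by (simp add: n0_def ceiling_le_iff nat_le_iff)
    have "(\<Sum>n\<in>A. 2 powr (- \<delta> * real n) * (real n + 1) ^ k)
        \<le> (\<Sum>n\<in>A. 2 powr (- \<delta> * R) * (2 * R) ^ k * c * r ^ (n - n0))"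
    proof (rule sum_mono)
      fix n assume n: "n \<in> A"
      define m where "m = n - n0"
      have m: "real n = real n0 + real m" using n0A[OF n] by (simp add: m_def)
      \<comment> \<open>A product instead of a sum, so that the k-th power separates R from the
        offset m.\<close>
      have "real n + 1 \<le> 2 * R * (real m + 2)"
      proof -
        have "real n + 1 \<le> R + (real m + 2)" using n0 m by linarith
        also have "\<dots> \<le> R * (real m + 2) + R * (real m + 2)"
        proof (rule add_mono)
          show "R \<le> R * (real m + 2)" using R mult_left_mono[of 1 "real m + 2" R] by simp
          show "real m + 2 \<le> R * (real m + 2)" using R mult_right_mono[of 1 R "real m + 2"] by simp
        qed
        finally show ?thesis by simp
      qed
      then have "(real n + 1) ^ k \<le> (2 * R * (real m + 2)) ^ k" by (intro power_mono) auto
      also have "\<dots> = (2 * R) ^ k * (real m + 2) ^ k" by (rule power_mult_distrib)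
      also have "\<dots> \<le> (2 * R) ^ k * (fact k / \<eta> ^ k * exp (\<eta> * (real m + 2)))"
        using R by (intro mult_left_mono power_le_exp_scaled \<eta>) auto
      also have "\<dots> = (2 * R) ^ k * c * exp (\<eta> * real m)"
        by (simp add: c_def distrib_left exp_add mult_ac)
      finally have 1: "(real n + 1) ^ k \<le> (2 * R) ^ k * c * exp (\<eta> * real m)" .
      have "2 powr (- \<delta> * real n) \<le> 2 powr (- \<delta> * (R + real m))"
        using n0 m assms by (intro powr_mono) auto
      also have "\<dots> = 2 powr (- \<delta> * R) * exp (- 2 * \<eta> * real m)"
        by (simp add: powr_def \<eta>_def exp_add[symmetric] algebra_simps)
      finally have "2 powr (- \<delta> * real n) * (real n + 1) ^ k
          \<le> (2 powr (- \<delta> * R) * exp (- 2 * \<eta> * real m)) * ((2 * R) ^ k * c * exp (\<eta> * real m))"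
        using 1 by (intro mult_mono) auto
      also have "\<dots> = 2 powr (- \<delta> * R) * (2 * R) ^ k * c * (exp (- 2 * \<eta> * real m) * exp (\<eta> * real m))"
        by (simp only: mult_ac)
      also have "exp (- 2 * \<eta> * real m) * exp (\<eta> * real m) = r ^ (n - n0)"
        unfolding r_def m_def[symmetric] exp_add[symmetric] exp_of_nat_mult[symmetric] by (simp add: algebra_simps)
      finally show "2 powr (- \<delta> * real n) * (real n + 1) ^ k
          \<le> 2 powr (- \<delta> * R) * (2 * R) ^ k * c * r ^ (n - n0)" .
    qed
    also have "\<dots> = 2 powr (- \<delta> * R) * (2 * R) ^ k * c * (\<Sum>n\<in>A. r ^ (n - n0))"
      by (simp add: sum_distrib_left)
    also have "(\<Sum>n\<in>A. r ^ (n - n0)) \<le> 1 / (1 - r)"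
    proof -
      have "inj_on (\<lambda>n. n - n0) A" using n0A by (intro inj_onI) (metis le_add_diff_inverse)
      then have "(\<Sum>n\<in>A. r ^ (n - n0)) = (\<Sum>m\<in>(\<lambda>n. n - n0) ` A. r ^ m)" by (simp add: sum.reindex)
      also have "\<dots> \<le> (\<Sum>m. r ^ m)"
        using r A by (intro sum_le_suminf summable_geometric) auto
      also have "\<dots> = 1 / (1 - r)" using r by (intro suminf_geometric) auto
      finally show ?thesis .
    qed
    finally show ?thesis using R c by (simp add: power_mult_distrib field_simps)
  qed
  moreover have "2 ^ k * c / (1 - r) > 0" using c r by simp
  ultimately show ?thesis by blast
qed

text \<open>With n the total of j, the coordinate \<open>j s\<close> is n minus the other
  coordinates. The exponent to base 2 becomes -\<delta> n plus 2 \<beta> times the sum of the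
  others, so the sum over these factors into d - 1 copies of \<open>G n\<close>. For \<beta> < 0
  they are bounded geometric sums, for \<beta> = 0 each equals n + 1: this is the source of the
  power \<open>R ^ (d - 1)\<close>.\<close>

lemma level_tail_sum:
  fixes \<alpha> \<beta> :: real
  assumes "\<alpha> + \<beta> > 1/2" "\<beta> \<le> 0" "d \<ge> 1"
  shows "\<exists>C>0. \<forall>R s J. R \<ge> 1 \<and> s < d \<and> finite J \<and> J \<subseteq> nat_vecs d \<and> (\<forall>j\<in>J. real (\<Sum>s<d. j s) > R) \<longrightarrow>
    (\<Sum>j\<in>J. 2 ^ (\<Sum>s<d. j s) * 4 powr (- \<alpha> * real (\<Sum>s<d. j s) - \<beta> * real (j s)))
      \<le> C * 2 powr (- (2 * (\<alpha> + \<beta>) - 1) * R) * (if \<beta> = 0 then R ^ (d - 1) else 1)"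
proof -
  define \<delta> where "\<delta> = 2 * (\<alpha> + \<beta>) - 1"
  have \<delta>: "\<delta> > 0" using assms by (simp add: \<delta>_def)
  define k where "k = (if \<beta> = 0 then d - 1 else 0)"
  define G where "G n = (\<Sum>i\<le>n. 2 powr (2 * \<beta> * real i))" for n :: nat
  have "\<exists>D>0. \<forall>n. G n ^ (d - 1) \<le> D * (real n + 1) ^ k"
  proof (cases "\<beta> = 0")
    case True
    then show ?thesis by (intro exI[of _ 1]) (simp add: G_def k_def add.commute)
  next
    case False
    define x :: real where "x = 2 powr (2 * \<beta>)"
    have x: "0 < x" "x < 1" using False assms powr_less_mono[of "2 * \<beta>" 0 2] by (auto simp: x_def)
    have "G n \<le> 1 / (1 - x)" for n
    proof -
      have "G n = (\<Sum>i\<le>n. x ^ i)" by (simp add: G_def x_def powr_powr flip: powr_realpow)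
      also have "\<dots> \<le> (\<Sum>i. x ^ i)" using x by (intro sum_le_suminf summable_geometric) auto
      also have "\<dots> = 1 / (1 - x)" using x by (intro suminf_geometric) auto
      finally show ?thesis .
    qed
    then have "G n ^ (d - 1) \<le> (1 / (1 - x)) ^ (d - 1)" for n
      by (intro power_mono) (auto simp: G_def intro!: sum_nonneg)
    then show ?thesis using x False by (intro exI[of _ "(1 / (1 - x)) ^ (d - 1)"]) (simp add: k_def)
  qed
  then obtain D where D: "D > 0" "\<forall>n. G n ^ (d - 1) \<le> D * (real n + 1) ^ k"
    by (elim exE conjE) (rule that)
  from exponential_tail_sum[OF \<delta>, of k] obtain C where C: "C > 0"
    "\<forall>R A. R \<ge> 1 \<and> finite A \<and> (\<forall>n\<in>A. real n > R) \<longrightarrow>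
      (\<Sum>n\<in>A. 2 powr (- \<delta> * real n) * (real n + 1) ^ k) \<le> C * 2 powr (- \<delta> * R) * R ^ k"
    by (elim exE conjE) (rule that)
  have "(\<Sum>j\<in>J. 2 ^ (\<Sum>s<d. j s) * 4 powr (- \<alpha> * real (\<Sum>s<d. j s) - \<beta> * real (j s)))
      \<le> D * C * 2 powr (- \<delta> * R) * R ^ k"
    if R: "R \<ge> 1" and s: "s < d" and J: "finite J" "J \<subseteq> nat_vecs d" "\<And>j. j \<in> J \<Longrightarrow> real (\<Sum>s<d. j s) > R" for R s J
  proof -
    define T where "T = {..<d} - {s}"
    have T: "finite T" "card T = d - 1" using s by (auto simp: T_def)
    define tot where "tot j = (\<Sum>s<d. j s)" for j :: "nat \<Rightarrow> nat"
    have tot: "tot j = j s + sum j T" for j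
      unfolding tot_def T_def using s by (simp add: sum.remove)
    define A where "A = tot ` J"
    define g where "g = (\<lambda>(n :: nat, t). 2 powr (- \<delta> * real n) * (\<Prod>i\<in>T. 2 powr (2 * \<beta> * real (t i))))"
    \<comment> \<open>The total and the coordinates other than s determine j.\<close>
    define \<Phi> where "\<Phi> j = (tot j, restrict j T)" for j
    have inj: "inj_on \<Phi> J"
    proof (rule inj_onI)
      fix i j assume ij: "i \<in> J" "j \<in> J" "\<Phi> i = \<Phi> j"
      have "restrict i T = restrict j T" using ij(3) by (simp add: \<Phi>_def)
      from fun_cong[OF this] have eq: "i u = j u" if "u \<in> T" for u using that by (metis restrict_apply')
      then have "sum i T = sum j T" by (intro sum.cong) auto
      then have "i s = j s" using ij(3) tot[of i] tot[of j] by (simp add: \<Phi>_def)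
      with eq have "i u = j u" if "u < d" for u using that by (cases "u = s") (auto simp: T_def)
      then show "i = j"
        using J(2) ij by (intro PiE_ext[of i "{..<d}" "\<lambda>_. UNIV" j]) (auto simp: nat_vecs_def)
    qed
    have sub: "\<Phi> ` J \<subseteq> Sigma A (\<lambda>n. \<Pi>\<^sub>E i\<in>T. {..n})"
    proof -
      have "j u \<le> tot j" if "u \<in> T" for j u
        unfolding tot_def using that by (intro member_le_sum) (auto simp: T_def)
      then show ?thesis by (auto simp: \<Phi>_def A_def)
    qed
    have "(\<Sum>j\<in>J. 2 ^ (\<Sum>s<d. j s) * 4 powr (- \<alpha> * real (\<Sum>s<d. j s) - \<beta> * real (j s))) = (\<Sum>j\<in>J. g (\<Phi> j))"
    proof (rule sum.cong[OF refl])
      fix j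
      have js: "real (j s) = real (tot j) - (\<Sum>i\<in>T. real (j i))" by (simp add: tot)
      have "2 ^ tot j * 4 powr (- \<alpha> * real (tot j) - \<beta> * real (j s))
          = 2 powr (real (tot j) + 2 * (- \<alpha> * real (tot j) - \<beta> * real (j s)))"
        by (simp add: four_powr powr_add powr_realpow)
      also have "real (tot j) + 2 * (- \<alpha> * real (tot j) - \<beta> * real (j s))
          = - \<delta> * real (tot j) + (\<Sum>i\<in>T. 2 * \<beta> * real (j i))"
        unfolding js sum_distrib_left[symmetric] by (simp add: \<delta>_def algebra_simps)
      also have "2 powr \<dots> = g (\<Phi> j)"
        by (subst powr_add, subst powr_sum) (simp_all add: g_def \<Phi>_def cong: prod.cong)
      finally show "2 ^ (\<Sum>s<d. j s) * 4 powr (- \<alpha> * real (\<Sum>s<d. j s) - \<beta> * real (j s)) = g (\<Phi> j)"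
        by (simp add: tot_def)
    qed
    also have "\<dots> = (\<Sum>p\<in>\<Phi> ` J. g p)" by (simp add: sum.reindex[OF inj])
    \<comment> \<open>The other coordinates are allowed to run through the full box up to n, which
      only adds nonnegative terms and gives the sum its product form.\<close>
    also have "\<dots> \<le> (\<Sum>p\<in>Sigma A (\<lambda>n. \<Pi>\<^sub>E i\<in>T. {..n}). g p)"
      using J(1) T sub by (intro sum_mono2) (auto simp: A_def g_def intro!: finite_SigmaI finite_PiE mult_nonneg_nonneg prod_nonneg)
    also have "\<dots> = (\<Sum>n\<in>A. 2 powr (- \<delta> * real n) * (\<Sum>t\<in>(\<Pi>\<^sub>E i\<in>T. {..n}). \<Prod>i\<in>T. 2 powr (2 * \<beta> * real (t i))))"
      unfolding g_def using J(1) T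
      by (subst sum.Sigma[symmetric]) (auto simp: A_def sum_distrib_left intro!: finite_PiE)
    also have "\<dots> = (\<Sum>n\<in>A. 2 powr (- \<delta> * real n) * G n ^ (d - 1))"
    proof -
      have "(\<Sum>t\<in>(\<Pi>\<^sub>E i\<in>T. {..n}). \<Prod>i\<in>T. 2 powr (2 * \<beta> * real (t i))) = G n ^ (d - 1)" for n
        using prod_sum_PiE[of T "\<lambda>_. {..n}" "\<lambda>_ y. 2 powr (2 * \<beta> * real y)"] T by (simp add: G_def)
      then show ?thesis by simp
    qed
    also have "\<dots> \<le> (\<Sum>n\<in>A. 2 powr (- \<delta> * real n) * (D * (real n + 1) ^ k))"
      by (intro sum_mono mult_left_mono D(2)[rule_format]) auto
    also have "\<dots> = D * (\<Sum>n\<in>A. 2 powr (- \<delta> * real n) * (real n + 1) ^ k)"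
      unfolding sum_distrib_left by (simp only: mult_ac)
    also have "\<dots> \<le> D * (C * 2 powr (- \<delta> * R) * R ^ k)"
      using D J R by (intro mult_left_mono C(2)[rule_format]) (auto simp: A_def tot_def)
    finally show ?thesis by (simp add: mult.assoc)
  qed
  note main = this
  show ?thesis
  proof (intro exI[of _ "D * C"] conjI mult_pos_pos D(1) C(1) allI impI, elim conjE)
    fix R :: real and s and J :: "(nat \<Rightarrow> nat) set"
    assume "R \<ge> 1" "s < d" "finite J" "J \<subseteq> nat_vecs d" "\<forall>j\<in>J. R < real (\<Sum>s<d. j s)"
    then show "(\<Sum>j\<in>J. 2 ^ (\<Sum>s<d. j s) * 4 powr (- \<alpha> * real (\<Sum>s<d. j s) - \<beta> * real (j s)))
      \<le> D * C * 2 powr (- (2 * (\<alpha> + \<beta>) - 1) * R) * (if \<beta> = 0 then R ^ (d - 1) else 1)"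
      using main[of R s J] unfolding \<delta>_def k_def by (auto split: if_splits)
  qed
qed

subsection \<open>Sampling of trigonometric polynomials\<close>

text \<open>The number of frequencies of one residue class in the block j is of order 2 to the power
  |j|\<sub>1 - R\<open>,\<close> so the tail sum gains a factor \<open>2 powr (- R)\<close> over the
  full sum, and the exponents -R and -(2 (\<alpha> + \<beta>) - 1) R add up to -2 (\<alpha> +
  \<beta>) R.\<close>

lemma alias_sum_bound:
  fixes \<alpha> \<beta> :: real
  assumes ab: "\<alpha> > 0" "\<beta> \<le> 0" "\<alpha> + \<beta> > 1/2" and d: "d \<ge> 1"
  shows "\<exists>C>0. \<forall>R z M F a. R \<ge> 1 \<and> reconstructing d (hyp_cross d R) z M \<and> finite F
      \<and> F \<subseteq> int_vecs d - hyp_cross d R \<and> (\<forall>h\<in>F. int M dvd freq_dot d h z - a) \<longrightarrow>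
    (\<Sum>h\<in>F. 1 / hybrid_weight d \<alpha> \<beta> h)
      \<le> C * 2 powr (- 2 * (\<alpha> + \<beta>) * R) * (if \<beta> = 0 then R ^ (d - 1) else 1)"
proof -
  define w where "w = hybrid_weight d \<alpha> \<beta>"
  define K where "K = 4 powr (\<alpha> * d) * (2 * real d) powr (- \<beta>)"
  have K: "K > 0" using d by (simp add: K_def)
  from level_tail_sum[OF ab(3,2) d] obtain C where C: "C > 0"
    "\<forall>R s J. R \<ge> 1 \<and> s < d \<and> finite J \<and> J \<subseteq> nat_vecs d \<and> (\<forall>j\<in>J. real (\<Sum>s<d. j s) > R) \<longrightarrow>
    (\<Sum>j\<in>J. 2 ^ (\<Sum>s<d. j s) * 4 powr (- \<alpha> * real (\<Sum>s<d. j s) - \<beta> * real (j s)))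
      \<le> C * 2 powr (- (2 * (\<alpha> + \<beta>) - 1) * R) * (if \<beta> = 0 then R ^ (d - 1) else 1)"
    by (elim exE conjE) (rule that)
  have main: "(\<Sum>h\<in>F. 1 / w h)
      \<le> K * (2 * 3 ^ d) * real d * C * 2 powr (- 2 * (\<alpha> + \<beta>) * R) * (if \<beta> = 0 then R ^ (d - 1) else 1)"
    if R: "R \<ge> 1" and rec: "reconstructing d (hyp_cross d R) z M" and F: "finite F"
      "F \<subseteq> int_vecs d - hyp_cross d R" and dvd: "\<And>h. h\<in>F \<Longrightarrow> int M dvd freq_dot d h z - a" for R z M F a
  proof -
    define lv where "lv h = (\<lambda>s\<in>{..<d}. lev (h s))" for h :: "nat \<Rightarrow> int"
    define J where "J = lv ` F"
    define n where "n = nat \<lfloor>R\<rfloor>"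
    have n: "real n \<le> R" "R < real n + 1" using R unfolding n_def by linarith+
    have sum_lv: "(\<Sum>s<d. lv h s) = level d h" for h by (simp add: lv_def level_def)
    have J: "finite J" "J \<subseteq> nat_vecs d" using F by (auto simp: J_def lv_def nat_vecs_def split: if_splits)
    have JR: "real (\<Sum>s<d. j s) > R" if "j \<in> J" for j
    proof -
      obtain h where "h \<in> F" "j = lv h" using \<open>j \<in> J\<close> by (auto simp: J_def)
      then show ?thesis using F(2) d by (auto simp: sum_lv mem_hyp_cross_iff simp del: of_nat_sum)
    qed
    define t where "t j = (\<Sum>s<d. 4 powr (- \<alpha> * real (\<Sum>s<d. j s) - \<beta> * real (j s)))" for j :: "nat \<Rightarrow> nat"
    have "(\<Sum>h\<in>F. 1 / w h) = (\<Sum>j\<in>J. \<Sum>h\<in>{h\<in>F. lv h = j}. 1 / w h)"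
      by (rule sum.group[symmetric]) (use F J in \<open>auto simp: J_def\<close>)
    also have "\<dots> \<le> (\<Sum>j\<in>J. (3 ^ d * (2 ^ (\<Sum>s<d. j s) * (2 * 2 powr (- R)))) * (K * t j))"
    proof (rule sum_mono)
      fix j assume j: "j \<in> J"
      have nj: "n \<le> (\<Sum>s<d. j s)" using JR[OF j] n by linarith
      have "(\<Sum>h\<in>{h\<in>F. lv h = j}. 1 / w h) \<le> real (card {h\<in>F. lv h = j}) * (K * t j)"
      proof (rule sum_bounded_above)
        fix h assume "h \<in> {h\<in>F. lv h = j}"
        then have "j = lv h" by simp
        then have "t j = (\<Sum>s<d. 4 powr (- \<alpha> * level d h - \<beta> * lev (h s)))"
          unfolding t_def \<open>j = lv h\<close> sum_lv by (intro sum.cong) (auto simp: lv_def)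
        then show "1 / w h \<le> K * t j"
          unfolding w_def K_def using inverse_hybrid_weight_le[OF ab(1,2) d, of h] by simp
      qed
      also have "\<dots> \<le> (3 ^ d * (2 ^ (\<Sum>s<d. j s) * (2 * 2 powr (- R)))) * (K * t j)"
      proof (rule mult_right_mono)
        have "card {h\<in>F. lv h = j} \<le> 3 ^ d * 2 ^ ((\<Sum>s<d. j s) - n)"
        proof (rule card_alias_block[OF rec d n(1) nj])
          fix h s assume "h \<in> {h\<in>F. lv h = j}" "s < d"
          then show "lev (h s) = j s" by (auto simp: lv_def)
        qed (use F dvd in auto)
        then have "real (card {h\<in>F. lv h = j}) \<le> real (3 ^ d * 2 ^ ((\<Sum>s<d. j s) - n))"
          by (rule of_nat_mono)
        also have "\<dots> = 3 ^ d * (2 ^ (\<Sum>s<d. j s) * (1 / 2 ^ n))"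
        proof -
          have "(2::real) ^ ((\<Sum>s<d. j s) - n) = 2 ^ (\<Sum>s<d. j s) * (1 / 2 ^ n)"
            using nj by (simp add: power_diff)
          then show ?thesis by simp
        qed
        \<comment> \<open>Rounding R down to n costs the factor 2.\<close>
        also have "\<dots> \<le> 3 ^ d * (2 ^ (\<Sum>s<d. j s) * (2 * 2 powr (- R)))"
        proof (intro mult_left_mono)
          have "1 / 2 ^ n = 2 powr (- real n)" by (simp add: powr_minus_divide powr_realpow)
          also have "\<dots> \<le> 2 powr (1 - R)" using n by (intro powr_mono) auto
          also have "\<dots> = 2 * 2 powr (- R)" by (simp add: powr_diff powr_minus_divide)
          finally show "1 / 2 ^ n \<le> 2 * 2 powr (- R)" .
        qed auto
        finally show "real (card {h\<in>F. lv h = j}) \<le> 3 ^ d * (2 ^ (\<Sum>s<d. j s) * (2 * 2 powr (- R)))" .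
      qed (use K in \<open>auto simp: t_def intro!: mult_nonneg_nonneg sum_nonneg\<close>)
      finally show "(\<Sum>h\<in>{h\<in>F. lv h = j}. 1 / w h)
          \<le> (3 ^ d * (2 ^ (\<Sum>s<d. j s) * (2 * 2 powr (- R)))) * (K * t j)" .
    qed
    also have "\<dots> = K * (2 * 3 ^ d) * 2 powr (- R) *
        (\<Sum>s<d. \<Sum>j\<in>J. 2 ^ (\<Sum>s<d. j s) * 4 powr (- \<alpha> * real (\<Sum>s<d. j s) - \<beta> * real (j s)))"
      unfolding t_def sum.swap[of _ J] sum_distrib_left by (simp only: mult_ac)
    also have "\<dots> \<le> K * (2 * 3 ^ d) * 2 powr (- R) * (real (card {..<d}) *
        (C * 2 powr (- (2 * (\<alpha> + \<beta>) - 1) * R) * (if \<beta> = 0 then R ^ (d - 1) else 1)))"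
      using K R J JR by (intro mult_left_mono sum_bounded_above C(2)[rule_format]) (auto simp del: of_nat_sum)
    also have "\<dots> = K * (2 * 3 ^ d) * real d * C * (2 powr (- R) * 2 powr (- (2 * (\<alpha> + \<beta>) - 1) * R))
        * (if \<beta> = 0 then R ^ (d - 1) else 1)"
      unfolding card_lessThan by (simp only: mult_ac)
    also have "2 powr (- R) * 2 powr (- (2 * (\<alpha> + \<beta>) - 1) * R) = 2 powr (- 2 * (\<alpha> + \<beta>) * R)"
      unfolding powr_add[symmetric] by (rule arg_cong[where f="\<lambda>x. 2 powr x"]) (simp add: algebra_simps)
    finally show ?thesis .
  qed
  show ?thesis
  proof (intro exI[of _ "K * (2 * 3 ^ d) * real d * C"] conjI allI impI, goal_cases)
    case 1
    then show ?case using K C d by simp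
  next
    case (2 R z M F a)
    then show ?case by (intro main[unfolded w_def]) auto
  qed
qed

lemma inj_on_restrict_int_vecs: "F \<subseteq> int_vecs d \<Longrightarrow> inj_on (\<lambda>k. restrict k {..<d}) F"
  by (rule inj_onI) (metis PiE_restrict int_vecs_def subsetD)

text \<open>Two frequencies of I are never aliased to each other. For k in I the lattice coefficient
  is therefore the true coefficient plus the contributions aliased from outside I, and the true one
  cancels in the error.\<close>

lemma trig_poly_error_eq:
  assumes rec: "reconstructing d I z M" and I: "finite I" and F: "finite F"
  shows "trig_poly d F c x - sampling_op d I z M (trig_poly d F c) x
    = (\<Sum>k\<in>F \<union> I. (if k \<in> I
        then - (\<Sum>h\<in>{h\<in>F - I. int M dvd freq_dot d h z - freq_dot d k z}. c h) else c k) * trig d k x)"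
proof -
  define A where "A k = (\<Sum>h\<in>{h\<in>F - I. int M dvd freq_dot d h z - freq_dot d k z}. c h)" for k
  have M: "0 < M" using rec by (simp add: reconstructing_def)
  have coeff: "lattice_coeff d z M (trig_poly d F c) k = (if k \<in> F then c k else 0) + A k" if k: "k \<in> I" for k
  proof -
    have "lattice_coeff d z M (trig_poly d F c) k
        = (\<Sum>h\<in>F \<inter> I. if int M dvd freq_dot d h z - freq_dot d k z then c h else 0)
        + (\<Sum>h\<in>F - I. if int M dvd freq_dot d h z - freq_dot d k z then c h else 0)"
      unfolding lattice_coeff_trig_poly[OF M] using F
      by (subst sum.union_disjoint[symmetric]) (auto intro!: sum.cong)
    also have "(\<Sum>h\<in>F \<inter> I. if int M dvd freq_dot d h z - freq_dot d k z then c h else 0)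
        = (\<Sum>h\<in>F \<inter> I. if h = k then c k else 0)"
      using reconstructing_inj[OF rec I _ k] by (intro sum.cong) auto
    also have "\<dots> = (if k \<in> F then c k else 0)" using F k by simp
    also have "(\<Sum>h\<in>F - I. if int M dvd freq_dot d h z - freq_dot d k z then c h else 0) = A k"
      unfolding A_def using F by (intro sum.inter_filter[symmetric]) auto
    finally show ?thesis .
  qed
  have "sampling_op d I z M (trig_poly d F c) x
      = (\<Sum>k\<in>I. (if k \<in> F then c k * trig d k x else 0)) + (\<Sum>k\<in>I. A k * trig d k x)"
    unfolding sampling_op_def by (simp add: coeff algebra_simps flip: sum.distrib) (auto intro!: sum.cong)
  also have "(\<Sum>k\<in>I. (if k \<in> F then c k * trig d k x else 0)) = (\<Sum>k\<in>F \<inter> I. c k * trig d k x)"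
    using I by (simp add: sum.If_cases Int_commute)
  finally have S: "sampling_op d I z M (trig_poly d F c) x
      = (\<Sum>k\<in>F \<inter> I. c k * trig d k x) + (\<Sum>k\<in>I. A k * trig d k x)" .
  have "trig_poly d F c x = (\<Sum>k\<in>F - I. c k * trig d k x) + (\<Sum>k\<in>F \<inter> I. c k * trig d k x)"
    unfolding trig_poly_def using F by (subst sum.union_disjoint[symmetric]) (auto intro!: sum.cong)
  then have "trig_poly d F c x - sampling_op d I z M (trig_poly d F c) x
      = (\<Sum>k\<in>F - I. c k * trig d k x) + (\<Sum>k\<in>I. - A k * trig d k x)"
    unfolding S by (simp add: sum_negf)
  also have "\<dots> = (\<Sum>k\<in>F - I. (if k \<in> I then - A k else c k) * trig d k x)
      + (\<Sum>k\<in>I. (if k \<in> I then - A k else c k) * trig d k x)"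
    by (intro arg_cong2[where f="(+)"] sum.cong) auto
  also have "\<dots> = (\<Sum>k\<in>F \<union> I. (if k \<in> I then - A k else c k) * trig d k x)"
    using F I by (subst sum.union_disjoint[symmetric]) (auto intro!: sum.cong)
  finally show ?thesis unfolding A_def .
qed

text \<open>The embedding reduces the claim to the square sum of the error coefficients with weights
  \<open>4 powr (\<tau> * level d k)\<close>. Outside the cross these are compared with the hybrid
  weights term by term; on the cross Cauchy-Schwarz and the alias sum apply, and the energies of the
  disjoint alias classes add up to at most 1.\<close>

lemma trig_poly_error_bound:
  fixes \<alpha> \<beta> q :: real
  assumes ab: "\<alpha> > 0" "\<beta> \<le> 0" "\<alpha> + \<beta> > 1/2" and d: "d \<ge> 1" and q: "2 < q"
  shows "\<exists>C>0. \<forall>R z M F c. R \<ge> 1 \<and> reconstructing d (hyp_cross d R) z M \<and> finite F \<and> F \<subseteq> int_vecs d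
      \<and> (\<Sum>k\<in>F. hybrid_weight d \<alpha> \<beta> k * (cmod (c k))\<^sup>2) \<le> 1 \<longrightarrow>
    (\<integral>x. cmod (trig_poly d F c x - sampling_op d (hyp_cross d R) z M (trig_poly d F c) x) powr q \<partial>torus d)
      \<le> C * (2 powr (- 2 * (\<alpha> + \<beta> - (1/2 - 1/q)) * R) * (if \<beta> = 0 then R ^ (d - 1) else 1)) powr (q/2)"
proof -
  define w where "w = hybrid_weight d \<alpha> \<beta>"
  have w: "w k > 0" for k by (simp add: w_def hybrid_weight_pos)
  define \<tau> where "\<tau> = 1/2 - 1/q"
  have \<tau>: "0 < \<tau>" "\<tau> < 1/2" using q by (auto simp: \<tau>_def field_simps)
  define K where "K = 4 powr (\<alpha> * d) * (2 * real d) powr (- \<beta>) * d"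
  have K: "K > 0" using d by (simp add: K_def)
  from sobolev_torus[OF q, of d, folded \<tau>_def level_def] obtain C1 where C1: "C1 > 0"
    "\<forall>F a. finite F \<and> inj_on (\<lambda>k. restrict k {..<d}) F \<longrightarrow>
      (\<integral>x. cmod (\<Sum>k\<in>F. a k * trig d k x) powr q \<partial>torus d)
      \<le> C1 * (\<Sum>k\<in>F. 4 powr (\<tau> * real (level d k)) * (cmod (a k))\<^sup>2) powr (q/2)"
    by (elim exE conjE) (rule that)
  from alias_sum_bound[OF ab d, folded w_def] obtain C2 where C2: "C2 > 0"
    "\<forall>R z M F a. R \<ge> 1 \<and> reconstructing d (hyp_cross d R) z M \<and> finite F
      \<and> F \<subseteq> int_vecs d - hyp_cross d R \<and> (\<forall>h\<in>F. int M dvd freq_dot d h z - a) \<longrightarrow>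
    (\<Sum>h\<in>F. 1 / w h) \<le> C2 * 2 powr (- 2 * (\<alpha> + \<beta>) * R) * (if \<beta> = 0 then R ^ (d - 1) else 1)"
    by (elim exE conjE) (rule that)
  \<comment> \<open>K comes from the frequencies outside the cross, the other summand from the
    aliasing error on it; the factor \<open>4 powr (\<tau> * d)\<close> pays for levels on the cross
    beyond R.\<close>
  define C3 where "C3 = K + 4 powr (\<tau> * d) * C2"
  have C3: "C3 > 0" using K C2 by (simp add: C3_def add_pos_pos)
  have main: "(\<integral>x. cmod (trig_poly d F c x - sampling_op d (hyp_cross d R) z M (trig_poly d F c) x) powr q \<partial>torus d)
      \<le> C1 * C3 powr (q/2) * (2 powr (- 2 * (\<alpha> + \<beta> - \<tau>) * R) * (if \<beta> = 0 then R ^ (d - 1) else 1)) powr (q/2)"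
    if R: "R \<ge> 1" and rec: "reconstructing d (hyp_cross d R) z M" and F: "finite F" "F \<subseteq> int_vecs d"
      and c: "(\<Sum>k\<in>F. w k * (cmod (c k))\<^sup>2) \<le> 1" for R z M F c
  proof -
    define I where "I = hyp_cross d R"
    have I: "finite I" "I \<subseteq> int_vecs d" by (auto simp: I_def finite_hyp_cross hyp_cross_subset)
    define lo where "lo = (if \<beta> = 0 then R ^ (d - 1) else 1)"
    have lo: "lo \<ge> 1" using R by (auto simp: lo_def)
    define N where "N k = {h\<in>F - I. int M dvd freq_dot d h z - freq_dot d k z}" for k
    define a where "a k = (if k \<in> I then - (\<Sum>h\<in>N k. c h) else c k)" for k
    have N: "finite (N k)" "N k \<subseteq> F - I" for k using F by (auto simp: N_def)
    have wc0: "w h * (cmod (c h))\<^sup>2 \<ge> 0" for h using w[of h] by simp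
    have out: "4 powr (\<tau> * level d k) * (cmod (a k))\<^sup>2
        \<le> K * 2 powr (- 2 * (\<alpha> + \<beta> - \<tau>) * R) * (w k * (cmod (c k))\<^sup>2)" if k: "k \<in> F - I" for k
    proof -
      have L: "real (level d k) \<ge> R"
        using k F(2) d by (auto simp: I_def mem_hyp_cross_iff)
      have "1 / w k \<le> K * 4 powr (- (\<alpha> + \<beta>) * level d k)"
        unfolding w_def K_def by (rule inverse_hybrid_weight_le_level[OF ab(1,2) d])
      then have "4 powr (\<tau> * level d k) * (1 / w k) \<le> 4 powr (\<tau> * level d k) * (K * 4 powr (- (\<alpha> + \<beta>) * level d k))"
        by (intro mult_left_mono) auto
      also have "\<dots> = K * 4 powr (- (\<alpha> + \<beta> - \<tau>) * level d k)"
      proof -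
        have "4 powr (\<tau> * level d k) * 4 powr (- (\<alpha> + \<beta>) * level d k) = 4 powr (- (\<alpha> + \<beta> - \<tau>) * level d k)"
          unfolding powr_add[symmetric] by (rule arg_cong[where f="\<lambda>x. 4 powr x"]) (simp add: algebra_simps)
        then show ?thesis by (simp add: mult_ac)
      qed
      \<comment> \<open>The exponent decreases in the level since \<tau> < 1/2 < \<alpha> +
        \<beta>.\<close>
      also have "\<dots> \<le> K * 4 powr (- (\<alpha> + \<beta> - \<tau>) * R)"
        using K L ab \<tau> by (intro mult_left_mono powr_mono mult_left_mono_neg) auto
      also have "\<dots> = K * 2 powr (- 2 * (\<alpha> + \<beta> - \<tau>) * R)" by (simp add: four_powr mult_ac)
      finally have "4 powr (\<tau> * level d k) \<le> K * 2 powr (- 2 * (\<alpha> + \<beta> - \<tau>) * R) * w k"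
        using w[of k] by (simp add: field_simps)
      then have "4 powr (\<tau> * level d k) * (cmod (c k))\<^sup>2 \<le> K * 2 powr (- 2 * (\<alpha> + \<beta> - \<tau>) * R) * w k * (cmod (c k))\<^sup>2"
        by (intro mult_right_mono) auto
      then show ?thesis using k by (simp add: a_def mult.assoc)
    qed
    have "(\<Sum>k\<in>F - I. 4 powr (\<tau> * level d k) * (cmod (a k))\<^sup>2)
        \<le> (\<Sum>k\<in>F - I. K * 2 powr (- 2 * (\<alpha> + \<beta> - \<tau>) * R) * (w k * (cmod (c k))\<^sup>2))"
      by (intro sum_mono out)
    also have "\<dots> \<le> K * 2 powr (- 2 * (\<alpha> + \<beta> - \<tau>) * R) * 1"
      unfolding sum_distrib_left[symmetric]
    proof (rule mult_left_mono)
      have "(\<Sum>k\<in>F - I. w k * (cmod (c k))\<^sup>2) \<le> (\<Sum>k\<in>F. w k * (cmod (c k))\<^sup>2)"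
        using F wc0 by (intro sum_mono2) auto
      with c show "(\<Sum>k\<in>F - I. w k * (cmod (c k))\<^sup>2) \<le> 1" by linarith
    qed (use K in simp)
    \<comment> \<open>As R \<ge> 1, the factor \<open>lo\<close> is at least 1; inserting it gives
      both parts of the error the same form.\<close>
    also have "\<dots> \<le> K * 2 powr (- 2 * (\<alpha> + \<beta> - \<tau>) * R) * lo"
      using K lo by (intro mult_left_mono) auto
    finally have S1: "(\<Sum>k\<in>F - I. 4 powr (\<tau> * level d k) * (cmod (a k))\<^sup>2)
        \<le> K * 2 powr (- 2 * (\<alpha> + \<beta> - \<tau>) * R) * lo" .
    define B where "B = C2 * 2 powr (- 2 * (\<alpha> + \<beta>) * R) * lo"
    have B: "B \<ge> 0" using C2 lo by (simp add: B_def)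
    \<comment> \<open>Cauchy-Schwarz with the square roots of the hybrid weights: one factor is the
      alias sum of reciprocal weights, the other the part of the hybrid norm carried by the class
      \<open>N k\<close>.\<close>
    have a_le: "(cmod (a k))\<^sup>2 \<le> B * (\<Sum>h\<in>N k. w h * (cmod (c h))\<^sup>2)" if k: "k \<in> I" for k
    proof -
      have "cmod (a k) \<le> (\<Sum>h\<in>N k. cmod (c h))" using k by (simp add: a_def norm_sum)
      also have "\<dots> = (\<Sum>h\<in>N k. (1 / sqrt (w h)) * (sqrt (w h) * cmod (c h)))"
        using w by (intro sum.cong) (auto simp: less_imp_neq[symmetric])
      finally have "(cmod (a k))\<^sup>2 \<le> (\<Sum>h\<in>N k. (1 / sqrt (w h)) * (sqrt (w h) * cmod (c h)))\<^sup>2"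
        by (rule power_mono) simp
      also have "\<dots> \<le> (\<Sum>h\<in>N k. (1 / sqrt (w h))\<^sup>2) * (\<Sum>h\<in>N k. (sqrt (w h) * cmod (c h))\<^sup>2)"
        by (rule Cauchy_Schwarz_ineq_sum)
      also have "\<dots> = (\<Sum>h\<in>N k. 1 / w h) * (\<Sum>h\<in>N k. w h * (cmod (c h))\<^sup>2)"
        using w by (simp add: power_mult_distrib power_divide less_imp_le)
      also have "\<dots> \<le> B * (\<Sum>h\<in>N k. w h * (cmod (c h))\<^sup>2)"
      proof (rule mult_right_mono)
        show "(\<Sum>h\<in>N k. 1 / w h) \<le> B"
          unfolding B_def lo_def using N(1)[of k] F R rec
          by (intro C2(2)[rule_format, of R z M "N k" "freq_dot d k z"]) (auto simp: N_def I_def)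
      qed (auto intro!: sum_nonneg wc0)
      finally show ?thesis .
    qed
    have "(\<Sum>k\<in>I. 4 powr (\<tau> * level d k) * (cmod (a k))\<^sup>2)
        \<le> (\<Sum>k\<in>I. 4 powr (\<tau> * (R + d)) * (B * (\<Sum>h\<in>N k. w h * (cmod (c h))\<^sup>2)))"
    proof (rule sum_mono)
      fix k assume k: "k \<in> I"
      then have "real (level d k) \<le> R + d" by (simp add: I_def mem_hyp_cross_iff)
      then have "4 powr (\<tau> * level d k) \<le> 4 powr (\<tau> * (R + d))" using \<tau> by (intro powr_mono) auto
      then show "4 powr (\<tau> * level d k) * (cmod (a k))\<^sup>2
          \<le> 4 powr (\<tau> * (R + d)) * (B * (\<Sum>h\<in>N k. w h * (cmod (c h))\<^sup>2))"
        by (intro mult_mono a_le k) auto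
    qed
    also have "\<dots> = 4 powr (\<tau> * (R + d)) * B * (\<Sum>k\<in>I. \<Sum>h\<in>N k. w h * (cmod (c h))\<^sup>2)"
      unfolding sum_distrib_left by (simp only: mult_ac)
    also have "\<dots> \<le> 4 powr (\<tau> * (R + d)) * B * 1"
    proof (rule mult_left_mono)
      have "(\<Sum>k\<in>I. \<Sum>h\<in>N k. w h * (cmod (c h))\<^sup>2)
          = (\<Sum>k\<in>I. \<Sum>h\<in>F - I. if int M dvd freq_dot d h z - freq_dot d k z then w h * (cmod (c h))\<^sup>2 else 0)"
        unfolding N_def using F by (intro sum.cong refl sum.inter_filter) auto
      also have "\<dots> = (\<Sum>h\<in>F - I. \<Sum>k\<in>I. if int M dvd freq_dot d h z - freq_dot d k z then w h * (cmod (c h))\<^sup>2 else 0)"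
        by (rule sum.swap)
      \<comment> \<open>Two alias partners of h in the cross would be congruent to each other and
        hence equal, so every h is counted at most once.\<close>
      also have "\<dots> \<le> (\<Sum>h\<in>F - I. w h * (cmod (c h))\<^sup>2)"
      proof (rule sum_mono)
        fix h
        have "card {k\<in>I. int M dvd freq_dot d h z - freq_dot d k z} \<le> Suc 0"
        proof (subst card_le_Suc0_iff_eq)
          show "\<forall>x\<in>{k\<in>I. int M dvd freq_dot d h z - freq_dot d k z}.
              \<forall>y\<in>{k\<in>I. int M dvd freq_dot d h z - freq_dot d k z}. x = y"
          proof safe
            fix x y assume xy: "x \<in> I" "y \<in> I" and
              dv: "int M dvd freq_dot d h z - freq_dot d x z" "int M dvd freq_dot d h z - freq_dot d y z"
            have "int M dvd freq_dot d x z - freq_dot d y z" using dvd_diff[OF dv(2,1)] by simp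
            then show "x = y" using reconstructing_inj[OF rec finite_hyp_cross] xy by (auto simp: I_def)
          qed
        qed (use I in simp)
        then have "real (card {k\<in>I. int M dvd freq_dot d h z - freq_dot d k z}) * (w h * (cmod (c h))\<^sup>2)
            \<le> 1 * (w h * (cmod (c h))\<^sup>2)"
          by (intro mult_right_mono wc0) auto
        then show "(\<Sum>k\<in>I. if int M dvd freq_dot d h z - freq_dot d k z then w h * (cmod (c h))\<^sup>2 else 0)
            \<le> w h * (cmod (c h))\<^sup>2"
          using I by (simp add: sum.inter_filter[symmetric])
      qed
      also have "\<dots> \<le> (\<Sum>k\<in>F. w k * (cmod (c k))\<^sup>2)"
        using F wc0 by (intro sum_mono2) auto
      also note c
      finally show "(\<Sum>k\<in>I. \<Sum>h\<in>N k. w h * (cmod (c h))\<^sup>2) \<le> 1" .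
    qed (use B in simp)
    also have "\<dots> = 4 powr (\<tau> * d) * C2 * (4 powr (\<tau> * R) * 2 powr (- 2 * (\<alpha> + \<beta>) * R)) * lo"
      by (simp add: B_def distrib_left powr_add mult_ac)
    also have "4 powr (\<tau> * R) * 2 powr (- 2 * (\<alpha> + \<beta>) * R) = 2 powr (- 2 * (\<alpha> + \<beta> - \<tau>) * R)"
      unfolding four_powr powr_add[symmetric] by (rule arg_cong[where f="\<lambda>x. 2 powr x"]) (simp add: algebra_simps)
    finally have S2: "(\<Sum>k\<in>I. 4 powr (\<tau> * level d k) * (cmod (a k))\<^sup>2)
        \<le> 4 powr (\<tau> * d) * C2 * 2 powr (- 2 * (\<alpha> + \<beta> - \<tau>) * R) * lo" .
    have "(\<Sum>k\<in>F \<union> I. 4 powr (\<tau> * level d k) * (cmod (a k))\<^sup>2)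
        = (\<Sum>k\<in>F - I. 4 powr (\<tau> * level d k) * (cmod (a k))\<^sup>2) + (\<Sum>k\<in>I. 4 powr (\<tau> * level d k) * (cmod (a k))\<^sup>2)"
      using F I by (subst sum.union_disjoint[symmetric]) (auto intro!: sum.cong)
    also have "\<dots> \<le> C3 * (2 powr (- 2 * (\<alpha> + \<beta> - \<tau>) * R) * lo)"
      using S1 S2 by (simp add: C3_def algebra_simps)
    finally have S: "(\<Sum>k\<in>F \<union> I. 4 powr (\<tau> * level d k) * (cmod (a k))\<^sup>2)
        \<le> C3 * (2 powr (- 2 * (\<alpha> + \<beta> - \<tau>) * R) * lo)" .
    have "(\<integral>x. cmod (trig_poly d F c x - sampling_op d (hyp_cross d R) z M (trig_poly d F c) x) powr q \<partial>torus d)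
        = (\<integral>x. cmod (\<Sum>k\<in>F \<union> I. a k * trig d k x) powr q \<partial>torus d)"
      unfolding trig_poly_error_eq[OF rec finite_hyp_cross F(1)] a_def N_def I_def by (rule refl)
    also have "\<dots> \<le> C1 * (\<Sum>k\<in>F \<union> I. 4 powr (\<tau> * level d k) * (cmod (a k))\<^sup>2) powr (q/2)"
      using F I by (intro C1(2)[rule_format] conjI inj_on_restrict_int_vecs) auto
    also have "\<dots> \<le> C1 * (C3 * (2 powr (- 2 * (\<alpha> + \<beta> - \<tau>) * R) * lo)) powr (q/2)"
      using C1 q S by (intro mult_left_mono powr_mono2 sum_nonneg) auto
    also have "\<dots> = C1 * C3 powr (q/2) * (2 powr (- 2 * (\<alpha> + \<beta> - \<tau>) * R) * lo) powr (q/2)"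
      unfolding powr_mult[of C3] by (simp only: mult_ac)
    finally show ?thesis unfolding lo_def .
  qed
  show ?thesis
  proof (intro exI[of _ "C1 * C3 powr (q/2)"] conjI allI impI, goal_cases)
    case 1
    then show ?case using C1 C3 by simp
  next
    case (2 R z M F c)
    then show ?case by (intro main[unfolded w_def \<tau>_def]) auto
  qed
qed

subsection \<open>Completeness of the trigonometric system\<close>

lemma integrable_mult_bounded:
  fixes f g :: "'a \<Rightarrow> complex"
  assumes "integrable M f" "g \<in> borel_measurable M" "\<And>x. cmod (g x) \<le> B"
  shows "integrable M (\<lambda>x. f x * g x)"
proof (rule Bochner_Integration.integrable_bound)
  show "integrable M (\<lambda>x. B * cmod (f x))" using assms by simp
  show "AE x in M. norm (f x * g x) \<le> norm (B * cmod (f x))"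
  proof (rule AE_I2)
    fix x
    have "cmod (f x) * cmod (g x) \<le> cmod (f x) * B" using assms(3) by (intro mult_left_mono) auto
    also have "\<dots> \<le> \<bar>B * cmod (f x)\<bar>" by (simp add: mult.commute)
    finally show "norm (f x * g x) \<le> norm (B * cmod (f x))" by (simp add: norm_mult)
  qed
qed (use assms in measurable)

lemma measurable_circle_cis[measurable]:
  "(\<lambda>y. cis (2 * pi * y)) \<in> borel_measurable circle"
  "(\<lambda>y. cis (2 * pi * (c * y))) \<in> borel_measurable circle"
  by measurable

lemma continuous_on_cis_2pi_compose:
  fixes \<phi> :: "complex \<Rightarrow> real"
  assumes "continuous_on UNIV \<phi>"
  shows "continuous_on UNIV (\<lambda>y. complex_of_real (\<phi> (cis (2 * pi * y))))"
proof -
  have "continuous_on UNIV (\<lambda>y::real. cis (2 * pi * y))" by (intro continuous_intros)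
  from continuous_on_compose2[OF assms this] show ?thesis by (intro continuous_on_of_real) simp
qed

lemma real_polynomial_function_cis_bounded:
  assumes "real_polynomial_function p"
  obtains B where "\<And>y. \<bar>p (cis y)\<bar> \<le> B"
proof -
  have "compact (p ` sphere 0 1)"
    using assms by (intro compact_continuous_image continuous_on_subset[OF continuous_on_polymonial_function])
      (auto simp: real_polynomial_function_eq)
  then obtain B where "\<And>x. x \<in> p ` sphere 0 1 \<Longrightarrow> norm x \<le> B"
    using compact_imp_bounded bounded_iff by metis
  then show ?thesis by (intro that[of B]) auto
qed

lemma borel_measurable_real_polynomial_function_cis:
  assumes "real_polynomial_function p"
  shows "(\<lambda>y. complex_of_real (p (cis (2 * pi * y)))) \<in> borel_measurable circle"
proof -
  have "continuous_on UNIV p"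
    using assms by (intro continuous_on_polymonial_function) (simp add: real_polynomial_function_eq)
  then have "continuous_on UNIV (\<lambda>y. complex_of_real (p (cis (2 * pi * y))))"
    by (rule continuous_on_cis_2pi_compose)
  then show ?thesis by (intro measurable_circle borel_measurable_continuous_onI)
qed

text \<open>Multiplication by a polynomial in \<open>cis\<close> preserves the class of integrable
  functions with vanishing coefficients. A linear form on the unit circle combines
  \<open>cis t\<close> and \<open>cis (- t)\<close>, so it merely shifts m by 1 in both directions.
  The statement is kept general in g and m so that the product case can feed g times the first
  factor into the hypothesis for the second.\<close>

lemma zero_coeffs_polynomial:
  assumes "real_polynomial_function p" "integrable circle g"
    and "\<And>m::int. (\<integral>y. g y * cis (2 * pi * (real_of_int m * y)) \<partial>circle) = 0"
  shows "(\<integral>y. g y * complex_of_real (p (cis (2 * pi * y))) * cis (2 * pi * (real_of_int m * y)) \<partial>circle) = 0"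
  using assms
proof (induction p arbitrary: g m rule: real_polynomial_function.induct)
  case (linear h)
  \<comment> \<open>Euler's formulas: h(\<open>cis t\<close>) is h(1) cos t + h(\<i>) sin t,
    rewritten in exponentials.\<close>
  define A where "A = complex_of_real (h 1) / 2 + complex_of_real (h \<i>) / (2 * \<i>)"
  define B where "B = complex_of_real (h 1) / 2 - complex_of_real (h \<i>) / (2 * \<i>)"
  have h: "complex_of_real (h (cis t)) = A * cis t + B * cis (- t)" for t
  proof -
    have lin: "linear h" using linear(1) by (rule bounded_linear.linear)
    have "cis t = cos t *\<^sub>R 1 + sin t *\<^sub>R \<i>" by (simp add: complex_eq_iff)
    then have "h (cis t) = h (cos t *\<^sub>R 1 + sin t *\<^sub>R \<i>)" by (rule arg_cong)
    also have "\<dots> = cos t * h 1 + sin t * h \<i>"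
      by (simp only: linear_add[OF lin] linear_scale[OF lin] real_scaleR_def)
    finally have "h (cis t) = cos t * h 1 + sin t * h \<i>" .
    then show ?thesis by (simp add: A_def B_def complex_eq_iff field_simps)
  qed
  have "g y * complex_of_real (h (cis (2 * pi * y))) * cis (2 * pi * (real_of_int m * y))
      = A * (g y * cis (2 * pi * (real_of_int (m + 1) * y))) + B * (g y * cis (2 * pi * (real_of_int (m - 1) * y)))" for y
  proof -
    have "cis (2 * pi * y) * cis (2 * pi * (real_of_int m * y)) = cis (2 * pi * (real_of_int (m + 1) * y))"
      "cis (- (2 * pi * y)) * cis (2 * pi * (real_of_int m * y)) = cis (2 * pi * (real_of_int (m - 1) * y))"
      unfolding cis_mult by (rule arg_cong[where f=cis], simp add: algebra_simps)+
    then show ?thesis unfolding h by (simp only: distrib_left distrib_right mult_ac)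
  qed
  moreover have "integrable circle (\<lambda>y. g y * cis (2 * pi * (real_of_int m * y)))" for m
    by (rule integrable_mult_bounded[OF linear(2), where B=1]) auto
  ultimately show ?case by (simp add: linear(3) del: of_int_add of_int_diff)
next
  case (const c)
  have "(\<lambda>y. g y * complex_of_real c * cis (2 * pi * (real_of_int m * y)))
      = (\<lambda>y. complex_of_real c * (g y * cis (2 * pi * (real_of_int m * y))))" by (simp add: mult_ac)
  then show ?case using const by simp
next
  case (add f1 f2)
  have "integrable circle (\<lambda>y. g y * complex_of_real (p (cis (2 * pi * y))) * cis (2 * pi * (real_of_int m * y)))"
    if p: "real_polynomial_function p" for p
  proof -
    obtain B where "\<And>y. \<bar>p (cis y)\<bar> \<le> B" using real_polynomial_function_cis_bounded[OF p] by blast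
    then show ?thesis
      by (intro integrable_mult_bounded[where B=1] integrable_mult_bounded[where B=B] add.prems
          borel_measurable_real_polynomial_function_cis p) auto
  qed
  then show ?case
    using add by (simp add: distrib_left distrib_right)
next
  case (mult f1 f2)
  obtain B where "\<And>y. \<bar>f1 (cis y)\<bar> \<le> B" using real_polynomial_function_cis_bounded[OF mult(1)] by blast
  then have "integrable circle (\<lambda>y. g y * complex_of_real (f1 (cis (2 * pi * y))))"
    by (intro integrable_mult_bounded[where B=B] mult.prems borel_measurable_real_polynomial_function_cis mult) auto
  from mult.IH(2)[OF this mult.IH(1)[OF mult.prems]] show ?case
    by (simp add: mult_ac)
qed

text \<open>By Stone-Weierstrass \<phi> is uniformly close to a polynomial on the unit circle, and
  the error is at most e times the norm of f in \<open>L_1\<close>. Testing with \<phi> composed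
  with \<open>cis\<close> makes periodicity automatic.\<close>

lemma zero_coeffs_continuous:
  fixes \<phi> :: "complex \<Rightarrow> real"
  assumes f: "integrable circle f"
    and zero: "\<And>m::int. (\<integral>y. f y * cis (2 * pi * (real_of_int m * y)) \<partial>circle) = 0"
    and \<phi>: "continuous_on UNIV \<phi>"
  shows "(\<integral>y. f y * complex_of_real (\<phi> (cis (2 * pi * y))) \<partial>circle) = 0"
proof -
  define N where "N = (\<integral>y. cmod (f y) \<partial>circle)"
  have N: "N \<ge> 0" by (simp add: N_def)
  have "compact (\<phi> ` sphere 0 1)"
    by (intro compact_continuous_image continuous_on_subset[OF \<phi>]) auto
  then obtain B where "\<And>x. x \<in> \<phi> ` sphere 0 1 \<Longrightarrow> norm x \<le> B"
    using compact_imp_bounded bounded_iff by metis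
  then have B: "\<bar>\<phi> (cis y)\<bar> \<le> B" for y by auto
  have "continuous_on UNIV (\<lambda>y. complex_of_real (\<phi> (cis (2 * pi * y))))"
    by (rule continuous_on_cis_2pi_compose[OF \<phi>])
  then have int\<phi>: "integrable circle (\<lambda>y. f y * complex_of_real (\<phi> (cis (2 * pi * y))))"
    by (intro integrable_mult_bounded[where B=B] f measurable_circle borel_measurable_continuous_onI) (auto simp: B)
  have le: "cmod (\<integral>y. f y * complex_of_real (\<phi> (cis (2 * pi * y))) \<partial>circle) \<le> e * N" if e: "e > 0" for e
  proof -
    obtain p where p: "real_polynomial_function p" "\<And>x. x \<in> sphere 0 1 \<Longrightarrow> \<bar>\<phi> x - p x\<bar> < e"
      using Stone_Weierstrass_real_polynomial_function[of "sphere 0 1" \<phi> e] e continuous_on_subset[OF \<phi>] by auto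
    obtain Bp where "\<And>y. \<bar>p (cis y)\<bar> \<le> Bp" using real_polynomial_function_cis_bounded[OF p(1)] by blast
    then have intp: "integrable circle (\<lambda>y. f y * complex_of_real (p (cis (2 * pi * y))))"
      by (intro integrable_mult_bounded[where B=Bp] f borel_measurable_real_polynomial_function_cis p) auto
    have "(\<integral>y. f y * complex_of_real (p (cis (2 * pi * y))) \<partial>circle) = 0"
      using zero_coeffs_polynomial[OF p(1) f zero, of 0] by simp
    then have "(\<integral>y. f y * complex_of_real (\<phi> (cis (2 * pi * y))) \<partial>circle)
        = (\<integral>y. f y * complex_of_real (\<phi> (cis (2 * pi * y))) - f y * complex_of_real (p (cis (2 * pi * y))) \<partial>circle)"
      using int\<phi> intp by simp
    also have "cmod \<dots> \<le> (\<integral>y. cmod (f y * complex_of_real (\<phi> (cis (2 * pi * y))) - f y * complex_of_real (p (cis (2 * pi * y)))) \<partial>circle)"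
      by (rule integral_norm_bound)
    also have "\<dots> \<le> (\<integral>y. e * cmod (f y) \<partial>circle)"
    proof (rule integral_mono)
      fix y
      have "cmod (f y * complex_of_real (\<phi> (cis (2 * pi * y))) - f y * complex_of_real (p (cis (2 * pi * y))))
          = cmod (f y) * \<bar>\<phi> (cis (2 * pi * y)) - p (cis (2 * pi * y))\<bar>"
        by (simp add: norm_mult flip: right_diff_distrib of_real_diff)
      also have "\<dots> \<le> cmod (f y) * e"
        using p(2)[of "cis (2 * pi * y)"] by (intro mult_left_mono) auto
      finally show "cmod (f y * complex_of_real (\<phi> (cis (2 * pi * y))) - f y * complex_of_real (p (cis (2 * pi * y)))) \<le> e * cmod (f y)"
        by (simp add: mult.commute)
    qed (use f int\<phi> intp in auto)
    also have "\<dots> = e * N" by (simp add: N_def)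
    finally show ?thesis .
  qed
  have "cmod (\<integral>y. f y * complex_of_real (\<phi> (cis (2 * pi * y))) \<partial>circle) \<le> 0"
  proof (rule field_le_epsilon)
    fix e :: real assume "e > 0"
    \<comment> \<open>The summand 1 guards against N = 0.\<close>
    then have "e / (N + 1) > 0" using N by simp
    from le[OF this] have "cmod (\<integral>y. f y * complex_of_real (\<phi> (cis (2 * pi * y))) \<partial>circle) \<le> e * (N / (N + 1))" by simp
    also have "\<dots> \<le> e * 1" using N \<open>e > 0\<close> by (intro mult_left_mono) auto
    finally show "cmod (\<integral>y. f y * complex_of_real (\<phi> (cis (2 * pi * y))) \<partial>circle) \<le> 0 + e" by simp
  qed
  then show ?thesis by simp
qed

text \<open>The continuous functions \<open>\<phi> n\<close> decrease to the indicator of C, and f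
  dominates. A nonempty C is required so that points outside it have positive
  \<open>infdist\<close>.\<close>

lemma zero_coeffs_closed:
  assumes f: "integrable circle f"
    and zero: "\<And>m::int. (\<integral>y. f y * cis (2 * pi * (real_of_int m * y)) \<partial>circle) = 0"
    and C: "closed C" "C \<noteq> {}"
  shows "(\<integral>y. f y * indicator C (cis (2 * pi * y)) \<partial>circle) = 0"
proof -
  define \<phi> where "\<phi> n w = max 0 (1 - real n * infdist w C)" for n w
  have cont: "continuous_on UNIV (\<phi> n)" for n
    unfolding \<phi>_def by (intro continuous_intros)
  have lim: "(\<lambda>n. complex_of_real (\<phi> n w)) \<longlonglongrightarrow> indicator C w" for w
  proof (cases "w \<in> C")
    case True
    then have "\<phi> n w = 1" for n by (simp add: \<phi>_def)
    then show ?thesis using True by simp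
  next
    case False
    then have pos: "infdist w C > 0"
      using C in_closed_iff_infdist_zero[of C w] infdist_nonneg[of w C] by force
    obtain n0 where n0: "real n0 * infdist w C > 1" using reals_Archimedean3[OF pos] by blast
    have "\<forall>\<^sub>F n in sequentially. complex_of_real (\<phi> n w) = indicator C w"
      using eventually_ge_at_top[of n0]
    proof eventually_elim
      case (elim n)
      have "real n0 * infdist w C \<le> real n * infdist w C" using elim pos by (intro mult_right_mono) auto
      then show ?case using n0 False by (simp add: \<phi>_def)
    qed
    then show ?thesis by (rule tendsto_eventually)
  qed
  have mf: "f \<in> borel_measurable circle" using f by auto
  have "(\<lambda>n. \<integral>y. f y * complex_of_real (\<phi> n (cis (2 * pi * y))) \<partial>circle)
      \<longlonglongrightarrow> (\<integral>y. f y * indicator C (cis (2 * pi * y)) \<partial>circle)"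
  proof (rule integral_dominated_convergence[where w="\<lambda>y. cmod (f y)"])
    have "C \<in> sets borel" using C by simp
    then show "(\<lambda>y. f y * indicator C (cis (2 * pi * y))) \<in> borel_measurable circle" using mf by measurable
    show "(\<lambda>y. f y * complex_of_real (\<phi> n (cis (2 * pi * y)))) \<in> borel_measurable circle" for n
    proof -
      have "continuous_on UNIV (\<lambda>y. complex_of_real (\<phi> n (cis (2 * pi * y))))"
        by (rule continuous_on_cis_2pi_compose[OF cont])
      then show ?thesis
        by (intro borel_measurable_times mf measurable_circle[OF borel_measurable_continuous_onI])
    qed
    show "AE y in circle. (\<lambda>n. f y * complex_of_real (\<phi> n (cis (2 * pi * y)))) \<longlonglongrightarrow> f y * indicator C (cis (2 * pi * y))"
      by (intro AE_I2 tendsto_mult tendsto_const lim)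
    show "AE y in circle. norm (f y * complex_of_real (\<phi> n (cis (2 * pi * y)))) \<le> cmod (f y)" for n
    proof (rule AE_I2)
      fix y
      have "0 \<le> real n * infdist (cis (2 * pi * y)) C" by (intro mult_nonneg_nonneg infdist_nonneg) simp
      then have "\<bar>\<phi> n (cis (2 * pi * y))\<bar> \<le> 1" by (simp add: \<phi>_def)
      then have "cmod (f y) * \<bar>\<phi> n (cis (2 * pi * y))\<bar> \<le> cmod (f y) * 1" by (intro mult_left_mono) auto
      then show "norm (f y * complex_of_real (\<phi> n (cis (2 * pi * y)))) \<le> cmod (f y)" by (simp add: norm_mult)
    qed
  qed (use f in auto)
  moreover have "(\<integral>y. f y * complex_of_real (\<phi> n (cis (2 * pi * y))) \<partial>circle) = 0" for n
    by (rule zero_coeffs_continuous[OF f zero cont])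
  ultimately show ?thesis by (simp add: LIMSEQ_const_iff)
qed

lemma cis_2pi_inj:
  assumes "cis (2 * pi * s) = cis (2 * pi * t)" "0 \<le> s" "s < 1" "0 \<le> t" "t < 1"
  shows "s = t"
proof -
  have "sin (2 * pi * s) = sin (2 * pi * t) \<and> cos (2 * pi * s) = cos (2 * pi * t)"
    using assms(1) by (simp add: complex_eq_iff)
  then obtain n :: int where "2 * pi * s = 2 * pi * t + 2 * pi * n"
    using sin_cos_eq_iff by blast
  then have "2 * pi * s = 2 * pi * (t + n)" by (simp add: distrib_left)
  then have n: "s = t + n" by simp
  then have "\<bar>real_of_int n\<bar> < 1" using assms by auto
  then have "n = 0" by linarith
  with n show ?thesis by simp
qed

text \<open>The half-lines up to a are stable under intersection and generate the Borel sets. For 0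
  \<le> a < 1 such a half-line meets the fundamental interval in [0, a], which \<open>cis\<close>
  maps bijectively onto a closed arc, so the previous case applies; the other values of a give the
  empty set or the whole circle.\<close>

lemma zero_coeffs_borel:
  assumes f: "integrable circle f"
    and zero: "\<And>m::int. (\<integral>y. f y * cis (2 * pi * (real_of_int m * y)) \<partial>circle) = 0"
    and A: "A \<in> sets borel"
  shows "(\<integral>y. f y * indicator A y \<partial>circle) = 0"
proof -
  have mf[measurable]: "f \<in> borel_measurable circle" using f by auto
  have int: "integrable circle (\<lambda>y. f y * indicator A y)" if "A \<in> sets borel" for A
    using that by (intro integrable_mult_bounded[where B=1] f measurable_circle borel_measurable_indicator)
      (auto simp: indicator_def)
  have all: "(\<integral>y. f y \<partial>circle) = 0" using zero[of 0] by simp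
  have sigma: "sets borel = sigma_sets UNIV (range (\<lambda>a::real. {..a}))"
    by (subst borel_eq_atMost) simp
  have "Int_stable (range (\<lambda>a::real. {..a}))"
    by (auto simp: Int_stable_def)
  moreover have "range (\<lambda>a::real. {..a}) \<subseteq> Pow UNIV" by simp
  moreover have "A \<in> sigma_sets UNIV (range (\<lambda>a::real. {..a}))" using A sigma by simp
  ultimately show ?thesis
  proof (induction rule: sigma_sets_induct_disjoint)
    case (basic A)
    then obtain a where a: "A = {..a}" by auto
    consider "a < 0" | "0 \<le> a" "a < 1" | "a \<ge> 1" by linarith
    then show ?case
    proof cases
      case 1
      then have "(\<integral>y. f y * indicator A y \<partial>circle) = (\<integral>y. 0 \<partial>circle)"
        unfolding a by (intro Bochner_Integration.integral_cong) (auto simp: indicator_def)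
      then show ?thesis by simp
    next
      case 2
      define C where "C = (\<lambda>t. cis (2 * pi * t)) ` {0..a}"
      have "compact C" unfolding C_def
        by (intro compact_continuous_image continuous_intros) auto
      then have C: "closed C" "C \<noteq> {}" using 2 by (auto simp: C_def compact_imp_closed)
      have "(\<integral>y. f y * indicator A y \<partial>circle) = (\<integral>y. f y * indicator C (cis (2 * pi * y)) \<partial>circle)"
      proof (intro Bochner_Integration.integral_cong refl)
        fix y assume "y \<in> space circle"
        then have y: "0 \<le> y" "y < 1" by auto
        have "cis (2 * pi * y) \<in> C \<longleftrightarrow> y \<in> A"
        proof
          assume "cis (2 * pi * y) \<in> C"
          then obtain t where t: "0 \<le> t" "t \<le> a" "cis (2 * pi * y) = cis (2 * pi * t)" by (auto simp: C_def)
          then have "y = t" using cis_2pi_inj[of y t] 2 y by simp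
          then show "y \<in> A" using t by (simp add: a)
        qed (use y in \<open>auto simp: a C_def\<close>)
        then show "f y * indicator A y = f y * indicator C (cis (2 * pi * y))" by (simp add: indicator_def)
      qed
      also have "\<dots> = 0" by (rule zero_coeffs_closed[OF f zero C])
      finally show ?thesis .
    next
      case 3
      then have "(\<integral>y. f y * indicator A y \<partial>circle) = (\<integral>y. f y \<partial>circle)"
        unfolding a by (intro Bochner_Integration.integral_cong) (auto simp: indicator_def)
      then show ?thesis using all by simp
    qed
  next
    case (compl A)
    have "(\<integral>y. f y * indicator (UNIV - A) y \<partial>circle) = (\<integral>y. f y - f y * indicator A y \<partial>circle)"
      by (intro Bochner_Integration.integral_cong) (auto simp: indicator_def)
    also have "\<dots> = 0" using compl f int all sigma by (subst Bochner_Integration.integral_diff) auto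
    finally show ?case .
  next
    case (union A)
    have Am: "A i \<in> sets borel" for i using union(2) sigma by auto
    have fin: "(\<integral>y. f y * indicator (\<Union>i<n. A i) y \<partial>circle) = 0" for n :: nat
    proof (induction n)
      case (Suc n)
      have "(\<integral>y. f y * indicator (\<Union>i<Suc n. A i) y \<partial>circle)
          = (\<integral>y. f y * indicator (\<Union>i<n. A i) y + f y * indicator (A n) y \<partial>circle)"
      proof (intro Bochner_Integration.integral_cong refl)
        fix y
        have "A i \<inter> A n = {}" if "i < n" for i
          using union(1) that by (intro disjoint_family_onD) auto
        then have "(\<Union>i<n. A i) \<inter> A n = {}" by blast
        moreover have "(\<Union>i<Suc n. A i) = (\<Union>i<n. A i) \<union> A n" by (auto simp: less_Suc_eq)
        ultimately show "f y * indicator (\<Union>i<Suc n. A i) y = f y * indicator (\<Union>i<n. A i) y + f y * indicator (A n) y"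
          by (auto simp: indicator_def)
      qed
      also have "\<dots> = 0"
        using Suc union(3)[of n] Am by (subst Bochner_Integration.integral_add) (auto intro!: int)
      finally show ?case .
    qed simp
    have "(\<lambda>n. \<integral>y. f y * indicator (\<Union>i<n. A i) y \<partial>circle) \<longlonglongrightarrow> (\<integral>y. f y * indicator (\<Union>i. A i) y \<partial>circle)"
    proof (rule integral_dominated_convergence[where w="\<lambda>y. cmod (f y)"])
      show "AE y in circle. (\<lambda>n. f y * indicator (\<Union>i<n. A i) y) \<longlonglongrightarrow> f y * indicator (\<Union>i. A i) y"
        by (intro AE_I2 tendsto_mult tendsto_const LIMSEQ_indicator_UN)
      show "AE y in circle. norm (f y * indicator (\<Union>i<n. A i) y) \<le> cmod (f y)" for n
        by (auto simp: norm_mult indicator_def)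
      show "(\<lambda>y. f y * indicator (\<Union>i<n. A i) y) \<in> borel_measurable circle" for n
        using int[of "\<Union>i<n. A i"] Am by auto
      show "(\<lambda>y. f y * indicator (\<Union>i. A i) y) \<in> borel_measurable circle"
        using int[of "\<Union>i. A i"] Am by auto
    qed (use f in auto)
    then show ?case unfolding fin by (simp add: LIMSEQ_const_iff)
  qed simp
qed

text \<open>The integral of Re (c f) over the set where it is positive vanishes, so this set is
  null. The four choices 1, -1, \<i>, -\<i> of c control both signs of the real and the imaginary
  part.\<close>

lemma AE_zero_circle:
  assumes f: "integrable circle f"
    and zero: "\<And>m::int. (\<integral>y. f y * cis (2 * pi * (real_of_int m * y)) \<partial>circle) = 0"
  shows "AE y in circle. f y = 0"
proof -
  have mf[measurable]: "f \<in> borel_measurable circle" using f by auto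
  have Re_le: "AE y in circle. Re (c * f y) \<le> 0" for c
  proof -
    define A where "A = {y \<in> space circle. Re (c * f y) > 0}"
    have "A \<in> sets circle" unfolding A_def by measurable
    then have A: "A \<in> sets borel" by (subst (asm) sets_restrict_space_iff) auto
    have int: "integrable circle (\<lambda>y. c * f y * indicator A y)"
      using A by (intro integrable_mult_bounded[where B=1] integrable_mult_right f measurable_circle borel_measurable_indicator)
        (auto simp: indicator_def)
    have "(\<integral>y. c * f y * indicator A y \<partial>circle) = c * (\<integral>y. f y * indicator A y \<partial>circle)"
      by (subst integral_mult_right_zero[symmetric]) (simp only: mult.assoc)
    then have "(\<integral>y. c * f y * indicator A y \<partial>circle) = 0"
      using zero_coeffs_borel[OF f zero A] by simp
    then have "(\<integral>y. Re (c * f y * indicator A y) \<partial>circle) = 0"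
      using integral_Re[OF int] by simp
    moreover have "Re (c * f y * indicator A y) \<ge> 0" for y
      by (auto simp: A_def indicator_def)
    ultimately have "AE y in circle. Re (c * f y * indicator A y) = 0"
      using integral_nonneg_eq_0_iff_AE[OF integrable_Re[OF int]] by simp
    with AE_space show ?thesis
    proof eventually_elim
      case (elim y)
      then show ?case by (cases "y \<in> A") (auto simp: A_def simp del: times_complex.simps)
    qed
  qed
  from Re_le[of 1] Re_le[of "-1"] Re_le[of \<i>] Re_le[of "-\<i>"] show ?thesis
    by eventually_elim (simp add: complex_eq_iff)
qed

text \<open>Splitting off the last coordinate as a factor of a binary product makes Fubini available
  in both orders and gives integrable slices for almost every y.\<close>

lemma integrable_pair_torus:
  fixes h :: "(nat \<Rightarrow> real) \<Rightarrow> complex"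
  assumes h: "integrable (torus (Suc d)) h"
  shows "integrable (torus d \<Otimes>\<^sub>M circle) (\<lambda>(x, y). h (x(d := y)))"
proof (rule integrableI_bounded)
  have mh[measurable]: "h \<in> borel_measurable (Pi\<^sub>M (insert d {..<d}) (\<lambda>_. circle))"
    using h by (auto simp: torus_Suc)
  have upd[measurable]: "(\<lambda>(x, y). x(d := y)) \<in> torus d \<Otimes>\<^sub>M circle \<rightarrow>\<^sub>M Pi\<^sub>M (insert d {..<d}) (\<lambda>_. circle)"
    unfolding torus_def by (rule measurable_add_dim)
  have "(\<lambda>p. h (case p of (x, y) \<Rightarrow> x(d := y))) \<in> borel_measurable (torus d \<Otimes>\<^sub>M circle)"
    by measurable
  then show m: "(\<lambda>(x, y). h (x(d := y))) \<in> borel_measurable (torus d \<Otimes>\<^sub>M circle)"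
    by (simp add: case_prod_beta')
  have "(\<integral>\<^sup>+p. ennreal (norm (case p of (x, y) \<Rightarrow> h (x(d := y)))) \<partial>(torus d \<Otimes>\<^sub>M circle))
      = (\<integral>\<^sup>+x. \<integral>\<^sup>+y. ennreal (norm (h (x(d := y)))) \<partial>circle \<partial>torus d)"
    using m by (subst circle.nn_integral_fst[symmetric]) (auto simp: case_prod_beta')
  also have "\<dots> = (\<integral>\<^sup>+x. ennreal (norm (h x)) \<partial>torus (Suc d))"
    unfolding torus_Suc by (subst circles.product_nn_integral_insert) (auto simp: torus_def)
  also have "\<dots> < \<infinity>" using h by (simp add: integrable_iff_bounded)
  finally show "(\<integral>\<^sup>+p. ennreal (norm (case p of (x, y) \<Rightarrow> h (x(d := y)))) \<partial>(torus d \<Otimes>\<^sub>M circle)) < \<infinity>" .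
qed

lemma countable_int_vecs: "countable (int_vecs d)"
  unfolding int_vecs_def by (intro countable_PiE) auto

text \<open>The last coordinate y is split off. For each k in the lower dimension, the k-th
  coefficient of the slice at y is a function of y whose coefficients on the circle are coefficients
  of h, so it vanishes almost everywhere and the induction hypothesis applies to almost every
  slice.\<close>

lemma AE_zero_torus:
  assumes "integrable (torus d) h"
    and "\<And>k. k \<in> int_vecs d \<Longrightarrow> (\<integral>x. h x * trig d k x \<partial>torus d) = 0"
  shows "AE x in torus d. h x = 0"
  using assms
proof (induction d arbitrary: h)
  case 0
  have t0: "torus 0 = count_space {\<lambda>_. undefined}" by (simp add: torus_def PiM_empty)
  have "(\<lambda>_. undefined) \<in> int_vecs 0" by (simp add: int_vecs_def)
  from 0(2)[OF this] have "h (\<lambda>_. undefined) = 0"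
    by (simp add: t0 trig_def lebesgue_integral_count_space_finite)
  then show ?case unfolding t0 AE_count_space by simp
next
  case (Suc d)
  interpret T: prob_space "torus d" by (rule prob_space_torus)
  interpret P: pair_sigma_finite "torus d" circle ..
  have int: "integrable (torus d \<Otimes>\<^sub>M circle) (\<lambda>(x, y). h (x(d := y)))"
    by (rule integrable_pair_torus[OF Suc.prems(1)])
  have mh[measurable]: "h \<in> borel_measurable (Pi\<^sub>M (insert d {..<d}) (\<lambda>_. circle))"
    using Suc.prems(1) by (auto simp: torus_Suc)
  have "AE y in circle. (\<integral>x. h (x(d := y)) * trig d k x \<partial>torus d) = 0" if k: "k \<in> int_vecs d" for k
  proof (rule AE_zero_circle)
    have mt: "(\<lambda>(x, y). trig d k x) \<in> borel_measurable (torus d \<Otimes>\<^sub>M circle)" by measurable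
    have intk: "integrable (torus d \<Otimes>\<^sub>M circle) (\<lambda>(x, y). h (x(d := y)) * trig d k x)"
      using integrable_mult_bounded[OF int mt, of 1] by (simp add: case_prod_beta')
    then show "integrable circle (\<lambda>y. \<integral>x. h (x(d := y)) * trig d k x \<partial>torus d)"
      by (rule P.integrable_snd)
    fix m :: int
    have mc: "(\<lambda>(x, y). cis (2 * pi * (real_of_int m * y))) \<in> borel_measurable (torus d \<Otimes>\<^sub>M circle)" by measurable
    have intm: "integrable (torus d \<Otimes>\<^sub>M circle) (\<lambda>(x, y). h (x(d := y)) * trig d k x * cis (2 * pi * (real_of_int m * y)))"
      using integrable_mult_bounded[OF intk mc, of 1] by (simp add: case_prod_beta')
    define k' where "k' = k(d := m)"
    have k': "k' \<in> int_vecs (Suc d)" using k by (auto simp: k'_def int_vecs_def PiE_def extensional_def)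
    have tr: "trig (Suc d) k' (x(d := y)) = trig d k x * cis (2 * pi * (real_of_int m * y))" for x y
    proof -
      have "trig d k' x = trig d k x" by (simp add: trig_def k'_def)
      then show ?thesis by (simp add: trig_Suc_upd) (simp add: k'_def)
    qed
    have "(\<integral>y. (\<integral>x. h (x(d := y)) * trig d k x \<partial>torus d) * cis (2 * pi * (real_of_int m * y)) \<partial>circle)
        = (\<integral>y. \<integral>x. h (x(d := y)) * trig d k x * cis (2 * pi * (real_of_int m * y)) \<partial>torus d \<partial>circle)"
      by simp
    also have "\<dots> = (\<integral>x. \<integral>y. h (x(d := y)) * trig d k x * cis (2 * pi * (real_of_int m * y)) \<partial>circle \<partial>torus d)"
      by (rule P.Fubini_integral[OF intm])
    also have "\<dots> = (\<integral>x. h x * trig (Suc d) k' x \<partial>torus (Suc d))"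
    proof (subst integral_torus_Suc)
      show "integrable (torus (Suc d)) (\<lambda>x. h x * trig (Suc d) k' x)"
        by (rule integrable_mult_bounded[OF Suc.prems(1), where B=1]) auto
    qed (simp add: tr mult.assoc)
    also have "\<dots> = 0" by (rule Suc.prems(2)[OF k'])
    finally show "(\<integral>y. (\<integral>x. h (x(d := y)) * trig d k x \<partial>torus d) * cis (2 * pi * (real_of_int m * y)) \<partial>circle) = 0" .
  qed
  \<comment> \<open>Countability of the frequencies makes one null set serve all of them.\<close>
  then have coeffs: "AE y in circle. \<forall>k\<in>int_vecs d. (\<integral>x. h (x(d := y)) * trig d k x \<partial>torus d) = 0"
    by (subst AE_ball_countable[OF countable_int_vecs]) blast
  have "AE y in circle. integrable (torus d) (\<lambda>x. h (x(d := y)))"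
    by (rule P.AE_integrable_snd[OF int])
  with coeffs have "AE y in circle. AE x in torus d. h (x(d := y)) = 0"
  proof eventually_elim
    case (elim y)
    show ?case by (rule Suc.IH) (use elim in blast)+
  qed
  \<comment> \<open>The nested almost-everywhere statement is converted into one on the torus
    through the integral of the norm.\<close>
  then have "AE y in circle. (\<integral>\<^sup>+x. ennreal (norm (h (x(d := y)))) \<partial>torus d) = 0"
  proof eventually_elim
    case (elim y)
    then have "(\<integral>\<^sup>+x. ennreal (norm (h (x(d := y)))) \<partial>torus d) = (\<integral>\<^sup>+x. 0 \<partial>torus d)"
      by (intro nn_integral_cong_AE) (auto elim: eventually_mono)
    then show ?case by simp
  qed
  then have "(\<integral>\<^sup>+y. \<integral>\<^sup>+x. ennreal (norm (h (x(d := y)))) \<partial>torus d \<partial>circle) = (\<integral>\<^sup>+y. 0 \<partial>circle)"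
    by (rule nn_integral_cong_AE)
  moreover have "(\<integral>\<^sup>+x. ennreal (norm (h x)) \<partial>torus (Suc d))
      = (\<integral>\<^sup>+y. \<integral>\<^sup>+x. ennreal (norm (h (x(d := y)))) \<partial>torus d \<partial>circle)"
    unfolding torus_Suc by (subst circles.product_nn_integral_insert_rev) (auto simp: torus_def)
  ultimately have "(\<integral>\<^sup>+x. ennreal (norm (h x)) \<partial>torus (Suc d)) = 0" by simp
  then have "AE x in torus (Suc d). ennreal (norm (h x)) = 0"
    using Suc.prems(1) by (subst (asm) nn_integral_0_iff_AE) auto
  then show ?case by eventually_elim simp
qed

subsection \<open>Fourier series and continuous representatives\<close>

lemma trig_mult: "trig d k x * trig d l x = trig d (\<lambda>s. k s + l s) x"
  unfolding trig_def cis_mult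
  by (rule arg_cong[where f=cis]) (simp add: sum.distrib algebra_simps)

lemma fourier_coeff_eq: "fourier_coeff d f k = (\<integral>x. f x * trig d (\<lambda>s. - k s) x \<partial>torus d)"
  by (simp add: fourier_coeff_def trig_def sum_negf)

lemma integral_trig: "(\<integral>x. trig d k x \<partial>torus d) = (if \<forall>s<d. k s = 0 then 1 else 0)"
proof (induction d)
  case 0
  interpret prob_space "torus 0" by (rule prob_space_torus)
  show ?case using prob_space by (simp add: trig_def)
next
  case (Suc d)
  have "integrable (torus (Suc d)) (trig (Suc d) k)"
    by (rule integrable_torus_bounded[where B=1]) auto
  then have "(\<integral>x. trig (Suc d) k x \<partial>torus (Suc d))
      = (\<integral>x. \<integral>y. trig d k x * cis (2 * pi * (real_of_int (k d) * y)) \<partial>circle \<partial>torus d)"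
    by (simp add: integral_torus_Suc trig_Suc_upd)
  also have "\<dots> = (\<integral>x. trig d k x * (if k d = 0 then 1 else 0) \<partial>torus d)"
    by (simp only: integral_mult_right_zero integral_circle_cis)
  also have "\<dots> = (if \<forall>s<Suc d. k s = 0 then 1 else 0)"
    using Suc by (auto simp: less_Suc_eq)
  finally show ?case .
qed

text \<open>An exhausting sequence of finite sets: it turns unordered sums into limits along
  sequences, to which dominated convergence applies.\<close>

definition freq_box :: "nat \<Rightarrow> nat \<Rightarrow> (nat \<Rightarrow> int) set" where
  "freq_box d n = (\<Pi>\<^sub>E s\<in>{..<d}. {- int n..int n})"

lemma finite_freq_box: "finite (freq_box d n)"
  unfolding freq_box_def by (intro finite_PiE) auto

lemma freq_box_subset: "freq_box d n \<subseteq> int_vecs d"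
  by (auto simp: freq_box_def int_vecs_def)

lemma eventually_in_freq_box:
  assumes "k \<in> int_vecs d"
  shows "\<forall>\<^sub>F n in sequentially. k \<in> freq_box d n"
  using eventually_ge_at_top[of "nat (\<Sum>s<d. \<bar>k s\<bar>)"]
proof eventually_elim
  case (elim n)
  have "\<bar>k s\<bar> \<le> int n" if "s < d" for s
  proof -
    have "\<bar>k s\<bar> \<le> (\<Sum>s<d. \<bar>k s\<bar>)" using that by (intro member_le_sum) auto
    with elim show ?thesis by simp
  qed
  then show ?case using assms by (fastforce simp: freq_box_def int_vecs_def PiE_iff abs_le_iff)
qed

lemma filterlim_freq_box: "filterlim (freq_box d) (finite_subsets_at_top (int_vecs d)) sequentially"
  unfolding filterlim_finite_subsets_at_top
proof (intro allI impI, elim conjE)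
  fix X assume X: "finite X" "X \<subseteq> int_vecs d"
  have "\<forall>\<^sub>F n in sequentially. \<forall>k\<in>X. k \<in> freq_box d n"
    using X by (intro eventually_ball_finite) (auto intro: eventually_in_freq_box)
  then show "\<forall>\<^sub>F n in sequentially. finite (freq_box d n) \<and> X \<subseteq> freq_box d n \<and> freq_box d n \<subseteq> int_vecs d"
    by eventually_elim (use finite_freq_box freq_box_subset in auto)
qed

lemma continuous_on_trig: "continuous_on S (trig d k)"
  unfolding trig_def[abs_def]
  by (intro continuous_intros continuous_on_product_then_coordinatewise[OF continuous_on_id])

lemma trig_shift:
  assumes "s < d"
  shows "trig d k (x(s := x s + 1)) = trig d k x"
proof -
  have "(\<Sum>t<d. real_of_int (k t) * (x(s := x s + 1)) t)
      = real_of_int (k s) * (x s + 1) + (\<Sum>t\<in>{..<d} - {s}. real_of_int (k t) * x t)"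
    using assms by (subst sum.remove[of _ s]) auto
  also have "\<dots> = (\<Sum>t<d. real_of_int (k t) * x t) + real_of_int (k s)"
    using assms by (subst (2) sum.remove[of _ s]) (auto simp: algebra_simps)
  finally show ?thesis
    using cis_multiple_2pi[of "real_of_int (k s)"]
    by (simp add: trig_def distrib_left flip: cis_mult)
qed

text \<open>Starts from coefficients and not from a function. The continuous sum is built with its
  uniform \<open>bound\<close>, and afterwards any integrable function with these Fourier
  coefficients is shown to equal it almost everywhere.\<close>

locale absolutely_convergent_series =
  fixes d :: nat and c :: "(nat \<Rightarrow> int) \<Rightarrow> complex"
  assumes summable: "(\<lambda>k. cmod (c k)) summable_on int_vecs d"
begin

definition bound :: real where
  "bound = (\<Sum>\<^sub>\<infinity>k\<in>int_vecs d. cmod (c k))"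

definition series :: "(nat \<Rightarrow> real) \<Rightarrow> complex" where
  "series x = (\<Sum>\<^sub>\<infinity>k\<in>int_vecs d. c k * trig d k x)"

lemma norm_trig_poly_le:
  assumes "finite F" "F \<subseteq> int_vecs d"
  shows "cmod (trig_poly d F c x) \<le> bound"
proof -
  have "cmod (trig_poly d F c x) \<le> (\<Sum>k\<in>F. cmod (c k))"
    unfolding trig_poly_def by (rule sum_norm_le) (simp add: norm_mult)
  also have "\<dots> \<le> bound"
    unfolding bound_def using assms by (intro finite_sum_le_infsum summable) auto
  finally show ?thesis .
qed

lemma trig_poly_tendsto: "(\<lambda>n. trig_poly d (freq_box d n) c x) \<longlonglongrightarrow> series x"
proof -
  have "(\<lambda>k. c k * trig d k x) summable_on int_vecs d"
    by (rule abs_summable_summable) (use summable in \<open>simp add: norm_mult\<close>)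
  then have "((\<lambda>k. c k * trig d k x) has_sum series x) (int_vecs d)"
    unfolding series_def by (rule has_sum_infsum)
  then have "(sum (\<lambda>k. c k * trig d k x) \<longlongrightarrow> series x) (finite_subsets_at_top (int_vecs d))"
    by (simp add: has_sum_def)
  from filterlim_compose[OF this filterlim_freq_box] show ?thesis
    by (simp add: trig_poly_def)
qed

lemma norm_series_le: "cmod (series x) \<le> bound"
  by (rule LIMSEQ_le_const2[OF tendsto_norm[OF trig_poly_tendsto]])
     (intro exI[of _ 0] allI impI norm_trig_poly_le finite_freq_box freq_box_subset)

lemma measurable_trig_poly: "trig_poly d F c \<in> borel_measurable (torus d)"
  unfolding trig_poly_def[abs_def] by measurable

lemma measurable_series: "series \<in> borel_measurable (torus d)"
  by (rule borel_measurable_LIMSEQ_metric[OF measurable_trig_poly]) (rule trig_poly_tendsto)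

lemma torus_continuous_series: "torus_continuous d series"
proof -
  have "uniform_limit (real_vecs d) (\<lambda>F x. \<Sum>k\<in>F. c k * trig d k x) series (finite_subsets_at_top (int_vecs d))"
    unfolding series_def[abs_def]
    by (rule Weierstrass_m_test_general[OF _ summable]) (simp add: norm_mult)
  then have "continuous_on (real_vecs d) series"
    by (rule uniform_limit_theorem[rotated])
       (auto intro!: always_eventually continuous_intros continuous_on_trig)
  then show ?thesis by (simp add: torus_continuous_def series_def trig_shift)
qed

text \<open>Termwise integration is dominated by the constant \<open>bound\<close>. As soon as the
  box contains l, the coefficient of the partial sum is exactly \<open>c l\<close>.\<close>

lemma fourier_coeff_series:
  assumes l: "l \<in> int_vecs d"
  shows "fourier_coeff d series l = c l"
proof -
  interpret prob_space "torus d" by (rule prob_space_torus)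
  define e where "e = trig d (\<lambda>s. - l s)"
  have e[measurable]: "e \<in> borel_measurable (torus d)" by (simp add: e_def)
  have ne: "cmod (e x) = 1" for x by (simp add: e_def)
  have "(\<lambda>n. \<integral>x. trig_poly d (freq_box d n) c x * e x \<partial>torus d) \<longlonglongrightarrow> (\<integral>x. series x * e x \<partial>torus d)"
  proof (rule integral_dominated_convergence[where w="\<lambda>_. bound"])
    show "AE x in torus d. (\<lambda>n. trig_poly d (freq_box d n) c x * e x) \<longlonglongrightarrow> series x * e x"
      by (intro AE_I2 tendsto_mult tendsto_const trig_poly_tendsto)
    show "AE x in torus d. norm (trig_poly d (freq_box d n) c x * e x) \<le> bound" for n
      using norm_trig_poly_le[OF finite_freq_box freq_box_subset] by (simp add: norm_mult ne)
  qed (use measurable_trig_poly measurable_series in measurable)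
  moreover have "\<forall>\<^sub>F n in sequentially. (\<integral>x. trig_poly d (freq_box d n) c x * e x \<partial>torus d) = c l"
    using eventually_in_freq_box[OF l]
  proof eventually_elim
    case (elim n)
    have "(\<integral>x. trig_poly d (freq_box d n) c x * e x \<partial>torus d)
        = (\<integral>x. (\<Sum>k\<in>freq_box d n. c k * trig d (\<lambda>s. k s - l s) x) \<partial>torus d)"
      by (simp add: trig_poly_def e_def sum_distrib_right mult.assoc trig_mult)
    also have "\<dots> = (\<Sum>k\<in>freq_box d n. c k * (\<integral>x. trig d (\<lambda>s. k s - l s) x \<partial>torus d))"
      by (subst Bochner_Integration.integral_sum)
         (auto intro!: integrable_mult_right integrable_torus_bounded[where B=1])
    also have "\<dots> = (\<Sum>k\<in>freq_box d n. if k = l then c k else 0)"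
    proof (rule sum.cong[OF refl])
      fix k assume "k \<in> freq_box d n"
      then have "k \<in> int_vecs d" using freq_box_subset by blast
      then have "(\<forall>s<d. k s - l s = 0) \<longleftrightarrow> k = l"
        using l by (auto simp: int_vecs_def intro!: PiE_ext[of k "{..<d}" "\<lambda>_. UNIV" l])
      then show "c k * (\<integral>x. trig d (\<lambda>s. k s - l s) x \<partial>torus d) = (if k = l then c k else 0)"
        by (simp add: integral_trig)
    qed
    also have "\<dots> = c l" using elim finite_freq_box by simp
    finally show ?case .
  qed
  ultimately have "(\<integral>x. series x * e x \<partial>torus d) = c l"
    by (rule LIMSEQ_unique[OF _ tendsto_eventually])
  then show ?thesis by (simp add: fourier_coeff_eq e_def)
qed

lemma AE_eq_series:
  assumes f: "integrable (torus d) f" and c: "\<And>k. k \<in> int_vecs d \<Longrightarrow> fourier_coeff d f k = c k"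
  shows "AE x in torus d. series x = f x"
proof -
  have s: "integrable (torus d) series"
    by (rule integrable_torus_bounded[OF measurable_series norm_series_le])
  have "AE x in torus d. series x - f x = 0"
  proof (rule AE_zero_torus)
    fix k assume k: "k \<in> int_vecs d"
    \<comment> \<open>Membership in \<open>int_vecs d\<close> prescribes \<open>undefined\<close>
      beyond d, so the negated frequency has to be restricted again.\<close>
    define k' where "k' = (\<lambda>s\<in>{..<d}. - k s)"
    have k': "k' \<in> int_vecs d" by (simp add: k'_def int_vecs_def)
    have tr: "trig d k x = trig d (\<lambda>s. - k' s) x" for x by (simp add: trig_def k'_def)
    have int: "integrable (torus d) (\<lambda>x. g x * trig d k x)" if "integrable (torus d) g" for g
      using that by (rule integrable_mult_bounded[where B=1]) auto
    have "(\<integral>x. (series x - f x) * trig d k x \<partial>torus d)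
        = (\<integral>x. series x * trig d k x \<partial>torus d) - (\<integral>x. f x * trig d k x \<partial>torus d)"
      unfolding left_diff_distrib by (rule Bochner_Integration.integral_diff) (intro int s f)+
    also have "\<dots> = fourier_coeff d series k' - fourier_coeff d f k'"
      unfolding fourier_coeff_eq tr ..
    finally show "(\<integral>x. (series x - f x) * trig d k x \<partial>torus d) = 0"
      by (simp add: fourier_coeff_series[OF k'] c[OF k'])
  qed (use s f in simp)
  then show ?thesis by eventually_elim simp
qed

end

section \<open>Uniqueness of continuous representatives\<close>

lemma torus_continuous_int_shift:
  assumes g: "torus_continuous d g" and x: "x \<in> real_vecs d" and s: "s < d"
  shows "g (x(s := x s + real_of_int n)) = g x"
proof -
  have upd: "x(s := a) \<in> real_vecs d" if "x \<in> real_vecs d" for x a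
    using that s by (auto simp: real_vecs_def PiE_def extensional_def)
  have nat: "g (x(s := x s + real m)) = g x" if x: "x \<in> real_vecs d" for m x
  proof (induction m)
    case (Suc m)
    let ?y = "x(s := x s + real m)"
    have "\<forall>x\<in>real_vecs d. \<forall>s<d. g (x(s := x s + 1)) = g x" using g by (simp add: torus_continuous_def)
    from this[rule_format, OF upd[OF x] s] have "g (?y(s := ?y s + 1)) = g ?y" .
    moreover have "?y(s := ?y s + 1) = x(s := x s + real (Suc m))" by (simp add: fun_eq_iff)
    ultimately have "g (x(s := x s + real (Suc m))) = g ?y" by (simp only:)
    also have "\<dots> = g x" by (rule Suc)
    finally show ?case .
  qed simp
  show ?thesis
  proof (cases "n \<ge> 0")
    case True
    then show ?thesis using nat[OF x, of "nat n"] by simp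
  next
    case False
    have "g ((x(s := x s + real_of_int n))(s := (x(s := x s + real_of_int n)) s + real (nat (- n))))
        = g (x(s := x s + real_of_int n))"
      by (rule nat[OF upd[OF x]])
    then show ?thesis using False by simp
  qed
qed

text \<open>The measure lives on the unit cube while continuous representatives are functions on all
  of \<open>real_vecs d\<close>. Reducing one coordinate after the other brings every point into the
  cube.\<close>

lemma torus_continuous_frac:
  assumes g: "torus_continuous d g" and x: "x \<in> real_vecs d"
  shows "g (\<lambda>s\<in>{..<d}. frac (x s)) = g x"
proof -
  define y where "y m s = (if s < m then frac (x s) else x s)" for m s :: nat
  have "g (y m) = g x" if "m \<le> d" for m
    using that
  proof (induction m)
    case 0
    then show ?case by (simp add: y_def)
  next
    case (Suc m)
    have ym: "y m \<in> real_vecs d"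
      using x Suc.prems by (auto simp: real_vecs_def PiE_def extensional_def y_def)
    have ys: "y (Suc m) = (y m)(m := y m m + real_of_int (- \<lfloor>x m\<rfloor>))"
      by (auto simp: y_def frac_def fun_eq_iff less_Suc_eq)
    have "g (y (Suc m)) = g (y m)"
      unfolding ys by (rule torus_continuous_int_shift[OF g ym]) (use Suc.prems in simp)
    also have "\<dots> = g x" using Suc by simp
    finally show ?case .
  qed
  moreover have "y d = (\<lambda>s\<in>{..<d}. frac (x s))"
    using x by (auto simp: y_def real_vecs_def PiE_def extensional_def fun_eq_iff)
  ultimately show ?thesis by force
qed

text \<open>Small boxes at the reduced point u have positive measure, so each contains a point where
  the two functions agree; these points converge to u.\<close>

lemma torus_continuous_unique:
  assumes g: "torus_continuous d g" and h: "torus_continuous d h"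
    and ae: "AE x in torus d. g x = h x" and x: "x \<in> real_vecs d"
  shows "g x = h x"
proof -
  define u where "u = (\<lambda>s\<in>{..<d}. frac (x s))"
  have u: "u \<in> real_vecs d" by (simp add: u_def real_vecs_def)
  have u01: "0 \<le> u s" "u s < 1" if "s < d" for s using that by (auto simp: u_def frac_lt_1)
  \<comment> \<open>The boxes have u as lower corner and are cut off at 1, so they stay in the cube
    even if u lies on one of its faces.\<close>
  define b where "b n s = min 1 (u s + 1 / real (Suc n))" for n s
  define B where "B n = (\<Pi>\<^sub>E s\<in>{..<d}. {u s..<b n s})" for n
  have Bs: "B n \<in> sets (torus d)" for n
    unfolding B_def torus_def
  proof (rule sets_PiM_I_finite)
    fix s assume "s \<in> {..<d}"
    then show "{u s..<b n s} \<in> sets circle"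
      using u01[of s] by (subst sets_restrict_space_iff) (auto simp: b_def)
  qed simp
  have "emeasure (torus d) (B n) \<noteq> 0" for n
  proof -
    have "emeasure (torus d) (B n) = (\<Prod>s<d. emeasure circle {u s..<b n s})"
      unfolding torus_def B_def
    proof (rule circles.emeasure_PiM)
      fix s assume "s \<in> {..<d}"
      then show "{u s..<b n s} \<in> sets circle"
        using u01[of s] by (subst sets_restrict_space_iff) (auto simp: b_def)
    qed simp
    moreover have "emeasure circle {u s..<b n s} \<noteq> 0" if "s < d" for s
    proof -
      have "emeasure circle {u s..<b n s} = emeasure lborel {u s..<b n s}"
        using u01[OF that] by (intro emeasure_restrict_space) (auto simp: b_def)
      also have "\<dots> = ennreal (b n s - u s)" using u01[OF that] by (simp add: b_def)
      also have "\<dots> \<noteq> 0"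
      proof -
        have "u s < b n s" using u01[OF that] by (simp add: b_def)
        then show ?thesis by (simp add: ennreal_eq_0_iff)
      qed
      finally show ?thesis .
    qed
    ultimately show ?thesis by simp
  qed
  have "\<exists>y\<in>B n. g y = h y" for n
  proof (rule ccontr)
    assume "\<not> (\<exists>y\<in>B n. g y = h y)"
    with ae have "AE x in torus d. x \<notin> B n" by (auto elim!: eventually_mono)
    moreover have "{x \<in> space (torus d). \<not> x \<notin> B n} = B n" using sets.sets_into_space[OF Bs[of n]] by auto
    ultimately have "emeasure (torus d) (B n) = 0"
      using AE_iff_measurable[OF Bs[of n], of "\<lambda>x. x \<notin> B n"] by simp
    with \<open>emeasure (torus d) (B n) \<noteq> 0\<close> show False ..
  qed
  then obtain y where y: "\<And>n. y n \<in> B n" "\<And>n. g (y n) = h (y n)" by metis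
  have yr: "y n \<in> real_vecs d" for n using y(1)[of n] by (auto simp: B_def real_vecs_def)
  have comp: "(\<lambda>n. y n s) \<longlonglongrightarrow> u s" for s
  proof (cases "s < d")
    case True
    have le: "u s \<le> y n s" "y n s \<le> u s + 1 / real (Suc n)" for n
      using PiE_mem[OF y(1)[of n, unfolded B_def], of s] True by (auto simp: b_def)
    have lim: "(\<lambda>n. u s + 1 / real (Suc n)) \<longlonglongrightarrow> u s"
      using tendsto_add[OF tendsto_const lim_1_over_n[THEN LIMSEQ_Suc], of "u s"] by simp
    show ?thesis
      by (rule tendsto_sandwich[OF always_eventually always_eventually tendsto_const lim]) (intro allI le)+
  next
    case False
    then have "y n s = u s" for n using yr[of n] u by (auto simp: real_vecs_def PiE_def extensional_def)
    then show ?thesis by simp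
  qed
  have "limitin (product_topology (\<lambda>_. euclidean) UNIV) y u sequentially"
    unfolding limitin_componentwise using comp by auto
  then have lim: "y \<longlonglongrightarrow> u" by (simp add: euclidean_product_topology)
  have "(\<lambda>n. g (y n)) \<longlonglongrightarrow> g u"
    by (rule continuous_on_tendsto_compose[OF _ lim u]) (use g yr in \<open>auto simp: torus_continuous_def\<close>)
  moreover have "(\<lambda>n. h (y n)) \<longlonglongrightarrow> h u"
    by (rule continuous_on_tendsto_compose[OF _ lim u]) (use h yr in \<open>auto simp: torus_continuous_def\<close>)
  ultimately have "g u = h u" unfolding y(2) by (rule LIMSEQ_unique)
  then show ?thesis
    using torus_continuous_frac[OF g x] torus_continuous_frac[OF h x] by (simp add: u_def)
qed

subsection \<open>The error of the sampling operator\<close>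

text \<open>The bound by the total level is a product over the coordinates. Enlarging a finite set
  to the product of its projections turns the sum into a product of univariate sums, which are
  bounded since \<alpha> + \<beta> > 1/2 gives r < 1.\<close>

lemma summable_inverse_hybrid_weight:
  fixes \<alpha> \<beta> :: real
  assumes ab: "\<alpha> > 0" "\<beta> \<le> 0" "\<alpha> + \<beta> > 1/2" and d: "d \<ge> 1"
  shows "(\<lambda>k. 1 / hybrid_weight d \<alpha> \<beta> k) summable_on int_vecs d"
proof (rule nonneg_bdd_above_summable_on)
  define a where "a = \<alpha> + \<beta>"
  define r :: real where "r = 2 powr (1 - 2 * a)"
  have r: "0 < r" "r < 1"
    using ab powr_less_mono[of "1 - 2 * a" 0 2] by (auto simp: r_def a_def)
  define K where "K = 4 powr (\<alpha> * d) * (2 * real d) powr (- \<beta>) * d"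
  have K: "K > 0" using d by (simp add: K_def)
  have one: "(\<Sum>m\<in>S. 4 powr (- a * real (lev m))) \<le> 3 / (1 - r)" if S: "finite S" for S
  proof -
    define n where "n = (\<Sum>m\<in>S. lev m)"
    have lev_n: "lev m \<le> n" if "m \<in> S" for m
      unfolding n_def using member_le_sum[OF that _ S, of lev] by simp
    have "(\<Sum>m\<in>S. 4 powr (- a * real (lev m))) \<le> 3 * (\<Sum>j\<le>n. r ^ j)"
      unfolding r_def by (rule sum_four_powr_lev_le[OF S lev_n])
    also have "\<dots> \<le> 3 * (\<Sum>j. r ^ j)"
      using r by (intro mult_left_mono sum_le_suminf summable_geometric) auto
    also have "\<dots> = 3 / (1 - r)" using r by (simp add: suminf_geometric)
    finally show ?thesis .
  qed
  show "bdd_above (sum (\<lambda>k. 1 / hybrid_weight d \<alpha> \<beta> k) ` {F. F \<subseteq> int_vecs d \<and> finite F})"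
  proof (rule bdd_aboveI2)
    fix F assume "F \<in> {F. F \<subseteq> int_vecs d \<and> finite F}"
    then have F: "finite F" "F \<subseteq> int_vecs d" by auto
    define P where "P = (\<Pi>\<^sub>E s\<in>{..<d}. (\<lambda>k. k s) ` F)"
    have P: "finite P" "F \<subseteq> P"
      using F by (auto simp: P_def int_vecs_def PiE_iff intro!: finite_PiE)
    have "(\<Sum>k\<in>F. 1 / hybrid_weight d \<alpha> \<beta> k) \<le> (\<Sum>k\<in>F. K * 4 powr (- a * level d k))"
      unfolding K_def a_def by (intro sum_mono inverse_hybrid_weight_le_level ab d)
    also have "\<dots> \<le> (\<Sum>k\<in>P. K * 4 powr (- a * level d k))"
      using K P by (intro sum_mono2) auto
    also have "\<dots> = K * (\<Sum>k\<in>P. \<Prod>s<d. 4 powr (- a * real (lev (k s))))"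
      unfolding sum_distrib_left level_def of_nat_sum by (simp add: powr_sum)
    also have "(\<Sum>k\<in>P. \<Prod>s<d. 4 powr (- a * real (lev (k s))))
        = (\<Prod>s<d. \<Sum>m\<in>(\<lambda>k. k s) ` F. 4 powr (- a * real (lev m)))"
      unfolding P_def using F by (intro prod_sum_PiE[symmetric]) auto
    also have "\<dots> \<le> (\<Prod>s<d. 3 / (1 - r))"
      using F by (intro prod_mono conjI one sum_nonneg) auto
    finally show "(\<Sum>k\<in>F. 1 / hybrid_weight d \<alpha> \<beta> k) \<le> K * (3 / (1 - r)) ^ d"
      using K by (simp add: mult_left_mono)
  qed
qed (simp add: hybrid_weight_pos less_imp_le)

lemma L2_space_integrable:
  assumes "f \<in> L2_space d"
  shows "integrable (torus d) f"
proof -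
  interpret prob_space "torus d" by (rule prob_space_torus)
  have f: "f \<in> borel_measurable (torus d)" "integrable (torus d) (\<lambda>x. (norm (f x))\<^sup>2)"
    using assms by (auto simp: L2_space_def)
  show ?thesis
  proof (rule Bochner_Integration.integrable_bound[OF _ f(1)])
    show "integrable (torus d) (\<lambda>x. 1 + (norm (f x))\<^sup>2)" using f by simp
    have "t \<le> 1 + t\<^sup>2" for t :: real
    proof -
      have "(t - 1 / 2)\<^sup>2 = t\<^sup>2 - t + 1 / 4" by (simp add: power2_eq_square algebra_simps)
      then show ?thesis using zero_le_power2[of "t - 1 / 2"] by linarith
    qed
    then show "AE x in torus d. norm (f x) \<le> norm (1 + (norm (f x))\<^sup>2)"
      by (auto intro!: AE_I2 order_trans[OF _ abs_ge_self])
  qed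
qed

text \<open>Cauchy-Schwarz in its pointwise form: 2 t is at most w t^2 + 1/w. Absolute summability
  of the coefficients is what yields the continuous representative.\<close>

lemma hybrid_space_summable:
  fixes \<alpha> \<beta> :: real
  assumes ab: "\<alpha> > 0" "\<beta> \<le> 0" "\<alpha> + \<beta> > 1/2" and d: "d \<ge> 1"
    and f: "f \<in> hybrid_space d \<alpha> \<beta>"
  shows "(\<lambda>k. cmod (fourier_coeff d f k)) summable_on int_vecs d"
proof (rule summable_on_comparison_test)
  show "(\<lambda>k. hybrid_term d \<alpha> \<beta> f k + 1 / hybrid_weight d \<alpha> \<beta> k) summable_on int_vecs d"
    using f by (intro summable_on_add summable_inverse_hybrid_weight ab d) (simp add: hybrid_space_def)
  fix k
  define w where "w = hybrid_weight d \<alpha> \<beta> k"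
  define t where "t = cmod (fourier_coeff d f k)"
  have w: "w > 0" by (simp add: w_def hybrid_weight_pos)
  have "0 \<le> (w * t - 1)\<^sup>2" by simp
  then have "2 * t * w \<le> (w * t\<^sup>2 + 1 / w) * w" using w by (simp add: power2_eq_square algebra_simps)
  then have "2 * t \<le> w * t\<^sup>2 + 1 / w" using w by (simp only: mult_le_cancel_right_pos)
  moreover have "t \<ge> 0" by (simp add: t_def)
  ultimately have "t \<le> w * t\<^sup>2 + 1 / w" by linarith
  then show "cmod (fourier_coeff d f k) \<le> hybrid_term d \<alpha> \<beta> f k + 1 / hybrid_weight d \<alpha> \<beta> k"
    by (simp add: t_def w_def hybrid_term_eq)
qed simp

lemma lattice_node_real_vecs: "lattice_node d z M j \<in> real_vecs d"
  by (simp add: lattice_node_def real_vecs_def)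

lemma sampling_op_cong:
  assumes "\<And>x. x \<in> real_vecs d \<Longrightarrow> f x = g x"
  shows "sampling_op d I z M f = sampling_op d I z M g"
  by (simp add: sampling_op_def[abs_def] lattice_coeff_def assms lattice_node_real_vecs)

text \<open>A crude bound used solely as a dominating constant; the cardinality of I does not reach
  the final estimate.\<close>

lemma norm_sampling_op_le:
  assumes g: "\<And>x. cmod (g x) \<le> B" and M: "0 < M"
  shows "cmod (sampling_op d I z M g x) \<le> real (card I) * B"
proof -
  have "cmod (lattice_coeff d z M g k) \<le> B" for k
  proof -
    have "cmod (\<Sum>j<M. g (lattice_node d z M j)
        * cis (- 2 * pi * (real j / real M) * (\<Sum>s<d. real_of_int (k s) * real_of_int (z s)))) \<le> real (card {..<M}) * B"
      by (intro order_trans[OF norm_sum] sum_bounded_above) (simp add: norm_mult g)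
    then show ?thesis using M by (simp add: lattice_coeff_def norm_mult norm_divide field_simps)
  qed
  then show ?thesis
    unfolding sampling_op_def
    by (intro order_trans[OF norm_sum] sum_bounded_above) (simp add: norm_mult)
qed

lemma sampling_op_tendsto:
  assumes "\<And>x. (\<lambda>n. g n x) \<longlonglongrightarrow> h x"
  shows "(\<lambda>n. sampling_op d I z M (g n) x) \<longlonglongrightarrow> sampling_op d I z M h x"
  unfolding sampling_op_def lattice_coeff_def by (intro tendsto_intros assms)

lemma measurable_sampling_op: "sampling_op d I z M g \<in> borel_measurable (torus d)"
  unfolding sampling_op_def[abs_def] by measurable

text \<open>The partial sums of the Fourier series over boxes lie in the same unit ball, so the
  polynomial bound holds for them uniformly. Dominated convergence carries it to the series, which
  agrees with f almost everywhere and with the continuous representative at the nodes.\<close>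

lemma Lq_norm_error_bound:
  fixes \<alpha> \<beta> q :: real
  assumes ab: "\<alpha> > 0" "\<beta> \<le> 0" "\<alpha> + \<beta> > 1/2" and d: "d \<ge> 1" and q: "2 < q"
  shows "\<exists>C>0. \<forall>R z M f. R \<ge> 1 \<and> reconstructing d (hyp_cross d R) z M
      \<and> f \<in> hybrid_space d \<alpha> \<beta> \<and> hybrid_norm d \<alpha> \<beta> f \<le> 1 \<longrightarrow>
    Lq_norm d q (\<lambda>x. f x - sampling_op d (hyp_cross d R) z M (continuous_rep d f) x)
      \<le> ennreal (C * (2 powr (- (\<alpha> + \<beta> - (1/2 - 1/q)) * R)
              * (if \<beta> = 0 then R powr ((real d - 1) / 2) else 1)))"
proof -
  from trig_poly_error_bound[OF ab d q] obtain C where C: "C > 0"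
    "\<forall>R z M F c. R \<ge> 1 \<and> reconstructing d (hyp_cross d R) z M \<and> finite F \<and> F \<subseteq> int_vecs d
      \<and> (\<Sum>k\<in>F. hybrid_weight d \<alpha> \<beta> k * (cmod (c k))\<^sup>2) \<le> 1 \<longrightarrow>
    (\<integral>x. cmod (trig_poly d F c x - sampling_op d (hyp_cross d R) z M (trig_poly d F c) x) powr q \<partial>torus d)
      \<le> C * (2 powr (- 2 * (\<alpha> + \<beta> - (1/2 - 1/q)) * R) * (if \<beta> = 0 then R ^ (d - 1) else 1)) powr (q/2)"
    by (elim exE conjE) (rule that)
  have main: "Lq_norm d q (\<lambda>x. f x - sampling_op d (hyp_cross d R) z M (continuous_rep d f) x)
      \<le> ennreal (C powr (1/q) * (2 powr (- (\<alpha> + \<beta> - (1/2 - 1/q)) * R)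
              * (if \<beta> = 0 then R powr ((real d - 1) / 2) else 1)))"
    if R: "R \<ge> 1" and rec: "reconstructing d (hyp_cross d R) z M"
      and f: "f \<in> hybrid_space d \<alpha> \<beta>" "hybrid_norm d \<alpha> \<beta> f \<le> 1" for R z M f
  proof -
    define \<sigma> where "\<sigma> = \<alpha> + \<beta> - (1/2 - 1/q)"
    define I where "I = hyp_cross d R"
    define c where "c = fourier_coeff d f"
    have M: "0 < M" using rec by (simp add: reconstructing_def)
    have fi: "integrable (torus d) f" using f by (intro L2_space_integrable) (simp add: hybrid_space_def)
    have fm[measurable]: "f \<in> borel_measurable (torus d)" using fi by auto
    interpret absolutely_convergent_series d c
      by standard (simp add: c_def hybrid_space_summable[OF ab d f(1)])
    have ae: "AE x in torus d. series x = f x"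
      by (rule AE_eq_series[OF fi]) (simp add: c_def)
    \<comment> \<open>The sum of the Fourier series witnesses that the choice in
      \<open>continuous_rep\<close> is not empty.\<close>
    have "torus_continuous d (continuous_rep d f) \<and> (AE x in torus d. continuous_rep d f x = f x)"
      unfolding continuous_rep_def by (rule someI[of _ series]) (use torus_continuous_series ae in simp)
    then have cr: "torus_continuous d (continuous_rep d f)" "AE x in torus d. continuous_rep d f x = f x"
      by auto
    have "AE x in torus d. continuous_rep d f x = series x"
      using ae cr(2) by eventually_elim simp
    then have cr_eq: "continuous_rep d f x = series x" if "x \<in> real_vecs d" for x
      by (rule torus_continuous_unique[OF cr(1) torus_continuous_series _ that])
    have S_eq: "sampling_op d I z M (continuous_rep d f) = sampling_op d I z M series"
      by (rule sampling_op_cong) (rule cr_eq)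
    define E where "E x = series x - sampling_op d I z M series x" for x
    define err where "err x = f x - sampling_op d I z M (continuous_rep d f) x" for x
    have err_ae: "AE x in torus d. cmod (E x) powr q = cmod (err x) powr q"
      using ae by eventually_elim (simp add: E_def err_def S_eq)
    have Em: "E \<in> borel_measurable (torus d)"
      unfolding E_def using measurable_series measurable_sampling_op by measurable
    have errm: "err \<in> borel_measurable (torus d)"
      unfolding err_def using measurable_sampling_op by measurable
    define W where "W = bound + real (card I) * bound"
    define En where "En n x = trig_poly d (freq_box d n) c x - sampling_op d I z M (trig_poly d (freq_box d n) c) x" for n x
    have En_le: "cmod (En n x) \<le> W" for n x
    proof -
      have "cmod (trig_poly d (freq_box d n) c y) \<le> bound" for y
        by (intro norm_trig_poly_le finite_freq_box freq_box_subset)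
      then show ?thesis unfolding En_def W_def
        by (intro order_trans[OF norm_triangle_ineq4] add_mono norm_sampling_op_le M)
    qed
    have E_le: "cmod (E x) \<le> W" for x
      unfolding E_def W_def
      by (intro order_trans[OF norm_triangle_ineq4] add_mono norm_sampling_op_le M norm_series_le)
    have lim: "(\<lambda>n. En n x) \<longlonglongrightarrow> E x" for x
      unfolding En_def E_def by (intro tendsto_diff sampling_op_tendsto trig_poly_tendsto)
    define X where "X = 2 powr (- 2 * \<sigma> * R) * (if \<beta> = 0 then R ^ (d - 1) else 1)"
    have X: "X \<ge> 0" using R by (simp add: X_def)
    have En_int: "(\<integral>x. cmod (En n x) powr q \<partial>torus d) \<le> C * X powr (q/2)" for n
    proof -
      have summable: "hybrid_term d \<alpha> \<beta> f summable_on int_vecs d" using f by (simp add: hybrid_space_def)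
      have nonneg: "hybrid_term d \<alpha> \<beta> f k \<ge> 0" for k
        using hybrid_weight_pos[of d \<alpha> \<beta> k] by (simp add: hybrid_term_eq less_imp_le)
      have "(\<Sum>k\<in>freq_box d n. hybrid_weight d \<alpha> \<beta> k * (cmod (c k))\<^sup>2) = (\<Sum>k\<in>freq_box d n. hybrid_term d \<alpha> \<beta> f k)"
        by (simp add: hybrid_term_eq c_def)
      also have "\<dots> \<le> (\<Sum>\<^sub>\<infinity>k\<in>int_vecs d. hybrid_term d \<alpha> \<beta> f k)"
        by (rule finite_sum_le_infsum[OF summable finite_freq_box freq_box_subset]) (rule nonneg)
      also have "\<dots> \<le> 1" using f(2) by (simp add: hybrid_norm_def real_sqrt_le_1_iff)
      finally have "(\<Sum>k\<in>freq_box d n. hybrid_weight d \<alpha> \<beta> k * (cmod (c k))\<^sup>2) \<le> 1" .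
      then show ?thesis
        unfolding En_def X_def \<sigma>_def I_def
        by (intro C(2)[rule_format] conjI R rec finite_freq_box freq_box_subset)
    qed
    have Wq: "AE x in torus d. norm (cmod (g x) powr q) \<le> W powr q" if "\<And>x. cmod (g x) \<le> W" for g
      using that q by (auto intro!: AE_I2 powr_mono2)
    interpret prob_space "torus d" by (rule prob_space_torus)
    have En_m: "En n \<in> borel_measurable (torus d)" for n
      unfolding En_def using measurable_trig_poly measurable_sampling_op by measurable
    have "(\<lambda>n. \<integral>x. cmod (En n x) powr q \<partial>torus d) \<longlonglongrightarrow> (\<integral>x. cmod (E x) powr q \<partial>torus d)"
    proof (rule integral_dominated_convergence[where w="\<lambda>_. W powr q"])
      show "AE x in torus d. (\<lambda>n. cmod (En n x) powr q) \<longlonglongrightarrow> cmod (E x) powr q"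
        using q by (intro AE_I2 tendsto_powr' tendsto_norm lim tendsto_const) auto
      show "AE x in torus d. norm (cmod (En n x) powr q) \<le> W powr q" for n
        by (rule Wq) (rule En_le)
    qed (use Em En_m in measurable)
    then have E_int: "(\<integral>x. cmod (E x) powr q \<partial>torus d) \<le> C * X powr (q/2)"
      by (rule LIMSEQ_le_const2) (use En_int in blast)
    have "integrable (torus d) (\<lambda>x. cmod (E x) powr q)"
      by (rule integrable_const_bound[OF Wq[OF E_le]]) (use Em in measurable)
    then have err_i: "integrable (torus d) (\<lambda>x. cmod (err x) powr q)"
      by (subst integrable_cong_AE[symmetric, OF _ _ err_ae]) (use Em errm in measurable)
    have "(\<integral>x. cmod (err x) powr q \<partial>torus d) = (\<integral>x. cmod (E x) powr q \<partial>torus d)"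
      by (rule integral_cong_AE[symmetric, OF _ _ err_ae]) (use Em errm in measurable)
    also note E_int
    finally have err_int: "(\<integral>x. cmod (err x) powr q \<partial>torus d) \<le> C * X powr (q/2)" .
    have "Lq_norm d q err = ennreal ((\<integral>x. cmod (err x) powr q \<partial>torus d) powr (1/q))"
      using err_i errm by (simp add: Lq_norm_def)
    also have "\<dots> \<le> ennreal ((C * X powr (q/2)) powr (1/q))"
      using q err_int by (intro ennreal_leI powr_mono2) auto
    \<comment> \<open>The powers q/2 and 1/q combine to a square root, which halves the exponent d -
      1 of the logarithmic factor.\<close>
    also have "(C * X powr (q/2)) powr (1/q) = C powr (1/q) * X powr (1/2)"
      using q by (simp add: powr_mult powr_powr)
    also have "X powr (1/2) = 2 powr (- \<sigma> * R) * (if \<beta> = 0 then R powr ((real d - 1) / 2) else 1)"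
    proof -
      have "(2 powr (- 2 * \<sigma> * R)) powr (1/2) = 2 powr (- \<sigma> * R)" by (simp add: powr_powr)
      moreover have "(R ^ (d - 1)) powr (1/2) = R powr ((real d - 1) / 2)"
      proof -
        have "R ^ (d - 1) = R powr real (d - 1)" using R by (simp add: powr_realpow)
        then show ?thesis using d by (simp add: powr_powr of_nat_diff)
      qed
      ultimately show ?thesis by (simp add: X_def powr_mult)
    qed
    finally show ?thesis unfolding err_def I_def \<sigma>_def .
  qed
  show ?thesis
  proof (intro exI[of _ "C powr (1/q)"] conjI allI impI, goal_cases)
    case 1
    then show ?case using C by simp
  next
    case (2 R z M f)
    then show ?case by (intro main) auto
  qed
qed

text \<open>Reconstruction separates the frequencies of \<^term>\<open>hyp_cross d R\<close> modulo \<^term>\<open>M\<close>, and those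
  on a coordinate axis already number at least \<open>2\<^sup>R\<close>.\<close>

lemma two_powr_le_lattice_size:
  assumes rec: "reconstructing d (hyp_cross d R) z M" and R: "R \<ge> 1" and d: "d \<ge> 2"
  shows "2 powr R \<le> real M"
proof -
  \<comment> \<open>Rounding up gives at least \<open>2 powr R\<close> frequencies on the axis. They
    still lie in the cross because n < R + 1 \<le> R + d - 1.\<close>
  define n where "n = nat \<lceil>R\<rceil>"
  have n: "R \<le> real n" "real n < R + 1" using R unfolding n_def by linarith+
  define v where "v i = (\<lambda>s\<in>{..<d}. if s = 0 then int i else 0)" for i :: nat
  have v: "v i \<in> hyp_cross d R" if "i < 2 ^ n" for i
  proof -
    have "int i < int (2 ^ n)" using that by (simp only: of_nat_less_iff)
    then have "lev (int i) \<le> n" by (simp add: lev_le_iff)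
    moreover have "lev 0 = 0" using lev_le_iff[of 0 0] by simp
    then have "level d (v i) = (\<Sum>s<d. if s = 0 then lev (int i) else 0)"
      unfolding level_def by (intro sum.cong) (auto simp: v_def)
    ultimately have "level d (v i) \<le> n" using d by simp
    then have "real (level d (v i)) \<le> R + real d - 1" using n d by linarith
    then show ?thesis by (simp add: mem_hyp_cross_iff int_vecs_def v_def)
  qed
  have M: "0 < M" using rec by (simp add: reconstructing_def)
  have "inj_on (\<lambda>i. freq_dot d (v i) z mod int M) {..<2 ^ n}"
  proof (rule inj_onI)
    fix i j assume ij: "i \<in> {..<2 ^ n}" "j \<in> {..<2 ^ n}"
      and "freq_dot d (v i) z mod int M = freq_dot d (v j) z mod int M"
    then have "int M dvd freq_dot d (v i) z - freq_dot d (v j) z" by (simp add: mod_eq_dvd_iff)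
    then have "v i = v j" using reconstructing_inj[OF rec finite_hyp_cross v v] ij by simp
    from fun_cong[OF this, of 0] show "i = j" using d by (simp add: v_def)
  qed
  moreover have "(\<lambda>i. freq_dot d (v i) z mod int M) ` {..<2 ^ n} \<subseteq> {0..<int M}" using M by auto
  ultimately have "card {..<2 ^ n :: nat} \<le> card {0..<int M}" by (intro card_inj_on_le) auto
  then have "real (2 ^ n) \<le> real M" by (intro of_nat_mono) simp
  then have "2 powr real n \<le> real M" by (simp add: powr_realpow)
  moreover have "2 powr R \<le> 2 powr real n" using n by (intro powr_mono) auto
  ultimately show ?thesis by linarith
qed

text \<open>The upper bound for M, raised to the power \<sigma>/2, trades
  \<open>2 powr (- \<sigma> * R)\<close> for a power of M at the price of a power of R. The lower
  bound gives R \<le> ln M / ln 2, which turns the powers of R into powers of the logarithm; hence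
  the factors 1 / ln 2.\<close>

lemma lattice_rate_bound:
  fixes \<sigma> K \<beta> R :: real and d M :: nat
  assumes \<sigma>: "\<sigma> > 0" and d: "d \<ge> 2" and R: "R \<ge> 1" and lower: "2 powr R \<le> real M"
    and upper: "real M \<le> K * 2 powr (2 * R) * R powr (real d - 2)" and K: "K > 0"
  shows "2 powr (- \<sigma> * R) * (if \<beta> = 0 then R powr ((real d - 1) / 2) else 1)
    \<le> K powr (\<sigma> / 2) * (1 / ln 2) powr ((real d - 2) / 2 * \<sigma>) * (1 / ln 2) powr ((real d - 1) / 2)
      * (real M powr (- \<sigma> / 2) * ln (real M) powr ((real d - 2) / 2 * \<sigma>)
        * (if \<beta> = 0 then ln (real M) powr ((real d - 1) / 2) else 1))"
proof -
  have M: "real M > 0" using lower by (smt (verit) powr_gt_zero)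
  have "ln (2 powr R) \<le> ln (real M)" using lower M by (subst ln_le_cancel_iff) auto
  then have "R * ln 2 \<le> ln (real M)" by (simp only: ln_powr)
  then have RL: "R \<le> 1 / ln 2 * ln (real M)" by (simp add: field_simps)
  have Rp: "R powr e \<le> (1 / ln 2) powr e * ln (real M) powr e" if "e \<ge> 0" for e
  proof -
    have "R powr e \<le> (1 / ln 2 * ln (real M)) powr e" using R RL that by (intro powr_mono2) auto
    then show ?thesis by (simp only: powr_mult)
  qed
  have "2 powr (- \<sigma> * R) \<le> K powr (\<sigma> / 2) * real M powr (- \<sigma> / 2) * R powr ((real d - 2) / 2 * \<sigma>)"
  proof -
    have "real M powr (\<sigma> / 2) \<le> (K * 2 powr (2 * R) * R powr (real d - 2)) powr (\<sigma> / 2)"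
      using M \<sigma> upper by (intro powr_mono2) auto
    also have "\<dots> = K powr (\<sigma> / 2) * 2 powr (\<sigma> * R) * R powr ((real d - 2) / 2 * \<sigma>)"
      by (simp add: powr_mult powr_powr mult_ac)
    finally have le: "real M powr (\<sigma> / 2) \<le> K powr (\<sigma> / 2) * 2 powr (\<sigma> * R) * R powr ((real d - 2) / 2 * \<sigma>)" .
    have inv: "real M powr (\<sigma> / 2) * real M powr (- \<sigma> / 2) = 1"
      "2 powr (\<sigma> * R) * 2 powr (- \<sigma> * R) = 1"
      using M by (simp_all add: powr_add[symmetric])
    have "2 powr (- \<sigma> * R) = real M powr (\<sigma> / 2) * real M powr (- \<sigma> / 2) * 2 powr (- \<sigma> * R)"
      unfolding inv by simp
    also have "\<dots> \<le> K powr (\<sigma> / 2) * 2 powr (\<sigma> * R) * R powr ((real d - 2) / 2 * \<sigma>)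
        * real M powr (- \<sigma> / 2) * 2 powr (- \<sigma> * R)"
      by (intro mult_right_mono le) auto
    also have "\<dots> = K powr (\<sigma> / 2) * real M powr (- \<sigma> / 2) * R powr ((real d - 2) / 2 * \<sigma>)
        * (2 powr (\<sigma> * R) * 2 powr (- \<sigma> * R))"
      by (simp only: mult_ac)
    finally show ?thesis unfolding inv by simp
  qed
  also have "\<dots> \<le> K powr (\<sigma> / 2) * real M powr (- \<sigma> / 2)
      * ((1 / ln 2) powr ((real d - 2) / 2 * \<sigma>) * ln (real M) powr ((real d - 2) / 2 * \<sigma>))"
    using \<sigma> d by (intro mult_left_mono Rp) auto
  finally have A: "2 powr (- \<sigma> * R) \<le> K powr (\<sigma> / 2) * real M powr (- \<sigma> / 2)
      * ((1 / ln 2) powr ((real d - 2) / 2 * \<sigma>) * ln (real M) powr ((real d - 2) / 2 * \<sigma>))" .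
  have B: "(if \<beta> = 0 then R powr ((real d - 1) / 2) else 1)
      \<le> (1 / ln 2) powr ((real d - 1) / 2) * (if \<beta> = 0 then ln (real M) powr ((real d - 1) / 2) else 1)"
  proof (cases "\<beta> = 0")
    case False
    \<comment> \<open>One constant serves both cases: its last factor is at least 1, also where no
      logarithm has to be compared.\<close>
    have "(1::real) \<le> 1 / ln 2" using ln_2_less_1 by (simp add: field_simps)
    then show ?thesis using False d by (simp add: ge_one_powr_ge_zero)
  qed (use Rp[of "(real d - 1) / 2"] d in simp)
  have "2 powr (- \<sigma> * R) * (if \<beta> = 0 then R powr ((real d - 1) / 2) else 1)
      \<le> (K powr (\<sigma> / 2) * real M powr (- \<sigma> / 2)
      * ((1 / ln 2) powr ((real d - 2) / 2 * \<sigma>) * ln (real M) powr ((real d - 2) / 2 * \<sigma>)))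
      * ((1 / ln 2) powr ((real d - 1) / 2) * (if \<beta> = 0 then ln (real M) powr ((real d - 1) / 2) else 1))"
    by (rule mult_mono[OF A B]) auto
  then show ?thesis by (simp only: mult_ac)
qed

theorem proposition4p7:
  fixes \<alpha> \<beta> q K :: real and d :: nat
  assumes "\<alpha> > 1 / 2" and "\<beta> \<le> 0" and "\<alpha> + \<beta> > 1 / 2" and "2 < q" and "d \<ge> 2"
  shows "\<exists>c\<^sub>1>0. \<exists>c\<^sub>2>0. \<forall>(R::real) (z::nat \<Rightarrow> int) (M::nat).
     R \<ge> 1 \<and> reconstructing d (hyp_cross d R) z M \<and> cbc_constructed K d R z M \<longrightarrow>
       op_norm (hybrid_space d \<alpha> \<beta>) (hybrid_norm d \<alpha> \<beta>) (Lq_norm d q)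
           (\<lambda>f x. f x - sampling_op d (hyp_cross d R) z M (continuous_rep d f) x)
         \<le> ennreal (c\<^sub>1 * (2 powr (- (\<alpha> + \<beta> - (1/2 - 1/q)) * R)
              * (if \<beta> = 0 then R powr ((real d - 1) / 2) else 1)))
     \<and> 2 powr (- (\<alpha> + \<beta> - (1/2 - 1/q)) * R)
              * (if \<beta> = 0 then R powr ((real d - 1) / 2) else 1)
         \<le> c\<^sub>2 * (real M powr (- (\<alpha> + \<beta> - (1/2 - 1/q)) / 2)
              * ln (real M) powr ((real d - 2) / 2 * (\<alpha> + \<beta> - (1/2 - 1/q)))
              * (if \<beta> = 0 then ln (real M) powr ((real d - 1) / 2) else 1))"
proof -
  define \<sigma> where "\<sigma> = \<alpha> + \<beta> - (1/2 - 1/q)"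
  have \<sigma>: "\<sigma> > 0"
  proof -
    have "1 / q > 0" using assms(4) by simp
    then show ?thesis using assms(3) unfolding \<sigma>_def by linarith
  qed
  \<comment> \<open>K is an arbitrary real number; the maximum preserves the size bound and keeps
    \<open>c\<^sub>2\<close> positive.\<close>
  define K' where "K' = max K 1"
  define c\<^sub>2 where "c\<^sub>2 = K' powr (\<sigma> / 2) * (1 / ln 2) powr ((real d - 2) / 2 * \<sigma>) * (1 / ln 2) powr ((real d - 1) / 2)"
  have c2: "c\<^sub>2 > 0" by (simp add: c\<^sub>2_def K'_def)
  have "\<alpha> > 0" "d \<ge> 1" using assms by auto
  from Lq_norm_error_bound[OF this(1) assms(2,3) this(2) assms(4)] obtain C where C: "C > 0"
    "\<forall>R z M f. R \<ge> 1 \<and> reconstructing d (hyp_cross d R) z M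
      \<and> f \<in> hybrid_space d \<alpha> \<beta> \<and> hybrid_norm d \<alpha> \<beta> f \<le> 1 \<longrightarrow>
    Lq_norm d q (\<lambda>x. f x - sampling_op d (hyp_cross d R) z M (continuous_rep d f) x)
      \<le> ennreal (C * (2 powr (- (\<alpha> + \<beta> - (1/2 - 1/q)) * R)
              * (if \<beta> = 0 then R powr ((real d - 1) / 2) else 1)))"
    by (elim exE conjE) (rule that)
  show ?thesis
  proof (rule exI[of _ C], rule conjI[OF C(1)], rule exI[of _ c\<^sub>2], rule conjI[OF c2], intro allI impI conjI, goal_cases)
    case (1 R z M)
    then show ?case unfolding op_norm_def by (intro SUP_least C(2)[rule_format]) auto
  next
    case (2 R z M)
    then have R: "R \<ge> 1" and rec: "reconstructing d (hyp_cross d R) z M"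
      and M: "real M \<le> K * 2 powr (2 * R) * R powr (real d - 2)" by (auto simp: cbc_constructed_def)
    have "real M \<le> K' * 2 powr (2 * R) * R powr (real d - 2)"
      by (rule order_trans[OF M]) (auto simp: K'_def intro!: mult_right_mono)
    from lattice_rate_bound[OF \<sigma> assms(5) R two_powr_le_lattice_size[OF rec R assms(5)] this, of \<beta>]
    show ?case unfolding c\<^sub>2_def \<sigma>_def by (simp add: K'_def)
  qed
qed

end
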